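(* Let $d=1$. For every $(1/p,1/q,1/r)$ in the interior of $\mathcal{R}_1$ there exist $\eta=\eta(p,q,r)>0$ and $C$ such that \[ \|\mathcal{A}_1(f_1-\tau_h f_1, f_2)\|_{L^r}\leq C|h|^\eta \|f_1\|_{L^p}\|f_2\|_{L^q} \] for all $h\in\mathbb{R}$ with $|h|<1$ and all $f_1\in L^p(\mathbb{R})$, $f_2\in L^q(\mathbb{R})$.
   Context: For functions on $\mathbb{R}$, $\mathcal{A}_1(f,g)(x)=\int_{0}^{2\pi} f(x-\cos t)g(x-\sin t)\,dt$, and $\tau_h f(x)=f(x-h)$. $\mathcal{R}_1=\{(1/p,1/q,1/r)\in[0,1]^3: \mathcal{A}_1 \text{ is bounded from } L^p(\mathbb{R})\times L^q(\mathbb{R}) \text{ to } L^r(\mathbb{R})\}$. *)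

theory Defs
  imports "HOL-Analysis.Analysis"
begin

text \<open>Exponents are encoded by their reciprocals: a = 1/p with a in [0,1];
  a = 0 corresponds to p = infinity.\<close>

definition enn_powr :: "ennreal \<Rightarrow> real \<Rightarrow> ennreal" where
  "enn_powr x e = (if x = \<infinity> then \<infinity> else ennreal (enn2real x powr e))"

definition lpnorm :: "real \<Rightarrow> (real \<Rightarrow> real) \<Rightarrow> ennreal" where
  "lpnorm a f =
     (if a = 0 then Inf {C::ennreal. AE x in lborel. ennreal \<bar>f x\<bar> \<le> C}
      else enn_powr (\<integral>\<^sup>+ x. ennreal (\<bar>f x\<bar> powr (1 / a)) \<partial>lborel) a)"

definition in_Lp :: "real \<Rightarrow> (real \<Rightarrow> real) \<Rightarrow> bool" where
  "in_Lp a f \<longleftrightarrow> f \<in> borel_measurable borel \<and> lpnorm a f < \<infinity>"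

definition A1 :: "(real \<Rightarrow> real) \<Rightarrow> (real \<Rightarrow> real) \<Rightarrow> real \<Rightarrow> real" where
  "A1 f g x = (LINT t:{0..2*pi}|lborel. f (x - cos t) * g (x - sin t))"

definition A1_bounded :: "real \<Rightarrow> real \<Rightarrow> real \<Rightarrow> bool" where
  "A1_bounded a b c \<longleftrightarrow> (\<exists>C::real. \<forall>f g. in_Lp a f \<longrightarrow> in_Lp b g \<longrightarrow>
      (AE x in lborel. set_integrable lborel {0..2*pi} (\<lambda>t. f (x - cos t) * g (x - sin t))) \<and>
      lpnorm c (A1 f g) \<le> ennreal C * lpnorm a f * lpnorm b g)"

definition R1 :: "(real \<times> real \<times> real) set" where
  "R1 = {(a, b, c). a \<in> {0..1} \<and> b \<in> {0..1} \<and> c \<in> {0..1} \<and> A1_bounded a b c}"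

end

(* Split f and g at the levels l and 1/l with l a small power of 1/|h|. Since the boundedness of A_1
   persists at nearby exponents, the large and the small parts only contribute a negative power of l,
   and it remains to gain a power of |h| for bounded functions with controlled L^1 norms.

   For these, write A_1(F,g)(x) as a sum over the two half circles of integrals of K(x,v) g(v) with
   K(x,v) = F(x - s c(x-v)) w(x-v), where F = f - tau_h f, c(s) = sqrt(1 - s^2), w replaces the arc
   length density 1/c and s is a sign. One Cauchy-Schwarz step bounds the L^2 norm by the integral of
   F(u1) F(u2) F(u3) F(u4) over all rectangles in the (x,v)-plane, u_j being the value of
   x - s c(x-v) at the j-th corner. Here F = Phi' with |Phi| <= |h|, and there is a vector field Z with
   Z u2 = Z u3 = Z u4 = 0 and Z u1 = D, so integrating Z(Phi(u1) F(u2) F(u3) F(u4)) by parts gains |h|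
   wherever the determinant D is not small. The curvature of the circle enters through the smallness
   of the set where D is small: multiplying D by its conjugates yields a polynomial of degree 8 in one
   variable whose leading coefficient is bounded below off a small set. *)
theory Submission
  imports Defs "HOL-Computational_Algebra.Fundamental_Theorem_Algebra"
begin

section \<open>Sublevel sets of polynomials and of the corner determinant\<close>

text \<open>After the Cauchy-Schwarz step only F is left, so nothing but size is ever asked of g.
  The four values u_j depend on the four coordinates x, y, v, w, hence three conditions Z u_j = 0
  still leave a direction, whose components are minors of the Jacobian; up to a factor D is the
  Jacobian determinant. In the divergence no derivative of F survives, only derivatives of the
  coefficients of Z, so bounds on F' never enter the final estimate and F can be passed to a limit.
  Two obstacles shape the details. The slope of c is infinite at the ends of the half circle, so the
  weight w vanishes there to third order in c; the discarded part of the circle has length of order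
  r, a small power of |h|. Division by D is replaced by a bounded function of D, which leaves an
  error concentrated where D is small, and that error is a measure estimate. All losses are fixed
  powers of 1/r, so a large power of r bounding |h| absorbs them. The resulting L^2 estimate is
  carried to the exponent 1/c by comparison with trivial L^1 and supremum bounds, which is possible
  because interior points satisfy 0 < c < 1.\<close>

lemma abs_mult_le: "\<bar>x\<bar> \<le> p \<Longrightarrow> \<bar>y\<bar> \<le> q \<Longrightarrow> \<bar>x * y\<bar> \<le> p * (q::real)"
  by (metis abs_ge_zero abs_mult mult_mono')

lemma abs_add_le: "\<bar>x\<bar> \<le> p \<Longrightarrow> \<bar>y\<bar> \<le> q \<Longrightarrow> \<bar>x + y\<bar> \<le> p + (q::real)"
  by linarith

text \<open>Over the complex numbers the polynomial is its leading coefficient times the product of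
  the x - r_i. A point farther than \<eta> from the real parts of all roots makes every factor
  exceed \<eta>, so one interval of length 2 \<eta> per root covers the sublevel set. The bound sees
  only the degree and the leading coefficient, hence is uniform over families of
  polynomials.\<close>

lemma emeasure_poly_sublevel:
  fixes p :: "real poly" and \<eta> :: real
  assumes deg: "degree p > 0" and \<eta>: "0 \<le> \<eta>"
  shows "emeasure lborel {x. \<bar>poly p x\<bar> \<le> \<bar>lead_coeff p\<bar> * \<eta> ^ degree p} \<le> ennreal (2 * real (degree p) * \<eta>)"
proof -
  define P where "P = map_poly complex_of_real p"
  have degP: "degree P = degree p" and lcP: "lead_coeff P = of_real (lead_coeff p)"
    unfolding P_def by (auto simp: degree_map_poly coeff_map_poly)
  have Peval: "poly P (of_real x) = of_real (poly p x)" for x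
    unfolding P_def by (induction p) (auto simp: map_poly_pCons)
  obtain r where decomp: "smult (lead_coeff P) (\<Prod>i<degree p. [:-r i, 1:]) = P"
    using complex_poly_decompose' degP by metis
  have lc0: "lead_coeff p \<noteq> 0" using deg by auto
  have factor: "\<bar>poly p x\<bar> = \<bar>lead_coeff p\<bar> * (\<Prod>i<degree p. norm (of_real x - r i))" for x
  proof -
    have "of_real (poly p x) = of_real (lead_coeff p) * (\<Prod>i<degree p. (of_real x - r i))"
      using arg_cong[OF decomp, of "\<lambda>q. poly q (of_real x)"] by (simp add: Peval lcP poly_prod)
    then show ?thesis by (metis norm_mult norm_of_real prod_norm)
  qed
  have "{x. \<bar>poly p x\<bar> \<le> \<bar>lead_coeff p\<bar> * \<eta> ^ degree p} \<subseteq> (\<Union>i<degree p. {Re (r i) - \<eta> .. Re (r i) + \<eta>})"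
  proof (rule subsetI, rule ccontr)
    fix x assume x: "x \<in> {x. \<bar>poly p x\<bar> \<le> \<bar>lead_coeff p\<bar> * \<eta> ^ degree p}"
      and nx: "x \<notin> (\<Union>i<degree p. {Re (r i) - \<eta> .. Re (r i) + \<eta>})"
    have far: "norm (of_real x - r i) > \<eta>" if "i < degree p" for i
    proof -
      have "\<bar>x - Re (r i)\<bar> > \<eta>" using nx that by (force simp: abs_if split: if_splits)
      moreover have "\<bar>x - Re (r i)\<bar> \<le> norm (of_real x - r i)" using abs_Re_le_cmod[of "of_real x - r i"] by simp
      ultimately show ?thesis by linarith
    qed
    have "(\<Prod>i<degree p. \<eta>) < (\<Prod>i<degree p. norm (of_real x - r i))"
      using far \<eta> deg le_less_trans[OF \<eta> far] less_imp_le[OF far] by (intro prod_mono_strict) auto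
    then have "\<bar>poly p x\<bar> > \<bar>lead_coeff p\<bar> * \<eta> ^ degree p" using lc0 by (simp add: factor)
    then show False using x by auto
  qed
  then have "emeasure lborel {x. \<bar>poly p x\<bar> \<le> \<bar>lead_coeff p\<bar> * \<eta> ^ degree p}
     \<le> emeasure lborel (\<Union>i<degree p. {Re (r i) - \<eta> .. Re (r i) + \<eta>})"
    by (rule emeasure_mono) auto
  also have "\<dots> \<le> (\<Sum>i<degree p. emeasure lborel {Re (r i) - \<eta> .. Re (r i) + \<eta>})"
    by (rule emeasure_subadditive_finite) auto
  also have "\<dots> = (\<Sum>i<degree p. ennreal (2 * \<eta>))" using \<eta> by (intro sum.cong) auto
  also have "\<dots> = ennreal (2 * real (degree p) * \<eta>)"
    using \<eta> by (simp add: ennreal_of_nat_eq_real_of_nat ennreal_mult[symmetric] mult_ac)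
  finally show ?thesis .
qed

text \<open>\<open>max 0\<close> continues the half circle by 0 to a continuous function on the
  line, so that integrals over all positions of the corners make sense without side
  conditions.\<close>

definition circ :: "real \<Rightarrow> real" where "circ s = sqrt (max 0 (1 - s\<^sup>2))"

lemma circ_ge_0 [simp]: "0 \<le> circ s" and circ_le_1 [simp]: "circ s \<le> 1"
  by (auto simp: circ_def)

lemma circ_sq: "\<bar>s\<bar> \<le> 1 \<Longrightarrow> (circ s)\<^sup>2 = 1 - s\<^sup>2"
  by (simp add: circ_def abs_square_le_1)

lemma circ_eq_0: "\<bar>s\<bar> \<ge> 1 \<Longrightarrow> circ s = 0"
  using abs_le_square_iff[of 1 s] by (simp add: circ_def)

text \<open>For |s| < 1 and s = x - v, \<open>circ_lin \<sigma> s / circ s\<close> is the derivative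
  of x - \<sigma> c(x - v) in x, because c' = -s/c; the derivative in v is -\<sigma> s/c. These are
  the entries of the Jacobian behind the determinant below.\<close>

definition circ_lin :: "real \<Rightarrow> real \<Rightarrow> real" where "circ_lin \<sigma> s = circ s + \<sigma> * s"

text \<open>The corners are $1 = (x,v)$, $2 = (y,v)$, $3 = (x,w)$, $4 = (y,w)$, and $s_j$ is the difference
  of the coordinates of corner $j$, so that $s_3 = s_1 + s_4 - s_2$. Up to the factor $c(s_1)c(s_2)c(s_3)c(s_4)$, this
  is the Jacobian of the four values $x - \sigma c(x - v)$ with respect to $(x, y, v, w)$.\<close>

definition corner_det :: "real \<Rightarrow> real \<Rightarrow> real \<Rightarrow> real \<Rightarrow> real \<Rightarrow> real" where
  "corner_det \<sigma> s1 s2 s3 s4 = circ_lin \<sigma> s1 * s3 * circ_lin \<sigma> s4 * s2 - s1 * circ_lin \<sigma> s3 * s4 * circ_lin \<sigma> s2"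

text \<open>As a function of $s = s_1$ the determinant is $X + Y - Z$ with $X$ a polynomial and $Y$, $Z$ multiples
  of $c(s_1)$ and $c(s_3)$. The product of the four conjugates $X \pm Y \pm Z$ is a polynomial in $X^2$, $Y^2$, $Z^2$.\<close>

definition det_poly :: "real \<Rightarrow> real \<Rightarrow> real \<Rightarrow> real poly" where
  "det_poly a b e = (let X = smult ((a - b)\<^sup>2) ([:0,1:]^2 * [:e,1:]^2);
     Y = smult (a\<^sup>2) ([:e,1:]^2 * (1 - [:0,1:]^2)); Z = smult (b\<^sup>2) ([:0,1:]^2 * (1 - [:e,1:]^2))
    in X^2 + Y^2 + Z^2 - smult 2 (X*Y) - smult 2 (Y*Z) - smult 2 (X*Z))"

lemma poly_det_poly: "poly (det_poly a b e) s = 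
  (let X = (a-b)\<^sup>2 * (s^2 * (e+s)^2); Y = a\<^sup>2 * ((e+s)^2*(1-s^2)); Z = b^2 * (s^2*(1-(e+s)^2)) 
  in X^2 + Y^2 + Z^2 - 2*(X*Y) - 2*(Y*Z) - 2*(X*Z))"
  by (simp add: det_poly_def Let_def)

text \<open>The coefficients of s^4 in the three squares are (a-b)^2, -a^2 and -b^2. At these values
  the form A^2 + B^2 + C^2 - 2AB - 2BC - 2AC equals (a-b)^2 ((a-b)^2 + (a+b)^2 + 2(a^2+b^2)), which
  is the last coefficient.\<close>

lemma det_poly_eq: "\<exists>c0 c1 c2 c3 c4 c5 c6 c7. det_poly a b e = [:c0,c1,c2,c3,c4,c5,c6,c7, 4*(a^2+b^2)*(a-b)^2:]"
  apply (simp add: det_poly_def Let_def power2_eq_square one_pCons)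
  apply (simp add: algebra_simps)
  done


text \<open>The determinant is one of the four conjugate factors of the polynomial, and each of the
  other three is at most 4 + 2 + 2 = 8 in absolute value, whence 512.\<close>

lemma corner_det_sublevel_subset:
  assumes \<sigma>: "\<sigma>\<^sup>2 = 1" and s2: "\<bar>s2\<bar> \<le> 1" and s4: "\<bar>s4\<bar> \<le> 1"
    and s1: "\<bar>s1\<bar> \<le> 1" and s3: "\<bar>s1 + s4 - s2\<bar> \<le> 1"
  shows "\<bar>poly (det_poly (s2 * circ_lin \<sigma> s4) (s4 * circ_lin \<sigma> s2) (s4 - s2)) s1\<bar> \<le> 512 * \<bar>corner_det \<sigma> s1 s2 (s1 + s4 - s2) s4\<bar>"
proof -
  define a where "a = s2 * circ_lin \<sigma> s4"
  define b where "b = s4 * circ_lin \<sigma> s2"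
  define t where "t = s1 + s4 - s2"
  define X where "X = \<sigma> * (a - b) * (s1 * t)"
  define Y where "Y = a * (t * circ s1)"
  define Z where "Z = b * (s1 * circ t)"
  have \<sigma>1: "\<bar>\<sigma>\<bar> = 1" using \<sigma> by (simp add: power2_eq_1_iff) auto
  have nnb: "\<bar>circ_lin \<sigma> s\<bar> \<le> 2" if "\<bar>s\<bar> \<le> 1" for s
  proof -
    have "\<bar>circ_lin \<sigma> s\<bar> \<le> \<bar>circ s\<bar> + \<bar>\<sigma> * s\<bar>" unfolding circ_lin_def by (rule abs_triangle_ineq)
    also have "\<bar>\<sigma> * s\<bar> \<le> 1" using that \<sigma>1 by (simp add: abs_mult)
    finally show ?thesis using circ_le_1[of s] circ_ge_0[of s] by linarith
  qed
  have a: "\<bar>a\<bar> \<le> 2" using abs_mult_le[OF s2 nnb[OF s4]] by (simp add: a_def)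
  have b: "\<bar>b\<bar> \<le> 2" using abs_mult_le[OF s4 nnb[OF s2]] by (simp add: b_def)
  have t: "\<bar>t\<bar> \<le> 1" using s3 by (simp add: t_def)
  have c: "\<bar>circ s\<bar> \<le> 1" for s by simp
  have "\<bar>\<sigma> * (a - b)\<bar> \<le> 1 * 4" using \<sigma>1 a b by (intro abs_mult_le) auto
  then have X: "\<bar>X\<bar> \<le> 4" using abs_mult_le[OF _ abs_mult_le[OF s1 t]] unfolding X_def by fastforce
  have Y: "\<bar>Y\<bar> \<le> 2" using abs_mult_le[OF a abs_mult_le[OF t c]] unfolding Y_def by simp
  have Z: "\<bar>Z\<bar> \<le> 2" using abs_mult_le[OF b abs_mult_le[OF s1 c]] unfolding Z_def by simp
  \<comment> \<open>Only the moving corners 1 and 3 are expanded; the data of corners 2 and 4 stay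
    hidden in a and b. The terms without c(s1) and c(t) form X.\<close>
  have D: "corner_det \<sigma> s1 s2 t s4 = X + Y - Z"
    unfolding corner_det_def X_def Y_def Z_def circ_lin_def[of _ s1] circ_lin_def[of _ t] a_def b_def by (simp add: algebra_simps)
  have sq: "X^2 = (a-b)\<^sup>2 * (s1^2 * t^2)" "Y^2 = a\<^sup>2 * (t^2*(1-s1^2))" "Z^2 = b\<^sup>2 * (s1^2*(1-t^2))"
    using \<sigma> circ_sq[OF s1] circ_sq[OF t] by (simp_all add: X_def Y_def Z_def power_mult_distrib)
  have t': "s4 - s2 + s1 = t" by (simp add: t_def)
  have "poly (det_poly a b (s4 - s2)) s1 = (X+Y-Z) * ((X+Y+Z) * ((X-Y-Z) * (X-Y+Z)))"
    unfolding poly_det_poly Let_def t' sq[symmetric] by algebra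
  then have "\<bar>poly (det_poly a b (s4 - s2)) s1\<bar> = \<bar>X+Y-Z\<bar> * \<bar>(X+Y+Z) * ((X-Y-Z) * (X-Y+Z))\<bar>" by (simp add: abs_mult)
  also have "\<bar>(X+Y+Z) * ((X-Y-Z) * (X-Y+Z))\<bar> \<le> 8 * (8 * 8)" using X Y Z by (intro abs_mult_le) auto
  finally show ?thesis using D by (simp add: a_def b_def t_def mult_left_mono)
qed

lemma det_poly_degree_lead:
  assumes "a \<noteq> b"
  shows "degree (det_poly a b e) = 8" "lead_coeff (det_poly a b e) = 4*(a^2+b^2)*(a-b)^2"
proof -
  obtain c0 c1 c2 c3 c4 c5 c6 c7 where d: "det_poly a b e = [:c0,c1,c2,c3,c4,c5,c6,c7, 4*(a^2+b^2)*(a-b)^2:]"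
    using det_poly_eq by blast
  have "a^2 + b^2 > 0" using assms by (auto simp: sum_power2_gt_zero_iff)
  then have "4*(a^2+b^2)*(a-b)^2 \<noteq> 0" using assms by auto
  then show "degree (det_poly a b e) = 8" "lead_coeff (det_poly a b e) = 4*(a^2+b^2)*(a-b)^2" unfolding d by simp_all
qed

text \<open>Curvature enters through (a - b)(s2 c(s4) + s4 c(s2)) = s2^2 - s4^2: separated squares
  force |a - b| >= \<theta>^2/2, and since 4(a^2+b^2)(a-b)^2 >= 2(a-b)^4 the leading coefficient is
  at least \<theta>^8/8.\<close>

lemma emeasure_corner_det_sublevel:
  assumes \<sigma>: "\<sigma>\<^sup>2 = 1" and s2: "\<bar>s2\<bar> \<le> 1" and s4: "\<bar>s4\<bar> \<le> 1" and \<theta>: "0 < \<theta>"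
    and sep: "\<bar>s2\<^sup>2 - s4\<^sup>2\<bar> \<ge> \<theta>\<^sup>2"
  shows "emeasure lborel {s1. \<bar>s1\<bar> \<le> 1 \<and> \<bar>s1 + s4 - s2\<bar> \<le> 1 \<and> \<bar>corner_det \<sigma> s1 s2 (s1 + s4 - s2) s4\<bar> \<le> \<theta> ^ 16}
    \<le> ennreal (48 * \<theta>)"
proof -
  define a where "a = s2 * circ_lin \<sigma> s4"
  define b where "b = s4 * circ_lin \<sigma> s2"
  have ab: "a - b = s2 * circ s4 - s4 * circ s2" by (simp add: a_def b_def circ_lin_def algebra_simps)
  have "(s2 * circ s4 - s4 * circ s2) * (s2 * circ s4 + s4 * circ s2) = s2\<^sup>2 * (circ s4)\<^sup>2 - s4\<^sup>2 * (circ s2)\<^sup>2"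
    by (simp add: algebra_simps power2_eq_square)
  also have "\<dots> = s2\<^sup>2 - s4\<^sup>2" using s2 s4 by (simp add: circ_sq algebra_simps)
  finally have "\<bar>a - b\<bar> * \<bar>s2 * circ s4 + s4 * circ s2\<bar> = \<bar>s2\<^sup>2 - s4\<^sup>2\<bar>" by (simp add: ab abs_mult[symmetric])
  moreover have "\<bar>s2 * circ s4 + s4 * circ s2\<bar> \<le> 2"
  proof -
    have "\<bar>s2 * circ s4\<bar> \<le> 1" "\<bar>s4 * circ s2\<bar> \<le> 1" using s2 s4 by (simp_all add: abs_mult mult_le_one)
    then show ?thesis by linarith
  qed
  ultimately have "\<theta>\<^sup>2 \<le> \<bar>a - b\<bar> * 2" using sep mult_left_mono[of _ 2 "\<bar>a - b\<bar>"] by (metis abs_ge_zero order_trans)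
  then have dab: "\<theta>\<^sup>2 / 2 \<le> \<bar>a - b\<bar>" by simp
  then have neq: "a \<noteq> b" using \<theta> by auto
  have "(\<theta>\<^sup>2 / 2)^4 \<le> \<bar>a - b\<bar>^4" using dab \<theta> by (intro power_mono) auto
  also have "\<dots> = (a-b)\<^sup>2 * (a-b)\<^sup>2" by (simp add: power_even_abs power_add[symmetric])
  also have "\<dots> \<le> (2*(a^2+b^2)) * (a-b)\<^sup>2"
  proof (rule mult_right_mono)
    have "0 \<le> (a+b)^2" by simp
    also have "(a+b)^2 = 2 * (a\<^sup>2 + b\<^sup>2) - (a-b)^2" by algebra
    finally show "(a-b)\<^sup>2 \<le> 2*(a^2+b^2)" by simp
  qed simp
  finally have "\<theta>^8 / 16 \<le> 2*(a^2+b^2) * (a-b)\<^sup>2" by (simp add: power_divide power_mult[symmetric])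
  then have lead: "\<theta>^8 / 8 \<le> lead_coeff (det_poly a b (s4 - s2))" unfolding det_poly_degree_lead(2)[OF neq] by linarith
  define l where "l = lead_coeff (det_poly a b (s4 - s2))"
  have deg: "degree (det_poly a b (s4 - s2)) = 8" using det_poly_degree_lead[OF neq] by simp
  \<comment> \<open>The radius 3 \<theta> suffices because 3^8 = 6561 exceeds 8 * 512; eight
    intervals of that radius have total length 48 \<theta>.\<close>
  have "512 * \<theta>^16 \<le> \<bar>l\<bar> * (3*\<theta>)^8"
  proof -
    have "(\<theta>^8/8) * (3*\<theta>)^8 = 6561 / 8 * \<theta>^16"
      by (simp add: power_mult_distrib flip: power_add)
    moreover have "512 * \<theta>^16 \<le> 6561 / 8 * \<theta>^16" using zero_le_power[of \<theta> 16] \<theta> by linarith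
    ultimately have "512 * \<theta>^16 \<le> (\<theta>^8/8) * (3*\<theta>)^8" by (simp only:)
    also have "\<dots> \<le> \<bar>l\<bar> * (3*\<theta>)^8" using lead \<theta> by (intro mult_right_mono) (auto simp: l_def)
    finally show ?thesis .
  qed
  then have sub: "{s1. \<bar>s1\<bar> \<le> 1 \<and> \<bar>s1 + s4 - s2\<bar> \<le> 1 \<and> \<bar>corner_det \<sigma> s1 s2 (s1 + s4 - s2) s4\<bar> \<le> \<theta> ^ 16}
     \<subseteq> {x. \<bar>poly (det_poly a b (s4 - s2)) x\<bar> \<le> \<bar>l\<bar> * (3*\<theta>)^8}"
    using corner_det_sublevel_subset[OF \<sigma> s2 s4] unfolding a_def[symmetric] b_def[symmetric] by fastforce
  have "emeasure lborel {s1. \<bar>s1\<bar> \<le> 1 \<and> \<bar>s1 + s4 - s2\<bar> \<le> 1 \<and> \<bar>corner_det \<sigma> s1 s2 (s1 + s4 - s2) s4\<bar> \<le> \<theta> ^ 16}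
    \<le> emeasure lborel {x. \<bar>poly (det_poly a b (s4 - s2)) x\<bar> \<le> \<bar>l\<bar> * (3*\<theta>)^8}"
    by (rule emeasure_mono[OF sub]) (auto intro!: borel_closed closed_Collect_le continuous_intros)
  also have "\<dots> \<le> ennreal (48 * \<theta>)"
    using emeasure_poly_sublevel[of "det_poly a b (s4 - s2)" "3*\<theta>"] \<theta> by (simp add: deg l_def)
  finally show ?thesis .
qed

section \<open>Smoothed arc length weight\<close>

lemma circ_eq_sqrt: "\<bar>s\<bar> \<le> 1 \<Longrightarrow> circ s = sqrt (1 - s\<^sup>2)"
  by (simp add: circ_def abs_square_le_1)

lemma continuous_circ: "continuous_on A circ"
  unfolding circ_def by (intro continuous_intros)

lemma borel_circ [measurable]: "circ \<in> borel_measurable borel"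
  using continuous_circ by (rule borel_measurable_continuous_onI)

text \<open>Also correct for $|s| > 1$, where $c = 0$ and the quotient is $0$ by convention.\<close>

definition dcirc :: "real \<Rightarrow> real" where "dcirc s = - s / circ s"

lemma borel_dcirc [measurable]: "dcirc \<in> borel_measurable borel"
  unfolding dcirc_def by measurable

lemma circ_pos: "\<bar>s\<bar> < 1 \<Longrightarrow> 0 < circ s"
  using abs_square_less_1[of s] by (simp add: circ_eq_sqrt)

lemma dcirc_eq_0: "\<bar>s\<bar> \<ge> 1 \<Longrightarrow> dcirc s = 0"
  by (simp add: dcirc_def circ_eq_0)

lemma DERIV_circ:
  assumes "\<bar>s\<bar> \<noteq> 1"
  shows "(circ has_real_derivative dcirc s) (at s)"
proof (cases "\<bar>s\<bar> < 1")
  case True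
  have "0 < 1 - s\<^sup>2" using True abs_square_less_1[of s] by simp
  then have "((\<lambda>s. sqrt (1 - s\<^sup>2)) has_real_derivative dcirc s) (at s)"
    using circ_eq_sqrt[of s] True by (auto intro!: derivative_eq_intros simp: dcirc_def divide_simps)
  then show ?thesis
    by (rule has_field_derivative_transform_within_open[where S = "{-1<..<1}"]) (use True in \<open>auto simp: circ_eq_sqrt\<close>)
next
  case False
  with assms have s: "\<bar>s\<bar> > 1" by auto
  have "((\<lambda>s. 0) has_real_derivative dcirc s) (at s)" using s by (simp add: dcirc_eq_0)
  then show ?thesis
    by (rule has_field_derivative_transform_within_open[where S = "{..<-1} \<union> {1<..}"]) (use s in \<open>auto simp: circ_eq_0\<close>)
qed

text \<open>The density $1/c$ times $(c^2/(c^2+\delta))^2$; the extra factor makes products with the derivative of $c$ bounded.\<close>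

definition wt :: "real \<Rightarrow> real \<Rightarrow> real" where "wt \<delta> s = circ s ^ 3 / ((circ s)\<^sup>2 + \<delta>)\<^sup>2"

definition dwt :: "real \<Rightarrow> real \<Rightarrow> real" where
  "dwt \<delta> s = dcirc s * (3 * (circ s)\<^sup>2 / ((circ s)\<^sup>2 + \<delta>)\<^sup>2 - 4 * circ s ^ 4 / ((circ s)\<^sup>2 + \<delta>) ^ 3)"

lemma borel_wt [measurable]: "wt \<delta> \<in> borel_measurable borel"
  unfolding wt_def by measurable

lemma borel_dwt [measurable]: "dwt \<delta> \<in> borel_measurable borel"
  unfolding dwt_def by measurable

lemma wt_eq_0: "\<bar>s\<bar> \<ge> 1 \<Longrightarrow> wt \<delta> s = 0"
  by (simp add: wt_def circ_eq_0)

lemma dwt_eq_0: "\<bar>s\<bar> \<ge> 1 \<Longrightarrow> dwt \<delta> s = 0"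
  by (simp add: dwt_def dcirc_eq_0)

lemma continuous_wt:
  assumes "\<delta> > 0" shows "continuous_on A (wt \<delta>)"
proof -
  have "(circ s)\<^sup>2 + \<delta> \<noteq> 0" for s using assms add_nonneg_pos[of "(circ s)\<^sup>2" \<delta>] by simp
  then show ?thesis unfolding wt_def by (intro continuous_intros continuous_circ) simp
qed

lemma DERIV_wt:
  assumes "\<bar>s\<bar> \<noteq> 1" "\<delta> > 0"
  shows "(wt \<delta> has_real_derivative dwt \<delta> s) (at s)"
proof -
  have p: "0 < (circ s)\<^sup>2 + \<delta>" using assms by (simp add: add_nonneg_pos)
  let ?c = "circ s" and ?d = "dcirc s"
  define S where "S = ?c\<^sup>2 + \<delta>"
  have S: "S \<noteq> 0" using p by (simp add: S_def)
  have c3: "((\<lambda>s. circ s ^ 3) has_real_derivative 3 * ?c\<^sup>2 * ?d) (at s)"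
    using DERIV_power[OF DERIV_circ[OF assms(1)], of 3] by (simp add: mult_ac)
  have c2: "((\<lambda>s. ((circ s)\<^sup>2 + \<delta>)) has_real_derivative 2 * ?c * ?d) (at s)"
    using DERIV_add[OF DERIV_power[OF DERIV_circ[OF assms(1)], of 2] DERIV_const, of \<delta>] by (simp add: mult_ac)
  have c4: "((\<lambda>s. ((circ s)\<^sup>2 + \<delta>)\<^sup>2) has_real_derivative 2 * S * (2 * ?c * ?d)) (at s)"
    using DERIV_power[OF c2, of 2] by (simp add: mult_ac S_def)
  have "((\<lambda>s. circ s ^ 3 / ((circ s)\<^sup>2 + \<delta>)\<^sup>2) has_real_derivative
     (3 * ?c\<^sup>2 * ?d * S\<^sup>2 - ?c ^ 3 * (2 * S * (2 * ?c * ?d))) / (S\<^sup>2 * S\<^sup>2)) (at s)"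
    using DERIV_divide[OF c3 c4] p S by (simp add: S_def)
  also have "(3 * ?c\<^sup>2 * ?d * S\<^sup>2 - ?c ^ 3 * (2 * S * (2 * ?c * ?d))) / (S\<^sup>2 * S\<^sup>2) = dwt \<delta> s"
    unfolding dwt_def S_def[symmetric] using S by (simp add: divide_simps) algebra
  finally show ?thesis unfolding wt_def .
qed

lemma circ_quotient:
  assumes "0 < \<delta>"
  shows "0 \<le> (circ s)\<^sup>2 / ((circ s)\<^sup>2 + \<delta>)" "(circ s)\<^sup>2 / ((circ s)\<^sup>2 + \<delta>) \<le> 1" "1 / ((circ s)\<^sup>2 + \<delta>) \<le> 1 / \<delta>" "0 \<le> 1 / ((circ s)\<^sup>2 + \<delta>)"
  using assms by (auto simp: divide_simps add_nonneg_pos)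

lemma wt_ge_0 [simp]: "0 \<le> wt \<delta> s"
  by (simp add: wt_def)

lemma wt_le:
  assumes "0 < \<delta>" shows "wt \<delta> s \<le> 1 / \<delta>"
proof -
  have "wt \<delta> s = circ s * ((circ s)\<^sup>2 / ((circ s)\<^sup>2 + \<delta>)) * (1 / ((circ s)\<^sup>2 + \<delta>))"
    by (simp add: wt_def power2_eq_square power3_eq_cube)
  also have "\<dots> \<le> 1 * 1 * (1 / \<delta>)"
    using circ_quotient[OF assms] by (intro mult_mono) auto
  finally show ?thesis by simp
qed

text \<open>The slope of c has a pole like 1/c at the end points. One of the three powers of c in
  the weight cancels it, which leaves |s| c^2/(c^2+\<delta>)^2.\<close>

lemma wt_dcirc_le:
  assumes "0 < \<delta>" "\<delta> \<le> 1" shows "wt \<delta> s * \<bar>dcirc s\<bar> \<le> 1 / \<delta>\<^sup>2"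
proof (cases "\<bar>s\<bar> < 1")
  case True
  let ?q = "(circ s)\<^sup>2 / ((circ s)\<^sup>2 + \<delta>)"
  have "wt \<delta> s * \<bar>dcirc s\<bar> = \<bar>s\<bar> * ?q * (1 / ((circ s)\<^sup>2 + \<delta>))"
    using circ_pos[OF True] by (simp add: wt_def dcirc_def power2_eq_square power3_eq_cube)
  also have "\<dots> \<le> 1 * 1 * (1 / \<delta>)"
    using circ_quotient[OF assms(1)] True by (intro mult_mono) auto
  also have "\<dots> \<le> 1 / \<delta>\<^sup>2" using assms by (simp add: divide_simps power2_eq_square)
  finally show ?thesis .
qed (use assms in \<open>simp add: dcirc_eq_0\<close>)

lemma dwt_le:
  assumes "0 < \<delta>" "\<delta> \<le> 1" shows "\<bar>dwt \<delta> s\<bar> \<le> 7 / \<delta>\<^sup>2"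
proof (cases "\<bar>s\<bar> < 1")
  case True
  let ?q = "(circ s)\<^sup>2 / ((circ s)\<^sup>2 + \<delta>)" and ?r = "1 / ((circ s)\<^sup>2 + \<delta>)"
  have q: "0 \<le> ?q" "?q \<le> 1" and r: "?r \<le> 1 / \<delta>" "0 \<le> ?r" using circ_quotient[OF assms(1), of s] by auto
  have q7: "\<bar>3 - 4 * ?q\<bar> \<le> 7" using q by linarith
  have p: "0 < (circ s)\<^sup>2 + \<delta>" using assms by (simp add: add_nonneg_pos)
  \<comment> \<open>Once the pole of c' is cancelled a factor c still remains, so two factors
    1/(c^2+\<delta>) are the only large quantities.\<close>
  have "dwt \<delta> s = - s * circ s * (3 - 4 * ?q) * (?r * ?r)"
  proof -
    define c where "c = circ s"
    define S where "S = c\<^sup>2 + \<delta>"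
    have "c \<noteq> 0" "S \<noteq> 0" using circ_pos[OF True] p by (auto simp: c_def S_def)
    then show ?thesis unfolding dwt_def dcirc_def c_def[symmetric] S_def[symmetric]
      by (simp add: divide_simps) algebra
  qed
  then have "\<bar>dwt \<delta> s\<bar> = \<bar>s\<bar> * circ s * \<bar>3 - 4 * ?q\<bar> * (?r * ?r)" using p by (simp add: abs_mult)
  also have "\<dots> \<le> 1 * 1 * 7 * ((1/\<delta>) * (1/\<delta>))"
    using q r True assms q7 by (intro mult_mono) auto
  finally show ?thesis by (simp add: power2_eq_square)
qed (use assms in \<open>simp add: dwt_eq_0\<close>)

section \<open>Coefficients of the vector field and their derivatives\<close>

definition dcirc_lin :: "real \<Rightarrow> real \<Rightarrow> real" where "dcirc_lin \<sigma> s = dcirc s + \<sigma>"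

text \<open>Each component of the vector field is a product with one expression per corner, and this
  expression is s, c(s) or c(s) + \<sigma> s. With names for the three kinds, one derivative formula
  and one bound serve all four components.\<close>

datatype factor = Fac_s | Fac_c | Fac_n

fun fac :: "real \<Rightarrow> factor \<Rightarrow> real \<Rightarrow> real" where
  "fac \<sigma> Fac_s s = s" | "fac \<sigma> Fac_c s = circ s" | "fac \<sigma> Fac_n s = circ_lin \<sigma> s"

fun dfac :: "real \<Rightarrow> factor \<Rightarrow> real \<Rightarrow> real" where
  "dfac \<sigma> Fac_s s = 1" | "dfac \<sigma> Fac_c s = dcirc s" | "dfac \<sigma> Fac_n s = dcirc_lin \<sigma> s"

lemma borel_circ_lin [measurable]: "circ_lin \<sigma> \<in> borel_measurable borel" "dcirc_lin \<sigma> \<in> borel_measurable borel"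
  unfolding circ_lin_def dcirc_lin_def by measurable

lemma continuous_circ_lin: "continuous_on A (circ_lin \<sigma>)"
  unfolding circ_lin_def by (intro continuous_intros continuous_circ)

lemma borel_fac [measurable]: "fac \<sigma> k \<in> borel_measurable borel" "dfac \<sigma> k \<in> borel_measurable borel"
  by (cases k; simp add: borel_circ_lin borel_circ borel_dcirc cong: measurable_cong)+

lemma continuous_fac: "continuous_on A (fac \<sigma> k)"
  by (cases k) (auto intro!: continuous_intros continuous_circ continuous_circ_lin simp: fac.simps[abs_def] cong: continuous_on_cong)

lemma DERIV_fac:
  assumes "\<bar>s\<bar> \<noteq> 1" shows "(fac \<sigma> k has_real_derivative dfac \<sigma> k s) (at s)"
proof (cases k)
  case Fac_n
  have "((\<lambda>s. circ s + \<sigma> * s) has_real_derivative dcirc s + \<sigma>) (at s)"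
    by (rule DERIV_add DERIV_circ[OF assms] DERIV_cmult_Id)+
  then show ?thesis by (simp add: Fac_n fac.simps[abs_def] circ_lin_def[abs_def] dcirc_lin_def)
qed (simp_all add: fac.simps[abs_def] DERIV_circ[OF assms])

lemma fac_le:
  assumes "\<bar>\<sigma>\<bar> = 1" "\<bar>s\<bar> \<le> 1" shows "\<bar>fac \<sigma> k s\<bar> \<le> 2"
proof -
  have "\<bar>circ_lin \<sigma> s\<bar> \<le> \<bar>circ s\<bar> + \<bar>\<sigma> * s\<bar>" unfolding circ_lin_def by (rule abs_triangle_ineq)
  moreover have "\<bar>\<sigma> * s\<bar> \<le> 1" using assms by (simp add: abs_mult)
  ultimately have "\<bar>circ_lin \<sigma> s\<bar> \<le> 2" using circ_le_1[of s] circ_ge_0[of s] by linarith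
  then show ?thesis using assms circ_le_1[of s] circ_ge_0[of s] by (cases k) (auto simp del: circ_ge_0 circ_le_1)
qed

lemma wt_dfac_le:
  assumes "\<bar>\<sigma>\<bar> = 1" "0 < \<delta>" "\<delta> \<le> 1" shows "wt \<delta> s * \<bar>dfac \<sigma> k s\<bar> \<le> 2 / \<delta>\<^sup>2"
proof -
  have 1: "wt \<delta> s \<le> 1 / \<delta>\<^sup>2"
    using wt_le[OF assms(2), of s] assms by (elim order_trans) (simp add: divide_simps power2_eq_square)
  have 2: "wt \<delta> s * \<bar>dcirc s\<bar> \<le> 1 / \<delta>\<^sup>2" using wt_dcirc_le assms by auto
  have "wt \<delta> s * \<bar>dcirc_lin \<sigma> s\<bar> \<le> wt \<delta> s * (\<bar>dcirc s\<bar> + 1)"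
    using assms(1) unfolding dcirc_lin_def by (intro mult_left_mono) (auto intro: order_trans[OF abs_triangle_ineq])
  then have 3: "wt \<delta> s * \<bar>dcirc_lin \<sigma> s\<bar> \<le> 2 / \<delta>\<^sup>2" using 1 2 by (simp add: algebra_simps)
  have "1 / \<delta>\<^sup>2 \<le> 2 / \<delta>\<^sup>2" using assms by (simp add: divide_right_mono)
  then show ?thesis using 1 2 3 by (cases k) auto
qed

text \<open>A regularised $1/y$: the factor $y \cdot \tau(y) = y^2/(y^2+\epsilon^2)$ is close to $1$ for $|y|$ much larger than $\epsilon$.\<close>

definition tau :: "real \<Rightarrow> real \<Rightarrow> real" where "tau \<epsilon> y = y / (y\<^sup>2 + \<epsilon>\<^sup>2)"
definition dtau :: "real \<Rightarrow> real \<Rightarrow> real" where "dtau \<epsilon> y = (\<epsilon>\<^sup>2 - y\<^sup>2) / (y\<^sup>2 + \<epsilon>\<^sup>2)\<^sup>2"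

lemma borel_tau [measurable]: "tau \<epsilon> \<in> borel_measurable borel" "dtau \<epsilon> \<in> borel_measurable borel"
  unfolding tau_def dtau_def by measurable

lemma DERIV_tau:
  assumes "\<epsilon> > 0" shows "(tau \<epsilon> has_real_derivative dtau \<epsilon> y) (at y)"
proof -
  have p: "y\<^sup>2 + \<epsilon>\<^sup>2 \<noteq> 0" using assms add_nonneg_pos[of "y\<^sup>2" "\<epsilon>\<^sup>2"] by simp
  have "((\<lambda>y. y\<^sup>2 + \<epsilon>\<^sup>2) has_real_derivative 2 * y) (at y)"
    using DERIV_add[OF DERIV_power[OF DERIV_ident, of 2] DERIV_const] by simp
  from DERIV_divide[OF DERIV_ident this p]
  have "(tau \<epsilon> has_real_derivative (1 * (y\<^sup>2 + \<epsilon>\<^sup>2) - y * (2 * y)) / ((y\<^sup>2 + \<epsilon>\<^sup>2) * (y\<^sup>2 + \<epsilon>\<^sup>2))) (at y)"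
    by (simp add: tau_def[abs_def])
  then show ?thesis by (simp add: dtau_def power2_eq_square)
qed

lemma continuous_tau: "\<epsilon> > 0 \<Longrightarrow> continuous_on A (tau \<epsilon>)"
  using DERIV_tau by (meson DERIV_isCont continuous_at_imp_continuous_on)

lemma tau_le: 
  assumes "\<epsilon> > 0" shows "\<bar>tau \<epsilon> y\<bar> \<le> 1 / \<epsilon>"
proof -
  have "0 \<le> (\<bar>y\<bar> - \<epsilon>)\<^sup>2" by simp
  then have "2 * (\<bar>y\<bar> * \<epsilon>) \<le> y\<^sup>2 + \<epsilon>\<^sup>2" unfolding power2_diff by simp
  moreover have "0 \<le> \<bar>y\<bar> * \<epsilon>" using assms by simp
  ultimately have "\<bar>y\<bar> * \<epsilon> \<le> y\<^sup>2 + \<epsilon>\<^sup>2" by linarith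
  then show ?thesis using assms add_nonneg_pos[of "y\<^sup>2" "\<epsilon>\<^sup>2"]
    by (simp add: tau_def abs_divide divide_simps)
qed

lemma dtau_le: 
  assumes "\<epsilon> > 0" shows "\<bar>dtau \<epsilon> y\<bar> \<le> 1 / \<epsilon>\<^sup>2"
proof -
  have p: "0 < y\<^sup>2 + \<epsilon>\<^sup>2" using assms by (simp add: add_nonneg_pos)
  have "\<bar>dtau \<epsilon> y\<bar> \<le> (y\<^sup>2 + \<epsilon>\<^sup>2) / (y\<^sup>2 + \<epsilon>\<^sup>2)\<^sup>2"
    unfolding dtau_def abs_divide by (intro divide_mono) (use assms p in \<open>auto simp: abs_if\<close>)
  also have "\<dots> = 1 / (y\<^sup>2 + \<epsilon>\<^sup>2)" by (simp add: power2_eq_square)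
  also have "\<dots> \<le> 1 / \<epsilon>\<^sup>2" using assms by (intro divide_left_mono) (auto intro!: mult_pos_pos p)
  finally show ?thesis .
qed

text \<open>The coefficients of the vector field, seen as functions of the two corners $s$, $t$ that move with one of
  the variables. The data of the two fixed corners are collected in $\alpha$, $\beta$, $\gamma$, chosen such that the
  argument of $\tau$ is always the corner determinant.\<close>

definition coef :: "real \<Rightarrow> real \<Rightarrow> real \<Rightarrow> real \<Rightarrow> real \<Rightarrow> real \<Rightarrow> factor \<Rightarrow> factor \<Rightarrow> real \<Rightarrow> real \<Rightarrow> real" where
  "coef \<sigma> \<delta> \<epsilon> \<alpha> \<beta> \<gamma> k l s t =
     \<gamma> * (wt \<delta> s * fac \<sigma> k s) * (wt \<delta> t * fac \<sigma> l t) * tau \<epsilon> (\<alpha> * (circ_lin \<sigma> s * t) + \<beta> * (s * circ_lin \<sigma> t))"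

definition dcoef :: "real \<Rightarrow> real \<Rightarrow> real \<Rightarrow> real \<Rightarrow> real \<Rightarrow> real \<Rightarrow> factor \<Rightarrow> factor \<Rightarrow> real \<Rightarrow> real \<Rightarrow> real" where
  "dcoef \<sigma> \<delta> \<epsilon> \<alpha> \<beta> \<gamma> k l s t =
     \<gamma> * ((dwt \<delta> s * fac \<sigma> k s + wt \<delta> s * dfac \<sigma> k s) * (wt \<delta> t * fac \<sigma> l t)
       + (wt \<delta> s * fac \<sigma> k s) * (dwt \<delta> t * fac \<sigma> l t + wt \<delta> t * dfac \<sigma> l t))
       * tau \<epsilon> (\<alpha> * (circ_lin \<sigma> s * t) + \<beta> * (s * circ_lin \<sigma> t))
     + \<gamma> * (wt \<delta> s * fac \<sigma> k s) * (wt \<delta> t * fac \<sigma> l t)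
       * (dtau \<epsilon> (\<alpha> * (circ_lin \<sigma> s * t) + \<beta> * (s * circ_lin \<sigma> t))
          * (\<alpha> * (dcirc_lin \<sigma> s * t + circ_lin \<sigma> s) + \<beta> * (circ_lin \<sigma> t + s * dcirc_lin \<sigma> t)))"

lemma borel_coef [measurable (raw)]:
  assumes [measurable]: "\<alpha> \<in> borel_measurable M" "\<beta> \<in> borel_measurable M" "\<gamma> \<in> borel_measurable M"
    "s \<in> borel_measurable M" "t \<in> borel_measurable M"
  shows "(\<lambda>x. coef \<sigma> \<delta> \<epsilon> (\<alpha> x) (\<beta> x) (\<gamma> x) k l (s x) (t x)) \<in> borel_measurable M"
    "(\<lambda>x. dcoef \<sigma> \<delta> \<epsilon> (\<alpha> x) (\<beta> x) (\<gamma> x) k l (s x) (t x)) \<in> borel_measurable M"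
  unfolding coef_def dcoef_def by measurable

lemma coef_eq_0: "\<bar>s\<bar> \<ge> 1 \<or> \<bar>t\<bar> \<ge> 1 \<Longrightarrow> coef \<sigma> \<delta> \<epsilon> \<alpha> \<beta> \<gamma> k l s t = 0"
  by (auto simp: coef_def wt_eq_0)

lemma dcoef_eq_0: "\<bar>s\<bar> \<ge> 1 \<or> \<bar>t\<bar> \<ge> 1 \<Longrightarrow> dcoef \<sigma> \<delta> \<epsilon> \<alpha> \<beta> \<gamma> k l s t = 0"
  by (auto simp: dcoef_def wt_eq_0 dwt_eq_0)

lemma wt_fac_le:
  assumes \<sigma>: "\<bar>\<sigma>\<bar> = 1" and \<delta>: "0 < \<delta>" "\<delta> \<le> 1" and s: "\<bar>s\<bar> \<le> 1"
  shows "\<bar>wt \<delta> s * fac \<sigma> k s\<bar> \<le> 2 / \<delta>" 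
    "\<bar>dwt \<delta> s * fac \<sigma> k s + wt \<delta> s * dfac \<sigma> k s\<bar> \<le> 16 / \<delta>\<^sup>2"
proof -
  have "\<bar>wt \<delta> s\<bar> \<le> 1 / \<delta>" using wt_le[OF \<delta>(1)] by simp
  from abs_mult_le[OF this fac_le[OF \<sigma> s]] show "\<bar>wt \<delta> s * fac \<sigma> k s\<bar> \<le> 2 / \<delta>" by simp
  have "\<bar>wt \<delta> s * dfac \<sigma> k s\<bar> \<le> 2 / \<delta>\<^sup>2"
    using wt_dfac_le[OF \<sigma> \<delta>] by (simp add: abs_mult)
  from abs_add_le[OF abs_mult_le[OF dwt_le[OF \<delta>] fac_le[OF \<sigma> s]] this]
  show "\<bar>dwt \<delta> s * fac \<sigma> k s + wt \<delta> s * dfac \<sigma> k s\<bar> \<le> 16 / \<delta>\<^sup>2" by simp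
qed

context
  fixes \<sigma> \<delta> \<epsilon> \<alpha> \<beta> \<gamma> :: real and s t :: real
  assumes \<sigma>: "\<bar>\<sigma>\<bar> = 1" and \<delta>: "0 < \<delta>" "\<delta> \<le> 1" and \<epsilon>: "0 < \<epsilon>" "\<epsilon> \<le> 1"
    and greek: "\<bar>\<alpha>\<bar> \<le> 4" "\<bar>\<beta>\<bar> \<le> 4" "\<bar>\<gamma>\<bar> \<le> 4"
    and s: "\<bar>s\<bar> \<le> 1" and t: "\<bar>t\<bar> \<le> 1"
begin

lemma coef_le: "\<bar>coef \<sigma> \<delta> \<epsilon> \<alpha> \<beta> \<gamma> k l s t\<bar> \<le> 16 / (\<delta>\<^sup>2 * \<epsilon>)"
proof -
  have "\<bar>coef \<sigma> \<delta> \<epsilon> \<alpha> \<beta> \<gamma> k l s t\<bar> \<le> 4 * (2/\<delta>) * (2/\<delta>) * (1/\<epsilon>)"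
    unfolding coef_def by (intro abs_mult_le wt_fac_le tau_le \<sigma> \<delta> \<epsilon> greek s t)
  then show ?thesis by (simp add: power2_eq_square)
qed

text \<open>A derivative falling on F(u_j) brings out the slope c' at one of the two moving corners.
  The weight of that corner is part of the coefficient and absorbs the pole, at the price of one
  more power of 1/\<delta> than in \<open>coef_le\<close>.\<close>

lemma coef_dcirc_le:
  "\<bar>coef \<sigma> \<delta> \<epsilon> \<alpha> \<beta> \<gamma> k l s t * dcirc s\<bar> \<le> 16 / (\<delta>^3 * \<epsilon>)"
  "\<bar>coef \<sigma> \<delta> \<epsilon> \<alpha> \<beta> \<gamma> k l s t * dcirc t\<bar> \<le> 16 / (\<delta>^3 * \<epsilon>)"
proof -
  have w: "\<bar>(wt \<delta> s * dcirc s) * fac \<sigma> k s\<bar> \<le> (1/\<delta>\<^sup>2) * 2" if "\<bar>s\<bar> \<le> 1" for s k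
    by (rule abs_mult_le[OF _ fac_le[OF \<sigma> that]]) (use wt_dcirc_le[OF \<delta>, of s] in \<open>simp add: abs_mult\<close>)
  have "\<bar>\<gamma> * ((wt \<delta> s * dcirc s) * fac \<sigma> k s) * (wt \<delta> t * fac \<sigma> l t) * tau \<epsilon> (\<alpha> * (circ_lin \<sigma> s * t) + \<beta> * (s * circ_lin \<sigma> t))\<bar> \<le> 4 * ((1/\<delta>\<^sup>2)*2) * (2/\<delta>) * (1/\<epsilon>)"
    by (rule abs_mult_le[OF abs_mult_le[OF abs_mult_le[OF greek(3) w[OF s]] wt_fac_le(1)[OF \<sigma> \<delta> t]] tau_le[OF \<epsilon>(1)]])
  then show "\<bar>coef \<sigma> \<delta> \<epsilon> \<alpha> \<beta> \<gamma> k l s t * dcirc s\<bar> \<le> 16 / (\<delta>^3 * \<epsilon>)"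
    by (simp add: coef_def power2_eq_square power3_eq_cube mult_ac)
  have "\<bar>\<gamma> * (wt \<delta> s * fac \<sigma> k s) * ((wt \<delta> t * dcirc t) * fac \<sigma> l t) * tau \<epsilon> (\<alpha> * (circ_lin \<sigma> s * t) + \<beta> * (s * circ_lin \<sigma> t))\<bar> \<le> 4 * (2/\<delta>) * ((1/\<delta>\<^sup>2)*2) * (1/\<epsilon>)"
    by (rule abs_mult_le[OF abs_mult_le[OF abs_mult_le[OF greek(3) wt_fac_le(1)[OF \<sigma> \<delta> s]] w[OF t]] tau_le[OF \<epsilon>(1)]])
  then show "\<bar>coef \<sigma> \<delta> \<epsilon> \<alpha> \<beta> \<gamma> k l s t * dcirc t\<bar> \<le> 16 / (\<delta>^3 * \<epsilon>)"
    by (simp add: coef_def power2_eq_square power3_eq_cube mult_ac)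
qed

lemma dcoef_le: "\<bar>dcoef \<sigma> \<delta> \<epsilon> \<alpha> \<beta> \<gamma> k l s t\<bar> \<le> 1280 / (\<delta>^3 * \<epsilon>\<^sup>2)"
proof -
  let ?T = "tau \<epsilon> (\<alpha> * (circ_lin \<sigma> s * t) + \<beta> * (s * circ_lin \<sigma> t))"
  let ?T' = "dtau \<epsilon> (\<alpha> * (circ_lin \<sigma> s * t) + \<beta> * (s * circ_lin \<sigma> t))"
  let ?F = "wt \<delta> s * fac \<sigma> k s" and ?G = "wt \<delta> t * fac \<sigma> l t"
  have 1: "\<bar>\<gamma> * ((dwt \<delta> s * fac \<sigma> k s + wt \<delta> s * dfac \<sigma> k s) * ?G
       + ?F * (dwt \<delta> t * fac \<sigma> l t + wt \<delta> t * dfac \<sigma> l t)) * ?T\<bar>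
    \<le> 4 * ((16/\<delta>\<^sup>2) * (2/\<delta>) + (2/\<delta>) * (16/\<delta>\<^sup>2)) * (1/\<epsilon>)"
    by (intro abs_mult_le abs_add_le wt_fac_le tau_le \<sigma> \<delta> \<epsilon> greek s t)
  have nns: "\<bar>circ_lin \<sigma> s\<bar> \<le> 2" and nnt: "\<bar>circ_lin \<sigma> t\<bar> \<le> 2"
    using fac_le[OF \<sigma> s, of Fac_n] fac_le[OF \<sigma> t, of Fac_n] by auto
  have w: "\<bar>(wt \<delta> s * dcirc_lin \<sigma> s) * fac \<sigma> k s\<bar> \<le> (2/\<delta>\<^sup>2) * 2" if "\<bar>s\<bar> \<le> 1" for s k
    by (rule abs_mult_le[OF _ fac_le[OF \<sigma> that]]) (use wt_dfac_le[OF \<sigma> \<delta>, of s Fac_n] in \<open>simp add: abs_mult\<close>)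
  have d1: "2 / \<delta> \<le> 2 / \<delta>\<^sup>2 * 2" and d2: "2 / \<delta> \<le> 4 / \<delta>\<^sup>2" using \<delta> by (auto simp: divide_simps power2_eq_square)
  have a: "\<bar>((wt \<delta> s * dcirc_lin \<sigma> s) * fac \<sigma> k s) * ?G * t\<bar> \<le> (2/\<delta>\<^sup>2*2) * (2/\<delta>) * 1"
    by (rule abs_mult_le[OF abs_mult_le[OF w[OF s] wt_fac_le(1)[OF \<sigma> \<delta> t]] t])
  have b: "\<bar>?F * ?G * circ_lin \<sigma> s\<bar> \<le> (2/\<delta>) * (2/\<delta>) * 2"
    by (intro abs_mult_le nns wt_fac_le \<sigma> \<delta> \<epsilon> greek s t)
  have c: "\<bar>?F * ?G * circ_lin \<sigma> t\<bar> \<le> (2/\<delta>) * (2/\<delta>) * 2"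
    by (intro abs_mult_le nnt wt_fac_le \<sigma> \<delta> \<epsilon> greek s t)
  have d: "\<bar>?F * ((wt \<delta> t * dcirc_lin \<sigma> t) * fac \<sigma> l t) * s\<bar> \<le> (2/\<delta>) * (2/\<delta>\<^sup>2*2) * 1"
    by (rule abs_mult_le[OF abs_mult_le[OF wt_fac_le(1)[OF \<sigma> \<delta> s] w[OF t]] s])
  have "(2/\<delta>) * (2/\<delta>) * 2 \<le> (2/\<delta>) * (4/\<delta>\<^sup>2) * 2" using d2 \<delta> by (intro mult_mono) auto
  then have bc: "(2/\<delta>) * (2/\<delta>) * 2 \<le> 16 / \<delta>^3" by (simp add: power2_eq_square power3_eq_cube)
  have ad: "(2/\<delta>\<^sup>2*2) * (2/\<delta>) * 1 \<le> 16 / \<delta>^3" "(2/\<delta>) * (2/\<delta>\<^sup>2*2) * 1 \<le> 16 / \<delta>^3"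
    using \<delta> by (auto simp: divide_simps power2_eq_square power3_eq_cube)
  have e: "\<bar>\<gamma> * (?T' * (\<alpha> * (((wt \<delta> s * dcirc_lin \<sigma> s) * fac \<sigma> k s) * ?G * t + ?F * ?G * circ_lin \<sigma> s)
       + \<beta> * (?F * ?G * circ_lin \<sigma> t + ?F * ((wt \<delta> t * dcirc_lin \<sigma> t) * fac \<sigma> l t) * s)))\<bar>
     \<le> 4 * ((1/\<epsilon>\<^sup>2) * (4 * (16 / \<delta>^3 + 16 / \<delta>^3) + 4 * (16 / \<delta>^3 + 16 / \<delta>^3)))"
    by (intro abs_mult_le[OF greek(3)] abs_mult_le[OF dtau_le[OF \<epsilon>(1)]] abs_add_le abs_mult_le[OF greek(1)] abs_mult_le[OF greek(2)])
       (use a b c d bc ad in linarith)+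
  \<comment> \<open>The factor \<open>dcirc_lin\<close> is unbounded by itself; the inner derivative
    is expanded so that each occurrence stands next to the weight at the same corner.\<close>
  have "dcoef \<sigma> \<delta> \<epsilon> \<alpha> \<beta> \<gamma> k l s t = \<gamma> * ((dwt \<delta> s * fac \<sigma> k s + wt \<delta> s * dfac \<sigma> k s) * ?G
       + ?F * (dwt \<delta> t * fac \<sigma> l t + wt \<delta> t * dfac \<sigma> l t)) * ?T
     + \<gamma> * (?T' * (\<alpha> * (((wt \<delta> s * dcirc_lin \<sigma> s) * fac \<sigma> k s) * ?G * t + ?F * ?G * circ_lin \<sigma> s)
       + \<beta> * (?F * ?G * circ_lin \<sigma> t + ?F * ((wt \<delta> t * dcirc_lin \<sigma> t) * fac \<sigma> l t) * s)))"
    unfolding dcoef_def by (simp only: algebra_simps)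
  then have "\<bar>dcoef \<sigma> \<delta> \<epsilon> \<alpha> \<beta> \<gamma> k l s t\<bar> \<le> 4 * ((16/\<delta>\<^sup>2) * (2/\<delta>) + (2/\<delta>) * (16/\<delta>\<^sup>2)) * (1/\<epsilon>)
    + 4 * ((1/\<epsilon>\<^sup>2) * (4 * (16 / \<delta>^3 + 16 / \<delta>^3) + 4 * (16 / \<delta>^3 + 16 / \<delta>^3)))"
    using abs_add_le[OF 1 e] by simp
  \<comment> \<open>The part 256 comes from differentiating weights and factors, the part 1024 from
    differentiating \<tau>; \<epsilon> <= 1 merges them into 1280.\<close>
  also have "\<dots> = (256 * \<epsilon> + 1024) / (\<delta>^3 * \<epsilon>\<^sup>2)"
    using \<delta> \<epsilon> by (simp add: divide_simps) (simp add: power2_eq_square power3_eq_cube algebra_simps)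
  also have "\<dots> \<le> 1280 / (\<delta>^3 * \<epsilon>\<^sup>2)" using \<delta> \<epsilon> by (intro divide_right_mono) auto
  finally show ?thesis .
qed

end

lemma DERIV_fac_affine:
  assumes "\<bar>\<zeta> * y + p\<bar> \<noteq> 1"
  shows "((\<lambda>y. fac \<sigma> k (\<zeta> * y + p)) has_real_derivative dfac \<sigma> k (\<zeta> * y + p) * \<zeta>) (at y)"
  by (rule DERIV_chain2[where g = "\<lambda>y. \<zeta> * y + p", OF DERIV_fac[OF assms]]) (auto intro!: derivative_eq_intros)

lemma DERIV_wt_affine:
  assumes "\<bar>\<zeta> * y + p\<bar> \<noteq> 1" "\<delta> > 0"
  shows "((\<lambda>y. wt \<delta> (\<zeta> * y + p)) has_real_derivative dwt \<delta> (\<zeta> * y + p) * \<zeta>) (at y)"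
  by (rule DERIV_chain2[where g = "\<lambda>y. \<zeta> * y + p", OF DERIV_wt[OF assms]]) (auto intro!: derivative_eq_intros)

lemma DERIV_coef_affine:
  assumes s: "\<bar>\<zeta> * y + p\<bar> \<noteq> 1" and t: "\<bar>\<zeta> * y + q\<bar> \<noteq> 1" and \<delta>: "0 < \<delta>" and \<epsilon>: "0 < \<epsilon>"
  shows "((\<lambda>y. coef \<sigma> \<delta> \<epsilon> \<alpha> \<beta> \<gamma> k l (\<zeta> * y + p) (\<zeta> * y + q)) has_real_derivative
     \<zeta> * dcoef \<sigma> \<delta> \<epsilon> \<alpha> \<beta> \<gamma> k l (\<zeta> * y + p) (\<zeta> * y + q)) (at y)"
proof -
  let ?s = "\<zeta> * y + p" and ?t = "\<zeta> * y + q"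
  have id: "((\<lambda>y. \<zeta> * y + p) has_real_derivative \<zeta>) (at y)" for p by (auto intro!: derivative_eq_intros)
  have F: "((\<lambda>y. wt \<delta> (\<zeta> * y + p) * fac \<sigma> k (\<zeta> * y + p)) has_real_derivative
     (dwt \<delta> (\<zeta> * y + p) * fac \<sigma> k (\<zeta> * y + p) + wt \<delta> (\<zeta> * y + p) * dfac \<sigma> k (\<zeta> * y + p)) * \<zeta>) (at y)"
    if "\<bar>\<zeta> * y + p\<bar> \<noteq> 1" for p k
    using DERIV_mult[OF DERIV_wt_affine[OF that \<delta>] DERIV_fac_affine[OF that, of \<sigma> k]] by (simp add: algebra_simps)
  have N: "((\<lambda>y. circ_lin \<sigma> (\<zeta> * y + p)) has_real_derivative dcirc_lin \<sigma> (\<zeta> * y + p) * \<zeta>) (at y)"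
    if "\<bar>\<zeta> * y + p\<bar> \<noteq> 1" for p
    using DERIV_fac_affine[OF that, of \<sigma> Fac_n] by simp
  have D: "((\<lambda>y. \<alpha> * (circ_lin \<sigma> (\<zeta> * y + p) * (\<zeta> * y + q)) + \<beta> * ((\<zeta> * y + p) * circ_lin \<sigma> (\<zeta> * y + q))) has_real_derivative
     (\<alpha> * (dcirc_lin \<sigma> ?s * ?t + circ_lin \<sigma> ?s) + \<beta> * (circ_lin \<sigma> ?t + ?s * dcirc_lin \<sigma> ?t)) * \<zeta>) (at y)"
    using DERIV_add[OF DERIV_cmult[OF DERIV_mult[OF N[OF s] id[of q]], of \<alpha>] DERIV_cmult[OF DERIV_mult[OF id[of p] N[OF t]], of \<beta>]]
    by (simp add: algebra_simps)
  have T: "((\<lambda>y. tau \<epsilon> (\<alpha> * (circ_lin \<sigma> (\<zeta> * y + p) * (\<zeta> * y + q)) + \<beta> * ((\<zeta> * y + p) * circ_lin \<sigma> (\<zeta> * y + q)))) has_real_derivative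
     dtau \<epsilon> (\<alpha> * (circ_lin \<sigma> ?s * ?t) + \<beta> * (?s * circ_lin \<sigma> ?t)) *
     ((\<alpha> * (dcirc_lin \<sigma> ?s * ?t + circ_lin \<sigma> ?s) + \<beta> * (circ_lin \<sigma> ?t + ?s * dcirc_lin \<sigma> ?t)) * \<zeta>)) (at y)"
    by (rule DERIV_chain2[OF _ D]) (rule DERIV_tau[OF \<epsilon>])
  show ?thesis unfolding coef_def dcoef_def
    by (rule DERIV_cong[OF DERIV_mult[OF DERIV_mult[OF DERIV_cmult[OF F[OF s]] F[OF t]] T]]) (simp only: algebra_simps)
qed

lemma continuous_coef_affine:
  assumes "0 < \<delta>" "0 < \<epsilon>"
  shows "continuous_on A (\<lambda>y. coef \<sigma> \<delta> \<epsilon> \<alpha> \<beta> \<gamma> k l (\<zeta> * y + p) (\<zeta> * y + q))"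
  unfolding coef_def
  by (intro continuous_intros continuous_on_compose2[OF continuous_wt[OF assms(1), of UNIV]]
      continuous_on_compose2[OF continuous_fac[of UNIV]] continuous_on_compose2[OF continuous_tau[OF assms(2), of UNIV]]
      continuous_on_compose2[OF continuous_circ_lin[of UNIV]]) auto

section \<open>Integration over four variables\<close>

abbreviation M3 :: "(real \<times> real \<times> real) measure" where "M3 \<equiv> lborel \<Otimes>\<^sub>M lborel \<Otimes>\<^sub>M lborel"
abbreviation M4 :: "(real \<times> real \<times> real \<times> real) measure" where "M4 \<equiv> lborel \<Otimes>\<^sub>M M3"

lemma sigma_finite_lborel_pair:
  "sigma_finite_measure (lborel \<Otimes>\<^sub>M lborel :: (real \<times> real) measure)" "sigma_finite_measure M3"
  unfolding lborel_prod by (rule sigma_finite_lborel)+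

lemma pair_sigma_finite_lborel:
  "pair_sigma_finite lborel (lborel \<Otimes>\<^sub>M lborel :: (real \<times> real) measure)" "pair_sigma_finite lborel M3"
  using sigma_finite_lborel_pair by (auto intro!: pair_sigma_finite.intro sigma_finite_lborel)

lemma nn_integral_M4:
  assumes [measurable]: "f \<in> borel_measurable M4"
  shows "(\<integral>\<^sup>+z. f z \<partial>M4) = (\<integral>\<^sup>+v. \<integral>\<^sup>+w. \<integral>\<^sup>+x. \<integral>\<^sup>+y. f (v, w, x, y) \<partial>lborel \<partial>lborel \<partial>lborel \<partial>lborel)"
proof -
  have "(\<integral>\<^sup>+z. f z \<partial>M4) = (\<integral>\<^sup>+v. \<integral>\<^sup>+r. f (v, r) \<partial>M3 \<partial>lborel)"
    by (rule sigma_finite_measure.nn_integral_fst[OF sigma_finite_lborel_pair(2), symmetric]) measurable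
  also have "\<dots> = (\<integral>\<^sup>+v. \<integral>\<^sup>+w. \<integral>\<^sup>+r. f (v, w, r) \<partial>(lborel \<Otimes>\<^sub>M lborel) \<partial>lborel \<partial>lborel)"
    by (intro nn_integral_cong sigma_finite_measure.nn_integral_fst[OF sigma_finite_lborel_pair(1), symmetric]) measurable
  also have "\<dots> = (\<integral>\<^sup>+v. \<integral>\<^sup>+w. \<integral>\<^sup>+x. \<integral>\<^sup>+y. f (v, w, x, y) \<partial>lborel \<partial>lborel \<partial>lborel \<partial>lborel)"
    by (intro nn_integral_cong lborel.nn_integral_fst[symmetric]) measurable
  finally show ?thesis .
qed

text \<open>For an integrable function this is Fubini; otherwise the Bochner integral has its
  default value 0. Vanishing inner integrals decide both cases.\<close>

lemma integral_pair_zero: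
  fixes p :: "'a \<times> 'b \<Rightarrow> real"
  assumes "pair_sigma_finite A B"
  shows integral_pair_zero_snd: "(\<And>a. (\<integral>b. p (a, b) \<partial>B) = 0) \<Longrightarrow> (\<integral>z. p z \<partial>(A \<Otimes>\<^sub>M B)) = 0"
    and integral_pair_zero_fst: "(\<And>b. (\<integral>a. p (a, b) \<partial>A) = 0) \<Longrightarrow> (\<integral>z. p z \<partial>(A \<Otimes>\<^sub>M B)) = 0"
proof -
  interpret pair_sigma_finite A B by fact
  show "(\<integral>z. p z \<partial>(A \<Otimes>\<^sub>M B)) = 0" if "\<And>a. (\<integral>b. p (a, b) \<partial>B) = 0"
    using that integral_fst'[of p] not_integrable_integral_eq[of "A \<Otimes>\<^sub>M B" p] by (cases "integrable (A \<Otimes>\<^sub>M B) p") simp_all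
  show "(\<integral>z. p z \<partial>(A \<Otimes>\<^sub>M B)) = 0" if "\<And>b. (\<integral>a. p (a, b) \<partial>A) = 0"
    using that integral_snd[of "\<lambda>a b. p (a, b)"] not_integrable_integral_eq[of "A \<Otimes>\<^sub>M B" p] by (cases "integrable (A \<Otimes>\<^sub>M B) p") simp_all
qed

lemma integral_M4_zero:
  fixes p :: "real \<times> real \<times> real \<times> real \<Rightarrow> real"
  shows "(\<And>w x y. (\<integral>v. p (v, w, x, y) \<partial>lborel) = 0) \<Longrightarrow> (\<integral>z. p z \<partial>M4) = 0"
    "(\<And>v x y. (\<integral>w. p (v, w, x, y) \<partial>lborel) = 0) \<Longrightarrow> (\<integral>z. p z \<partial>M4) = 0"
    "(\<And>v w y. (\<integral>x. p (v, w, x, y) \<partial>lborel) = 0) \<Longrightarrow> (\<integral>z. p z \<partial>M4) = 0"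
    "(\<And>v w x. (\<integral>y. p (v, w, x, y) \<partial>lborel) = 0) \<Longrightarrow> (\<integral>z. p z \<partial>M4) = 0"
proof -
  note L = lborel_pair.pair_sigma_finite_axioms pair_sigma_finite_lborel
  show "(\<integral>z. p z \<partial>M4) = 0" if "\<And>w x y. (\<integral>v. p (v, w, x, y) \<partial>lborel) = 0"
    by (rule integral_pair_zero_fst[OF L(3)]) (use that in \<open>auto split: prod.split\<close>)
  show "(\<integral>z. p z \<partial>M4) = 0" if "\<And>v x y. (\<integral>w. p (v, w, x, y) \<partial>lborel) = 0"
    by (rule integral_pair_zero_snd[OF L(3)], rule integral_pair_zero_fst[OF L(2)]) (use that in \<open>auto split: prod.split\<close>)
  show "(\<integral>z. p z \<partial>M4) = 0" if "\<And>v w y. (\<integral>x. p (v, w, x, y) \<partial>lborel) = 0"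
    by (rule integral_pair_zero_snd[OF L(3)], rule integral_pair_zero_snd[OF L(2)], rule integral_pair_zero_fst[OF L(1)]) (use that in auto)
  show "(\<integral>z. p z \<partial>M4) = 0" if "\<And>v w x. (\<integral>y. p (v, w, x, y) \<partial>lborel) = 0"
    by (rule integral_pair_zero_snd[OF L(3)], rule integral_pair_zero_snd[OF L(2)], rule integral_pair_zero_snd[OF L(1)]) (use that in auto)
qed

lemma nn_integral_reflect_translate:
  fixes f :: "real \<Rightarrow> ennreal"
  assumes [measurable]: "f \<in> borel_measurable borel"
  shows "(\<integral>\<^sup>+x. f (x - a) \<partial>lborel) = (\<integral>\<^sup>+x. f x \<partial>lborel)" "(\<integral>\<^sup>+x. f (a - x) \<partial>lborel) = (\<integral>\<^sup>+x. f x \<partial>lborel)"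
  using nn_integral_real_affine[of f 1 "-a"] nn_integral_real_affine[of f "-1" a] by simp_all

text \<open>The four differences satisfy one linear relation, so three of them and the position of
  one corner serve as coordinates. In the order x, v, w each variable being integrated occurs in a
  single difference; once y - w is the new variable, y occurs only in a translate of G.\<close>

lemma nn_integral_corner:
  fixes G :: "real \<Rightarrow> ennreal" and e :: "real \<Rightarrow> real \<Rightarrow> real \<Rightarrow> ennreal"
  assumes [measurable]: "G \<in> borel_measurable borel" "(\<lambda>(a,b,c). e a b c) \<in> borel_measurable M3"
  shows "(\<integral>\<^sup>+(v, w, x, y). G (y - \<sigma> * circ (y - w)) * e (x - v) (y - v) (y - w) \<partial>M4)
    = (\<integral>\<^sup>+x. G x \<partial>lborel) * (\<integral>\<^sup>+c. \<integral>\<^sup>+b. \<integral>\<^sup>+a. e a b c \<partial>lborel \<partial>lborel \<partial>lborel)"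
proof -
  have [measurable (raw)]: "(\<lambda>x. e (f x) (g x) (h x)) \<in> borel_measurable N"
    if [measurable]: "f \<in> borel_measurable N" "g \<in> borel_measurable N" "h \<in> borel_measurable N" for f g h and N :: "'z measure"
    using measurable_compose[OF _ assms(2), of "\<lambda>x. (f x, g x, h x)" N] by simp
  define e2 where "e2 b c = (\<integral>\<^sup>+a. e a b c \<partial>lborel)" for b c
  have e2[measurable]: "(\<lambda>(b,c). e2 b c) \<in> borel_measurable (lborel \<Otimes>\<^sub>M lborel)"
    unfolding e2_def by measurable
  have [measurable (raw)]: "(\<lambda>x. e2 (f x) (g x)) \<in> borel_measurable N"
    if [measurable]: "f \<in> borel_measurable N" "g \<in> borel_measurable N" for f g and N :: "'z measure"
    using measurable_compose[OF _ e2, of "\<lambda>x. (f x, g x)" N] by simp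
  have "(\<integral>\<^sup>+(v, w, x, y). G (y - \<sigma> * circ (y - w)) * e (x - v) (y - v) (y - w) \<partial>M4)
     = (\<integral>\<^sup>+v. \<integral>\<^sup>+w. \<integral>\<^sup>+x. \<integral>\<^sup>+y. G (y - \<sigma> * circ (y - w)) * e (x - v) (y - v) (y - w) \<partial>lborel \<partial>lborel \<partial>lborel \<partial>lborel)"
    by (subst nn_integral_M4) simp_all
  also have "\<dots> = (\<integral>\<^sup>+v. \<integral>\<^sup>+w. \<integral>\<^sup>+y. \<integral>\<^sup>+x. G (y - \<sigma> * circ (y - w)) * e (x - v) (y - v) (y - w) \<partial>lborel \<partial>lborel \<partial>lborel \<partial>lborel)"
    by (intro nn_integral_cong lborel_pair.Fubini') simp
  also have "\<dots> = (\<integral>\<^sup>+v. \<integral>\<^sup>+w. \<integral>\<^sup>+y. G (y - \<sigma> * circ (y - w)) * e2 (y - v) (y - w) \<partial>lborel \<partial>lborel \<partial>lborel)"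
    by (simp add: nn_integral_cmult nn_integral_reflect_translate(1)[of "\<lambda>x. e x _ _"] e2_def)
  also have "\<dots> = (\<integral>\<^sup>+w. \<integral>\<^sup>+v. \<integral>\<^sup>+y. G (y - \<sigma> * circ (y - w)) * e2 (y - v) (y - w) \<partial>lborel \<partial>lborel \<partial>lborel)"
    by (rule lborel_pair.Fubini') simp
  also have "\<dots> = (\<integral>\<^sup>+w. \<integral>\<^sup>+y. \<integral>\<^sup>+v. G (y - \<sigma> * circ (y - w)) * e2 (y - v) (y - w) \<partial>lborel \<partial>lborel \<partial>lborel)"
    by (intro nn_integral_cong lborel_pair.Fubini') simp
  also have "\<dots> = (\<integral>\<^sup>+w. \<integral>\<^sup>+y. G (y - \<sigma> * circ (y - w)) * (\<integral>\<^sup>+b. e2 b (y - w) \<partial>lborel) \<partial>lborel \<partial>lborel)"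
    by (simp add: nn_integral_cmult nn_integral_reflect_translate(2)[of "\<lambda>x. e2 x _"])
  also have "\<dots> = (\<integral>\<^sup>+y. \<integral>\<^sup>+w. G (y - \<sigma> * circ (y - w)) * (\<integral>\<^sup>+b. e2 b (y - w) \<partial>lborel) \<partial>lborel \<partial>lborel)"
    by (rule lborel_pair.Fubini') simp
  also have "\<dots> = (\<integral>\<^sup>+y. \<integral>\<^sup>+c. G (y - \<sigma> * circ c) * (\<integral>\<^sup>+b. e2 b c \<partial>lborel) \<partial>lborel \<partial>lborel)"
    by (intro nn_integral_cong nn_integral_reflect_translate(2)[of "\<lambda>c. G (_ - \<sigma> * circ c) * (\<integral>\<^sup>+b. e2 b c \<partial>lborel)"]) simp
  also have "\<dots> = (\<integral>\<^sup>+c. \<integral>\<^sup>+y. G (y - \<sigma> * circ c) * (\<integral>\<^sup>+b. e2 b c \<partial>lborel) \<partial>lborel \<partial>lborel)"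
    by (rule lborel_pair.Fubini') simp
  also have "\<dots> = (\<integral>\<^sup>+c. (\<integral>\<^sup>+y. G y \<partial>lborel) * (\<integral>\<^sup>+b. e2 b c \<partial>lborel) \<partial>lborel)"
    by (simp add: nn_integral_multc nn_integral_reflect_translate(1)[of G])
  also have "\<dots> = (\<integral>\<^sup>+x. G x \<partial>lborel) * (\<integral>\<^sup>+c. \<integral>\<^sup>+b. \<integral>\<^sup>+a. e a b c \<partial>lborel \<partial>lborel \<partial>lborel)"
    by (simp add: nn_integral_cmult e2_def)
  finally show ?thesis .
qed

text \<open>The derivative of $E_1(u)E_2(v)$ times the coefficient in one of the four variables; $\theta = \zeta = 1$ for
  the first coordinate of a corner, $\theta = 0$ and $\zeta = -1$ for the second one.\<close>

definition part_deriv :: "(real \<Rightarrow> real) \<Rightarrow> (real \<Rightarrow> real) \<Rightarrow> (real \<Rightarrow> real) \<Rightarrow> (real \<Rightarrow> real) \<Rightarrow> real \<Rightarrow> real \<Rightarrow> real \<Rightarrow> real \<Rightarrow> real \<Rightarrow> real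
    \<Rightarrow> factor \<Rightarrow> factor \<Rightarrow> real \<Rightarrow> real \<Rightarrow> real \<Rightarrow> real \<Rightarrow> real \<Rightarrow> real \<Rightarrow> real" where
  "part_deriv E1 E1' E2 E2' \<sigma> \<delta> \<epsilon> \<alpha> \<beta> \<gamma> k l \<theta> \<zeta> s t u v =
    (E1' u * (\<theta> - \<sigma> * \<zeta> * dcirc s) * E2 v + E1 u * (E2' v * (\<theta> - \<sigma> * \<zeta> * dcirc t))) * coef \<sigma> \<delta> \<epsilon> \<alpha> \<beta> \<gamma> k l s t
    + E1 u * E2 v * (\<zeta> * dcoef \<sigma> \<delta> \<epsilon> \<alpha> \<beta> \<gamma> k l s t)"

lemma part_deriv_eq_0: "\<bar>s\<bar> \<ge> 1 \<or> \<bar>t\<bar> \<ge> 1 \<Longrightarrow> part_deriv E1 E1' E2 E2' \<sigma> \<delta> \<epsilon> \<alpha> \<beta> \<gamma> k l \<theta> \<zeta> s t u v = 0"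
  using coef_eq_0 dcoef_eq_0 by (simp add: part_deriv_def)

lemma part_deriv_le:
  assumes \<sigma>: "\<bar>\<sigma>\<bar> = 1" and \<delta>: "0 < \<delta>" "\<delta> \<le> 1" and \<epsilon>: "0 < \<epsilon>" "\<epsilon> \<le> 1"
    and greek: "\<bar>\<alpha>\<bar> \<le> 4" "\<bar>\<beta>\<bar> \<le> 4" "\<bar>\<gamma>\<bar> \<le> 4" and \<theta>: "\<bar>\<theta>\<bar> \<le> 1" and \<zeta>: "\<bar>\<zeta>\<bar> = 1"
    and E1: "\<bar>E1 u\<bar> \<le> A" "\<bar>E1' u\<bar> \<le> A" and E2: "\<bar>E2 v\<bar> \<le> B" "\<bar>E2' v\<bar> \<le> B"
  shows "\<bar>part_deriv E1 E1' E2 E2' \<sigma> \<delta> \<epsilon> \<alpha> \<beta> \<gamma> k l \<theta> \<zeta> s t u v\<bar> \<le> A * B * (1400 / (\<delta>^3 * \<epsilon>\<^sup>2))"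
proof (cases "\<bar>s\<bar> \<le> 1 \<and> \<bar>t\<bar> \<le> 1")
  case True
  then have s: "\<bar>s\<bar> \<le> 1" and t: "\<bar>t\<bar> \<le> 1" by auto
  have A0: "0 \<le> A" and B0: "0 \<le> B" using E1(1) E2(1) by linarith+
  let ?O = "coef \<sigma> \<delta> \<epsilon> \<alpha> \<beta> \<gamma> k l s t" and ?K = "1 / (\<delta>^3 * \<epsilon>\<^sup>2)"
  note b = \<sigma> \<delta> \<epsilon> greek s t
  have de: "\<delta>^3 * \<epsilon>\<^sup>2 \<le> \<delta>\<^sup>2 * \<epsilon>" "\<delta>^3 * \<epsilon>\<^sup>2 \<le> \<delta>^3 * \<epsilon>"
  proof -
    show "\<delta>^3 * \<epsilon>\<^sup>2 \<le> \<delta>\<^sup>2 * \<epsilon>" using \<delta> \<epsilon> 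
      by (intro mult_mono) (auto simp: power3_eq_cube power2_eq_square mult_left_le_one_le)
    show "\<delta>^3 * \<epsilon>\<^sup>2 \<le> \<delta>^3 * \<epsilon>" using \<delta> \<epsilon> by (intro mult_left_mono) (auto simp: power2_eq_square mult_left_le_one_le)
  qed
  have "16 / (\<delta>\<^sup>2 * \<epsilon>) \<le> 16 * ?K" "16 / (\<delta>^3 * \<epsilon>) \<le> 16 * ?K"
    using de \<delta> \<epsilon> by (auto intro!: divide_left_mono)
  then have O: "\<bar>?O\<bar> \<le> 16 * ?K" "\<bar>?O * dcirc s\<bar> \<le> 16 * ?K" "\<bar>?O * dcirc t\<bar> \<le> 16 * ?K"
    using coef_le[OF b, of k l] coef_dcirc_le[OF b, of k l] by linarith+
  have dO: "\<bar>dcoef \<sigma> \<delta> \<epsilon> \<alpha> \<beta> \<gamma> k l s t\<bar> \<le> 1280 * ?K" using dcoef_le[OF b, of k l] by simp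
  have sz: "\<bar>\<sigma> * \<zeta>\<bar> \<le> 1" using \<sigma> \<zeta> by (simp add: abs_mult)
  have q: "\<bar>\<theta> * ?O + (- (\<sigma> * \<zeta>)) * (?O * dcirc s)\<bar> \<le> 1 * (16 * ?K) + 1 * (16 * ?K)"
    "\<bar>\<theta> * ?O + (- (\<sigma> * \<zeta>)) * (?O * dcirc t)\<bar> \<le> 1 * (16 * ?K) + 1 * (16 * ?K)"
    using sz by (intro abs_add_le abs_mult_le \<theta> O; simp)+
  \<comment> \<open>The slopes c' are moved onto the coefficient before estimating, since they are
    bounded only together with its weights. The two derivatives of E1 and E2 contribute 32 each, the
    derivative of the coefficient 1280.\<close>
  have "\<bar>E1' u * E2 v * (\<theta> * ?O + (- (\<sigma> * \<zeta>)) * (?O * dcirc s)) + E1 u * E2' v * (\<theta> * ?O + (- (\<sigma> * \<zeta>)) * (?O * dcirc t))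
    + E1 u * E2 v * (\<zeta> * dcoef \<sigma> \<delta> \<epsilon> \<alpha> \<beta> \<gamma> k l s t)\<bar>
    \<le> A * B * (1 * (16 * ?K) + 1 * (16 * ?K)) + A * B * (1 * (16 * ?K) + 1 * (16 * ?K)) + A * B * (1 * (1280 * ?K))"
    using \<zeta> by (intro abs_add_le abs_mult_le E1 E2 q dO) simp
  also have "\<dots> = A * B * (1344 * ?K)" by (simp add: algebra_simps)
  also have "\<dots> \<le> A * B * (1400 * ?K)" using A0 B0 \<delta> \<epsilon> by (intro mult_left_mono) (auto intro!: divide_right_mono)
  finally show ?thesis by (simp add: part_deriv_def algebra_simps)
next
  case False
  then have "part_deriv E1 E1' E2 E2' \<sigma> \<delta> \<epsilon> \<alpha> \<beta> \<gamma> k l \<theta> \<zeta> s t u v = 0" by (intro part_deriv_eq_0) auto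
  moreover have "0 \<le> A" "0 \<le> B" using E1(1) E2(1) by linarith+
  ultimately show ?thesis using \<delta> \<epsilon> by simp
qed

lemma borel_part_deriv [measurable (raw)]:
  assumes [measurable]: "E1 \<in> borel_measurable borel" "E1' \<in> borel_measurable borel"
    "E2 \<in> borel_measurable borel" "E2' \<in> borel_measurable borel"
    "\<alpha> \<in> borel_measurable M" "\<beta> \<in> borel_measurable M" "\<gamma> \<in> borel_measurable M"
    "s \<in> borel_measurable M" "t \<in> borel_measurable M" "u \<in> borel_measurable M" "v \<in> borel_measurable M"
  shows "(\<lambda>x. part_deriv E1 E1' E2 E2' \<sigma> \<delta> \<epsilon> (\<alpha> x) (\<beta> x) (\<gamma> x) k l \<theta> \<zeta> (s x) (t x) (u x) (v x)) \<in> borel_measurable M"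
  unfolding part_deriv_def by measurable

lemma DERIV_borel:
  assumes "\<And>y. (E has_real_derivative E' y) (at y)"
  shows "E \<in> borel_measurable borel"
  using assms by (intro borel_measurable_continuous_onI) (meson DERIV_isCont continuous_at_imp_continuous_on)

text \<open>The integrand is the derivative of a continuous function with compact support, except at
  the at most four points where a moving corner reaches an end of the half circle. Continuity there
  lets the fundamental theorem of calculus pass over them.\<close>

lemma integral_part_deriv:
  assumes D1: "\<And>y. (E1 has_real_derivative E1' y) (at y)" and D2: "\<And>y. (E2 has_real_derivative E2' y) (at y)"
    and E1': "E1' \<in> borel_measurable borel" and E2': "E2' \<in> borel_measurable borel"
    and bE: "\<And>y. \<bar>E1 y\<bar> \<le> A" "\<And>y. \<bar>E1' y\<bar> \<le> A" "\<And>y. \<bar>E2 y\<bar> \<le> B" "\<And>y. \<bar>E2' y\<bar> \<le> B"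
    and par: "\<bar>\<sigma>\<bar> = 1" "0 < \<delta>" "\<delta> \<le> 1" "0 < \<epsilon>" "\<epsilon> \<le> 1" "\<bar>\<alpha>\<bar> \<le> 4" "\<bar>\<beta>\<bar> \<le> 4" "\<bar>\<gamma>\<bar> \<le> 4"
      "\<bar>\<theta>\<bar> \<le> 1" "\<bar>\<zeta>\<bar> = 1"
  shows "(\<integral>y. part_deriv E1 E1' E2 E2' \<sigma> \<delta> \<epsilon> \<alpha> \<beta> \<gamma> k l \<theta> \<zeta> (\<zeta> * y + p) (\<zeta> * y + q)
       (\<theta> * y + m - \<sigma> * circ (\<zeta> * y + p)) (\<theta> * y + n - \<sigma> * circ (\<zeta> * y + q)) \<partial>lborel) = 0"
    (is "(\<integral>y. ?d y \<partial>lborel) = 0")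
proof -
  note [measurable] = E1' E2' DERIV_borel[OF D1] DERIV_borel[OF D2]
  define R where "R = \<bar>p\<bar> + 2"
  define u where "u r o' y = \<theta> * y + r - \<sigma> * circ (\<zeta> * y + o')" for r o' y
  define P where "P y = E1 (u m p y) * E2 (u n q y) * coef \<sigma> \<delta> \<epsilon> \<alpha> \<beta> \<gamma> k l (\<zeta> * y + p) (\<zeta> * y + q)" for y
  have big: "\<bar>\<zeta> * y + p\<bar> \<ge> 1" if "\<bar>y\<bar> \<ge> \<bar>p\<bar> + 1" for y
  proof -
    have "\<bar>\<zeta> * y\<bar> = \<bar>y\<bar>" using par by (simp add: abs_mult)
    then show ?thesis using that by linarith
  qed
  have zero: "?d y = 0" if "y \<notin> {-R..R}" for y
    using that big[of y] by (intro part_deriv_eq_0) (auto simp: R_def abs_if split: if_splits)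
  have int: "integrable lborel ?d"
  proof (rule integrableI_bounded_set[where A = "{-R..R}" and B = "A * B * (1400 / (\<delta>^3 * \<epsilon>\<^sup>2))"])
    show "AE y in lborel. y \<in> {-R..R} \<longrightarrow> norm (?d y) \<le> A * B * (1400 / (\<delta>^3 * \<epsilon>\<^sup>2))"
      unfolding real_norm_def by (intro AE_I2 impI part_deriv_le par bE)
  qed (use zero in \<open>auto simp: emeasure_lborel_Icc_eq\<close>)
  define S where "S = {(1 - p) / \<zeta>, (-1 - p) / \<zeta>, (1 - q) / \<zeta>, (-1 - q) / \<zeta>}"
  have \<zeta>0: "\<zeta> \<noteq> 0" using par by auto
  have notS: "\<bar>\<zeta> * y + p\<bar> \<noteq> 1" "\<bar>\<zeta> * y + q\<bar> \<noteq> 1" if "y \<notin> S" for y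
    using that \<zeta>0 by (auto simp: S_def field_simps abs_if split: if_splits)
  have derv: "(P has_real_derivative ?d y) (at y)" if "y \<notin> S" for y
  proof -
    note s = notS(1)[OF that] and t = notS(2)[OF that]
    have lin: "((\<lambda>y. a * y + b) has_real_derivative a) (at y)" for a b by (auto intro!: derivative_eq_intros)
    have U: "(u r o' has_real_derivative \<theta> - \<sigma> * (dcirc (\<zeta> * y + o') * \<zeta>)) (at y)" if "\<bar>\<zeta> * y + o'\<bar> \<noteq> 1" for r o'
      unfolding u_def
      using DERIV_diff[OF lin[of \<theta> r] DERIV_cmult[OF DERIV_fac_affine[OF that, of \<sigma> Fac_c], of \<sigma>]] by simp
    have 1: "((\<lambda>y. E1 (u m p y)) has_real_derivative E1' (u m p y) * (\<theta> - \<sigma> * (dcirc (\<zeta> * y + p) * \<zeta>))) (at y)"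
      by (rule DERIV_chain2[OF D1 U[OF s]])
    have 2: "((\<lambda>y. E2 (u n q y)) has_real_derivative E2' (u n q y) * (\<theta> - \<sigma> * (dcirc (\<zeta> * y + q) * \<zeta>))) (at y)"
      by (rule DERIV_chain2[OF D2 U[OF t]])
    show ?thesis unfolding P_def
      by (rule DERIV_cong[OF DERIV_mult[OF DERIV_mult[OF 1 2] DERIV_coef_affine[OF s t par(2) par(4)]]])
        (simp add: part_deriv_def u_def algebra_simps)
  qed
  have cE: "continuous_on UNIV E1" "continuous_on UNIV E2"
    using D1 D2 by (meson DERIV_isCont continuous_at_imp_continuous_on)+
  have "continuous_on UNIV (\<lambda>y. circ (\<zeta> * y + r))" for r
    by (rule continuous_on_compose2[OF continuous_circ[of UNIV]]) (auto intro!: continuous_intros)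
  then have cu: "continuous_on UNIV (u r o')" for r o'
    unfolding u_def by (intro continuous_intros)
  have "continuous_on UNIV P"
    unfolding P_def
    by (intro continuous_on_mult continuous_coef_affine par continuous_on_compose2[OF cE(1) cu]
        continuous_on_compose2[OF cE(2) cu]) simp_all
  then have cont: "continuous_on A P" for A by (rule continuous_on_subset) simp
  have "(?d has_integral (P R - P (-R))) {-R..R}"
    by (rule fundamental_theorem_of_calculus_interior_strong[of S])
       (use derv cont in \<open>auto simp: S_def R_def has_real_derivative_iff_has_vector_derivative\<close>)
  moreover have "P R = 0" "P (-R) = 0"
    using big[of R] big[of "-R"] unfolding P_def R_def by (simp_all add: coef_eq_0)
  ultimately have "(?d has_integral 0) {-R..R}" by simp
  then have "(?d has_integral 0) UNIV"
    by (rule has_integral_on_superset) (use zero in auto)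
  with has_integral_integral_lborel[OF int] show ?thesis by (rule has_integral_unique)
qed

text \<open>The derivatives of $F$ at the corners 2, 3, 4 cancel, and $\Phi' = F$ at corner 1 is multiplied by the
  determinant; the remaining terms form the divergence of the vector field.\<close>

lemma part_deriv_divergence:
  fixes s1 s2 s3 s4 u1 u2 u3 u4 :: real
  assumes \<sigma>: "\<bar>\<sigma>\<bar> = 1"
  shows "wt \<delta> s2 * wt \<delta> s4 * F u2 * F u4 * part_deriv \<Phi> F F F' \<sigma> \<delta> \<epsilon> (circ_lin \<sigma> s4 * s2) (-(s4 * circ_lin \<sigma> s2)) (s2 * circ_lin \<sigma> s4) Fac_c Fac_s 1 1 s1 s3 u1 u3
    + wt \<delta> s1 * wt \<delta> s3 * \<Phi> u1 * F u3 * part_deriv F F' F F' \<sigma> \<delta> \<epsilon> (circ_lin \<sigma> s1 * s3) (-(s1 * circ_lin \<sigma> s3)) (circ s1 * circ_lin \<sigma> s3) Fac_s Fac_s 1 1 s4 s2 u4 u2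
    + wt \<delta> s3 * wt \<delta> s4 * F u3 * F u4 * part_deriv \<Phi> F F F' \<sigma> \<delta> \<epsilon> (s3 * circ_lin \<sigma> s4) (-(circ_lin \<sigma> s3 * s4)) (\<sigma> * s4 * circ_lin \<sigma> s3) Fac_c Fac_n 0 (-1) s1 s2 u1 u2
    + wt \<delta> s1 * wt \<delta> s2 * \<Phi> u1 * F u2 * part_deriv F F' F F' \<sigma> \<delta> \<epsilon> (circ_lin \<sigma> s1 * s2) (-(s1 * circ_lin \<sigma> s2)) (\<sigma> * circ s1 * s2) Fac_n Fac_n 0 (-1) s4 s3 u4 u3
  = F u1 * F u2 * F u3 * F u4 * (wt \<delta> s1 * wt \<delta> s2 * wt \<delta> s3 * wt \<delta> s4) * (corner_det \<sigma> s1 s2 s3 s4 * tau \<epsilon> (corner_det \<sigma> s1 s2 s3 s4))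
    + \<Phi> u1 * F u2 * F u3 * F u4 *
      (wt \<delta> s2 * wt \<delta> s4 * dcoef \<sigma> \<delta> \<epsilon> (circ_lin \<sigma> s4 * s2) (-(s4 * circ_lin \<sigma> s2)) (s2 * circ_lin \<sigma> s4) Fac_c Fac_s s1 s3
       + wt \<delta> s1 * wt \<delta> s3 * dcoef \<sigma> \<delta> \<epsilon> (circ_lin \<sigma> s1 * s3) (-(s1 * circ_lin \<sigma> s3)) (circ s1 * circ_lin \<sigma> s3) Fac_s Fac_s s4 s2
       - wt \<delta> s3 * wt \<delta> s4 * dcoef \<sigma> \<delta> \<epsilon> (s3 * circ_lin \<sigma> s4) (-(circ_lin \<sigma> s3 * s4)) (\<sigma> * s4 * circ_lin \<sigma> s3) Fac_c Fac_n s1 s2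
       - wt \<delta> s1 * wt \<delta> s2 * dcoef \<sigma> \<delta> \<epsilon> (circ_lin \<sigma> s1 * s2) (-(s1 * circ_lin \<sigma> s2)) (\<sigma> * circ s1 * s2) Fac_n Fac_n s4 s3)"
\<comment> \<open>The relation c c' = -s is available only for |s| < 1. If a corner leaves this
  range, every term on both sides carries a vanishing weight.\<close>
proof (cases "\<bar>s1\<bar> \<ge> 1 \<or> \<bar>s2\<bar> \<ge> 1 \<or> \<bar>s3\<bar> \<ge> 1 \<or> \<bar>s4\<bar> \<ge> 1")
  case True
  then show ?thesis by (elim disjE) (simp_all add: wt_eq_0 part_deriv_eq_0 dcoef_eq_0)
next
  case False
  define d1 d2 d3 d4 where d: "d1 = dcirc s1" "d2 = dcirc s2" "d3 = dcirc s3" "d4 = dcirc s4"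
  define c1 c2 c3 c4 where c: "c1 = circ s1" "c2 = circ s2" "c3 = circ s3" "c4 = circ s4"
  define n1 n2 n3 n4 where n: "n1 = circ_lin \<sigma> s1" "n2 = circ_lin \<sigma> s2" "n3 = circ_lin \<sigma> s3" "n4 = circ_lin \<sigma> s4"
  define w1 w2 w3 w4 where w: "w1 = wt \<delta> s1" "w2 = wt \<delta> s2" "w3 = wt \<delta> s3" "w4 = wt \<delta> s4"
  have cd: "c1 * d1 = - s1" "c2 * d2 = - s2" "c3 * d3 = - s3" "c4 * d4 = - s4"
    using False circ_pos[of s1] circ_pos[of s2] circ_pos[of s3] circ_pos[of s4] by (auto simp: c d dcirc_def)
  have nc: "n1 = c1 + \<sigma> * s1" "n2 = c2 + \<sigma> * s2" "n3 = c3 + \<sigma> * s3" "n4 = c4 + \<sigma> * s4"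
    by (simp_all add: n c circ_lin_def)
  have \<sigma>2: "\<sigma> * \<sigma> = 1" using \<sigma> by (metis abs_mult_self_eq mult_1)
  define D where "D = corner_det \<sigma> s1 s2 s3 s4"
  have D: "D = n1 * s3 * n4 * s2 - s1 * n3 * s4 * n2" by (simp add: D_def corner_det_def n)
  have De: "n4 * s2 * (n1 * s3) + - (s4 * n2) * (s1 * n3) = D" "n1 * s3 * (n4 * s2) + - (s1 * n3) * (s4 * n2) = D"
     "s3 * n4 * (n1 * s2) + - (n3 * s4) * (s1 * n2) = D" "n1 * s2 * (n4 * s3) + - (s1 * n2) * (s4 * n3) = D"
    by (simp_all add: D algebra_simps)
  \<comment> \<open>\<open>K1\<close> is Z u1 = D; the three equations \<open>K\<close> further down
    are Z u3 = 0, Z u2 = 0 and Z u4 = 0 with common factors removed. Only c c' = -s and \<sigma>^2 =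
    1 enter.\<close>
  have K1: "s2 * n4 * c1 * s3 * (1 - \<sigma> * 1 * d1) + \<sigma> * s4 * n3 * c1 * n2 * (0 - \<sigma> * - 1 * d1) = D"
  proof -
    have e1: "c1 * (1 - \<sigma> * 1 * d1) = n1" using cd(1) nc(1) by (simp add: algebra_simps)
    have e2: "\<sigma> * c1 * (0 - \<sigma> * - 1 * d1) = - s1"
    proof -
      have "\<sigma> * c1 * (0 - \<sigma> * - 1 * d1) = (\<sigma> * \<sigma>) * (c1 * d1)" by simp
      then show ?thesis by (simp only: \<sigma>2 cd mult_1)
    qed
    have "s2 * n4 * s3 * (c1 * (1 - \<sigma> * 1 * d1)) + s4 * n3 * n2 * (\<sigma> * c1 * (0 - \<sigma> * - 1 * d1)) = D"
      unfolding e1 e2 by (simp add: D)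
    then show ?thesis by (simp only: mult_ac)
  qed
  have Kz: "s * (1 - \<sigma> * 1 * d) + \<sigma> * (c + \<sigma> * s) * (0 - \<sigma> * - 1 * d) = 0" if "c * d = - s" for c d s
  proof -
    have "s * (1 - \<sigma> * 1 * d) + \<sigma> * (c + \<sigma> * s) * (0 - \<sigma> * - 1 * d) = s - \<sigma> * s * d + (\<sigma> * \<sigma>) * (c * d) + (\<sigma> * \<sigma>) * (\<sigma> * s * d)"
      by (simp add: algebra_simps)
    then show ?thesis by (simp add: \<sigma>2 that)
  qed
  have K: "s3 * (1 - \<sigma> * 1 * d3) + \<sigma> * n3 * (0 - \<sigma> * - 1 * d3) = 0"
    "s2 * (1 - \<sigma> * 1 * d2) + \<sigma> * n2 * (0 - \<sigma> * - 1 * d2) = 0"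
    "s4 * (1 - \<sigma> * 1 * d4) + \<sigma> * n4 * (0 - \<sigma> * - 1 * d4) = 0"
    unfolding nc using Kz cd by blast+
  define T where "T = tau \<epsilon> D"
  \<comment> \<open>With the derivatives of the coefficients kept as letters O1 to O4, the
    divergence is sorted by which of the four factors is differentiated; what is claimed is a plain
    ring identity.\<close>
  have ring: "w2 * w4 * F u2 * F u4 * ((F u1 * (1 - \<sigma> * 1 * d1) * F u3 + \<Phi> u1 * (F' u3 * (1 - \<sigma> * 1 * d3))) * (s2 * n4 * (w1 * c1) * (w3 * s3) * T) + \<Phi> u1 * F u3 * (1 * O1))
    + w1 * w3 * \<Phi> u1 * F u3 * ((F' u4 * (1 - \<sigma> * 1 * d4) * F u2 + F u4 * (F' u2 * (1 - \<sigma> * 1 * d2))) * (c1 * n3 * (w4 * s4) * (w2 * s2) * T) + F u4 * F u2 * (1 * O2))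
    + w3 * w4 * F u3 * F u4 * ((F u1 * (0 - \<sigma> * - 1 * d1) * F u2 + \<Phi> u1 * (F' u2 * (0 - \<sigma> * - 1 * d2))) * (\<sigma> * s4 * n3 * (w1 * c1) * (w2 * n2) * T) + \<Phi> u1 * F u2 * (- 1 * O3))
    + w1 * w2 * \<Phi> u1 * F u2 * ((F' u4 * (0 - \<sigma> * - 1 * d4) * F u3 + F u4 * (F' u3 * (0 - \<sigma> * - 1 * d3))) * (\<sigma> * c1 * s2 * (w4 * n4) * (w3 * n3) * T) + F u4 * F u3 * (- 1 * O4))
   = w1 * w2 * w3 * w4 * T * (F u1 * F u2 * F u3 * F u4 * (s2 * n4 * c1 * s3 * (1 - \<sigma> * 1 * d1) + \<sigma> * s4 * n3 * c1 * n2 * (0 - \<sigma> * - 1 * d1))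
     + \<Phi> u1 * F u2 * F' u3 * F u4 * s2 * n4 * c1 * (s3 * (1 - \<sigma> * 1 * d3) + \<sigma> * n3 * (0 - \<sigma> * - 1 * d3))
     + \<Phi> u1 * F' u2 * F u3 * F u4 * c1 * n3 * s4 * (s2 * (1 - \<sigma> * 1 * d2) + \<sigma> * n2 * (0 - \<sigma> * - 1 * d2))
     + \<Phi> u1 * F u2 * F u3 * F' u4 * c1 * n3 * s2 * (s4 * (1 - \<sigma> * 1 * d4) + \<sigma> * n4 * (0 - \<sigma> * - 1 * d4)))
    + \<Phi> u1 * F u2 * F u3 * F u4 * (w2 * w4 * O1 + w1 * w3 * O2 - w3 * w4 * O3 - w1 * w2 * O4)" for O1 O2 O3 O4
    by (simp add: algebra_simps)
  show ?thesis
    unfolding part_deriv_def coef_def fac.simps d[symmetric] c[symmetric] n[symmetric] w[symmetric] De D_def[symmetric] T_def[symmetric]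
    unfolding ring K K1 by (simp add: algebra_simps)
qed

section \<open>The box form\<close>

text \<open>One function value, here at corner 4, supplies integrability in the direction of common
  translation of all corners, while e confines their relative position. This is why the later bounds
  are linear in an L^1 norm.\<close>

lemma corner_bound:
  fixes f :: "real \<times> real \<times> real \<times> real \<Rightarrow> real"
  assumes f[measurable]: "f \<in> borel_measurable M4" and g[measurable]: "g \<in> borel_measurable borel"
    and e[measurable]: "(\<lambda>(a,b,c). e a b c) \<in> borel_measurable M3"
    and nonneg: "\<And>y. 0 \<le> g y" "\<And>a b c. 0 \<le> e a b c" "0 \<le> K" "0 \<le> I" "0 \<le> S"
    and bound: "\<And>v w x y. \<bar>f (v, w, x, y)\<bar> \<le> K * (g (y - \<sigma> * circ (y - w)) * e (x - v) (y - v) (y - w))"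
    and I: "(\<integral>\<^sup>+y. ennreal (g y) \<partial>lborel) \<le> ennreal I"
    and S: "(\<integral>\<^sup>+c. \<integral>\<^sup>+b. \<integral>\<^sup>+a. ennreal (e a b c) \<partial>lborel \<partial>lborel \<partial>lborel) \<le> ennreal S"
  shows "integrable M4 f" "\<bar>\<integral>z. f z \<partial>M4\<bar> \<le> K * (I * S)"
proof -
  have [measurable]: "(\<lambda>(a,b,c). ennreal (e a b c)) \<in> borel_measurable M3"
    using measurable_compose[OF e measurable_ennreal] by (simp add: case_prod_unfold)
  have "(\<integral>\<^sup>+z. ennreal (norm (f z)) \<partial>M4)
    \<le> (\<integral>\<^sup>+(v, w, x, y). ennreal K * (ennreal (g (y - \<sigma> * circ (y - w))) * ennreal (e (x - v) (y - v) (y - w))) \<partial>M4)"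
  proof (intro nn_integral_mono)
    fix z :: "real \<times> real \<times> real \<times> real"
    obtain v w x y where z: "z = (v, w, x, y)" by (cases z) auto
    show "ennreal (norm (f z)) \<le> (case z of (v, w, x, y) \<Rightarrow> ennreal K * (ennreal (g (y - \<sigma> * circ (y - w))) * ennreal (e (x - v) (y - v) (y - w))))"
      using bound[of v w x y] nonneg by (simp add: z ennreal_mult[symmetric] ennreal_leI)
  qed
  also have "\<dots> = ennreal K * (\<integral>\<^sup>+(v, w, x, y). ennreal (g (y - \<sigma> * circ (y - w))) * ennreal (e (x - v) (y - v) (y - w)) \<partial>M4)"
  proof -
    have [measurable (raw)]: "(\<lambda>x. e (f x) (g x) (h x)) \<in> borel_measurable N"
      if [measurable]: "f \<in> borel_measurable N" "g \<in> borel_measurable N" "h \<in> borel_measurable N" for f g h and N :: "'z measure"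
      using measurable_compose[OF _ e, of "\<lambda>x. (f x, g x, h x)" N] by simp
    show ?thesis by (subst nn_integral_cmult[symmetric]) (auto simp: case_prod_unfold)
  qed
  also have "\<dots> = ennreal K * ((\<integral>\<^sup>+y. ennreal (g y) \<partial>lborel) * (\<integral>\<^sup>+c. \<integral>\<^sup>+b. \<integral>\<^sup>+a. ennreal (e a b c) \<partial>lborel \<partial>lborel \<partial>lborel))"
    by (subst nn_integral_corner) auto
  also have "\<dots> \<le> ennreal K * (ennreal I * ennreal S)"
    by (intro mult_mono I S order_refl) auto
  also have "\<dots> = ennreal (K * (I * S))" using nonneg by (simp add: ennreal_mult)
  finally have *: "(\<integral>\<^sup>+z. ennreal (norm (f z)) \<partial>M4) \<le> ennreal (K * (I * S))" .
  show int: "integrable M4 f"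
    by (rule integrableI_bounded) (use * in \<open>auto intro: le_less_trans\<close>)
  have "ennreal (norm (\<integral>z. f z \<partial>M4)) \<le> ennreal (K * (I * S))"
    using integral_norm_bound_ennreal[OF int] * by (rule order_trans)
  then show "\<bar>\<integral>z. f z \<partial>M4\<bar> \<le> K * (I * S)" using nonneg by simp
qed

text \<open>The arguments stand for s_1, s_2, s_4, so \<open>a + c - b\<close> is s_3. Where one of
  the four exceeds 1 in absolute value, the product of the weights is 0.\<close>

definition cube :: "real \<Rightarrow> real \<Rightarrow> real \<Rightarrow> real" where
  "cube a b c = (if \<bar>a\<bar> \<le> 1 \<and> \<bar>b\<bar> \<le> 1 \<and> \<bar>c\<bar> \<le> 1 \<and> \<bar>a + c - b\<bar> \<le> 1 then 1 else 0)"

lemma borel_cube [measurable (raw)]: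
  assumes [measurable]: "f \<in> borel_measurable N" "g \<in> borel_measurable N" "h \<in> borel_measurable N"
  shows "(\<lambda>x. cube (f x) (g x) (h x)) \<in> borel_measurable N"
  unfolding cube_def by measurable

lemma cube_cases: "0 \<le> cube a b c" "cube a b c \<le> 1"
  by (simp_all add: cube_def)

lemma nn_integral_cube: "(\<integral>\<^sup>+c. \<integral>\<^sup>+b. \<integral>\<^sup>+a. ennreal (cube a b c) \<partial>lborel \<partial>lborel \<partial>lborel) \<le> ennreal 8"
proof -
  have pw: "ennreal (cube a b c) \<le> indicator {-1..1} a * (indicator {-1..1} b * indicator {-1..1} c)" for a b c
    by (auto simp: cube_def abs_le_iff)
  have "(\<integral>\<^sup>+c. \<integral>\<^sup>+b. \<integral>\<^sup>+a. ennreal (cube a b c) \<partial>lborel \<partial>lborel \<partial>lborel)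
    \<le> (\<integral>\<^sup>+c. \<integral>\<^sup>+b. \<integral>\<^sup>+a. indicator {-1..1::real} a * (indicator {-1..1::real} b * indicator {-1..1::real} c) \<partial>lborel \<partial>lborel \<partial>lborel)"
    by (intro nn_integral_mono pw)
  also have "\<dots> = 8"
    by (simp add: nn_integral_multc nn_integral_cmult mult.assoc[symmetric])
  finally show ?thesis by simp
qed

definition arc_kernel :: "(real \<Rightarrow> real) \<Rightarrow> real \<Rightarrow> real \<Rightarrow> real \<Rightarrow> real \<Rightarrow> real" where
  "arc_kernel F \<sigma> \<delta> x v = F (x - \<sigma> * circ (x - v)) * wt \<delta> (x - v)"

definition box_integrand :: "(real \<Rightarrow> real) \<Rightarrow> real \<Rightarrow> real \<Rightarrow> real \<times> real \<times> real \<times> real \<Rightarrow> real" where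
  "box_integrand F \<sigma> \<delta> = (\<lambda>(v, w, x, y). arc_kernel F \<sigma> \<delta> x v * arc_kernel F \<sigma> \<delta> x w * (arc_kernel F \<sigma> \<delta> y v * arc_kernel F \<sigma> \<delta> y w))"

lemma borel_arc_kernel [measurable (raw)]:
  assumes [measurable]: "F \<in> borel_measurable borel" "f \<in> borel_measurable N" "g \<in> borel_measurable N"
  shows "(\<lambda>x. arc_kernel F \<sigma> \<delta> (f x) (g x)) \<in> borel_measurable N"
  unfolding arc_kernel_def by measurable

lemma borel_box_integrand [measurable]:
  assumes [measurable]: "F \<in> borel_measurable borel"
  shows "box_integrand F \<sigma> \<delta> \<in> borel_measurable M4"
  unfolding box_integrand_def by measurable

lemma borel_corner_det [measurable (raw)]:
  assumes [measurable]: "f \<in> borel_measurable N" "g \<in> borel_measurable N" "h \<in> borel_measurable N" "k \<in> borel_measurable N"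
  shows "(\<lambda>x. corner_det \<sigma> (f x) (g x) (h x) (k x)) \<in> borel_measurable N"
  unfolding corner_det_def by measurable

text \<open>Three of the four factors F are estimated by 2; the one at corner 4 is kept to produce
  the L^1 norm.\<close>

lemma box_integrand_le:
  assumes F2: "\<And>y. \<bar>F y\<bar> \<le> 2" and \<delta>: "0 < \<delta>"
  shows "\<bar>box_integrand F \<sigma> \<delta> (v,w,x,y)\<bar> \<le> (8 / \<delta>^4) * (\<bar>F (y - \<sigma> * circ (y - w))\<bar> * cube (x-v) (y-v) (y-w))"
proof (cases "\<bar>x-v\<bar> \<le> 1 \<and> \<bar>y-v\<bar> \<le> 1 \<and> \<bar>x-w\<bar> \<le> 1 \<and> \<bar>y-w\<bar> \<le> 1")
  case True
  have W: "\<bar>wt \<delta> s\<bar> \<le> 1 / \<delta>" for s using wt_le[OF \<delta>] by simp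
  have "\<bar>box_integrand F \<sigma> \<delta> (v,w,x,y)\<bar> \<le> 2 * (1/\<delta>) * (2 * (1/\<delta>)) * (2 * (1/\<delta>) * (\<bar>F (y - \<sigma> * circ (y - w))\<bar> * (1/\<delta>)))"
    unfolding box_integrand_def arc_kernel_def prod.case by (intro abs_mult_le F2 W order_refl)
  also have "\<dots> = (8 / \<delta>^4) * (\<bar>F (y - \<sigma> * circ (y - w))\<bar> * 1)" by (simp add: eval_nat_numeral)
  finally show ?thesis using True by (simp add: cube_def)
next
  case False
  then have "\<bar>x-v\<bar> \<ge> 1 \<or> \<bar>y-v\<bar> \<ge> 1 \<or> \<bar>x-w\<bar> \<ge> 1 \<or> \<bar>y-w\<bar> \<ge> 1" by linarith
  then have "box_integrand F \<sigma> \<delta> (v,w,x,y) = 0" by (elim disjE) (simp_all add: box_integrand_def arc_kernel_def wt_eq_0)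
  then show ?thesis using \<delta> cube_cases(1) by (simp add: mult_nonneg_nonneg)
qed

text \<open>Since D \<tau>(D) + \<epsilon>^2/(D^2 + \<epsilon>^2) = 1, the form splits into two. As
  the divergence integrates to 0, the first part equals minus an integral with \<Phi> in place of F
  at corner 1 and has size \<eta>. The second lives where D is small and has size S. The majorant G
  and the bound on F' serve integrability alone and do not reach the conclusion, which therefore
  survives approximation by smooth functions.\<close>

lemma box_form_smooth:
  assumes D\<Phi>: "\<And>y. (\<Phi> has_real_derivative F y) (at y)" and DF: "\<And>y. (F has_real_derivative F' y) (at y)"
    and bF': "F' \<in> borel_measurable borel" 
    and G[measurable]: "G \<in> borel_measurable borel"
    and \<Phi>: "\<And>y. \<bar>\<Phi> y\<bar> \<le> \<eta>" and F2: "\<And>y. \<bar>F y\<bar> \<le> 2" and FG: "\<And>y. \<bar>F y\<bar> \<le> G y" "\<And>y. \<bar>F' y\<bar> \<le> G y"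
    and GB: "\<And>y. G y \<le> B" and Gint: "(\<integral>\<^sup>+y. ennreal (G y) \<partial>lborel) < \<infinity>"
    and I: "(\<integral>\<^sup>+y. ennreal \<bar>F y\<bar> \<partial>lborel) \<le> ennreal I" "0 \<le> I"
    and \<sigma>: "\<bar>\<sigma>\<bar> = 1" and \<delta>: "0 < \<delta>" "\<delta> \<le> 1" and \<epsilon>: "0 < \<epsilon>" "\<epsilon> \<le> 1"
    and S: "(\<integral>\<^sup>+c. \<integral>\<^sup>+b. \<integral>\<^sup>+a. ennreal (cube a b c * (\<epsilon>\<^sup>2 / ((corner_det \<sigma> a b (a + c - b) c)\<^sup>2 + \<epsilon>\<^sup>2))) \<partial>lborel \<partial>lborel \<partial>lborel) \<le> ennreal S"
      "0 \<le> S"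
  shows "\<bar>\<integral>z. box_integrand F \<sigma> \<delta> z \<partial>M4\<bar> \<le> I * (\<eta> * (163840 / (\<delta>^5 * \<epsilon>\<^sup>2)) + 8 * S / \<delta>^4)"
proof -
  note [measurable] = bF' DERIV_borel[OF D\<Phi>] DERIV_borel[OF DF]
  define A where "A = \<eta> + 2 + B"
  have \<eta>0: "0 \<le> \<eta>" using \<Phi>[of 0] by linarith
  have G0: "0 \<le> G y" for y using FG(1)[of y] by linarith
  have B0: "0 \<le> B" using G0 GB by (meson order_trans)
  have A: "\<bar>\<Phi> y\<bar> \<le> A" "\<bar>F y\<bar> \<le> A" "\<bar>F' y\<bar> \<le> A" for y
    using \<Phi>[of y] F2[of y] FG[of y] GB[of y] \<eta>0 B0 unfolding A_def by linarith+
  have A0: "0 \<le> A" using \<eta>0 B0 by (simp add: A_def)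
  let ?U = "\<lambda>x v. x - \<sigma> * circ (x - v)"
  have n2: "\<bar>circ_lin \<sigma> s\<bar> \<le> 2" if "\<bar>s\<bar> \<le> 1" for s using fac_le[OF \<sigma> that, of Fac_n] by simp
  have gk: "\<bar>a * b\<bar> \<le> 4" if "\<bar>a\<bar> \<le> 2" "\<bar>b\<bar> \<le> 2" for a b :: real using abs_mult_le[OF that] by simp
  have gk': "\<bar>-(a * b)\<bar> \<le> 4" if "\<bar>a\<bar> \<le> 2" "\<bar>b\<bar> \<le> 2" for a b :: real using abs_mult_le[OF that] by simp
  have c1: "\<bar>circ s\<bar> \<le> 2" for s using circ_le_1[of s] circ_ge_0[of s] by linarith
  have s\<sigma>: "\<bar>\<sigma> * s\<bar> \<le> 2" if "\<bar>s\<bar> \<le> 1" for s using that \<sigma> by (simp add: abs_mult)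
  have s\<sigma>c: "\<bar>\<sigma> * circ s\<bar> \<le> 2" for s using order_trans[OF circ_le_1[of s], of 2] \<sigma> by (simp add: abs_mult)
  have s2: "\<bar>s\<bar> \<le> 2" if "\<bar>s\<bar> \<le> 1" for s :: real using that by simp
  note greek = gk gk' n2 c1 s\<sigma> s\<sigma>c s2
  have W: "\<bar>wt \<delta> s\<bar> \<le> 1 / \<delta>" for s using wt_le[OF \<delta>(1)] by simp
  define C where "C = 1400 / (\<delta>^3 * \<epsilon>\<^sup>2)"
  \<comment> \<open>q1, q2, q3, q4 are the parts of the divergence in x, y, v, w. In each of them
    the two corners not moving with that variable are split off as constants.\<close>
  define q1 where "q1 v w x y = wt \<delta> (y-v) * wt \<delta> (y-w) * F (?U y v) * F (?U y w) *
     part_deriv \<Phi> F F F' \<sigma> \<delta> \<epsilon> (circ_lin \<sigma> (y-w) * (y-v)) (-((y-w) * circ_lin \<sigma> (y-v))) ((y-v) * circ_lin \<sigma> (y-w)) Fac_c Fac_s 1 1 (x-v) (x-w) (?U x v) (?U x w)" for v w x y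
  define q2 where "q2 v w x y = wt \<delta> (x-v) * wt \<delta> (x-w) * \<Phi> (?U x v) * F (?U x w) *
     part_deriv F F' F F' \<sigma> \<delta> \<epsilon> (circ_lin \<sigma> (x-v) * (x-w)) (-((x-v) * circ_lin \<sigma> (x-w))) (circ (x-v) * circ_lin \<sigma> (x-w)) Fac_s Fac_s 1 1 (y-w) (y-v) (?U y w) (?U y v)" for v w x y
  define q3 where "q3 v w x y = wt \<delta> (x-w) * wt \<delta> (y-w) * F (?U x w) * F (?U y w) *
     part_deriv \<Phi> F F F' \<sigma> \<delta> \<epsilon> ((x-w) * circ_lin \<sigma> (y-w)) (-(circ_lin \<sigma> (x-w) * (y-w))) (\<sigma> * (y-w) * circ_lin \<sigma> (x-w)) Fac_c Fac_n 0 (-1) (x-v) (y-v) (?U x v) (?U y v)" for v w x y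
  define q4 where "q4 v w x y = wt \<delta> (x-v) * wt \<delta> (y-v) * \<Phi> (?U x v) * F (?U y v) *
     part_deriv F F' F F' \<sigma> \<delta> \<epsilon> (circ_lin \<sigma> (x-v) * (y-v)) (-((x-v) * circ_lin \<sigma> (y-v))) (\<sigma> * circ (x-v) * (y-v)) Fac_n Fac_n 0 (-1) (y-w) (x-w) (?U y w) (?U x w)" for v w x y
  define \<Psi> where "\<Psi> v w x y = 
      wt \<delta> (y-v) * wt \<delta> (y-w) * dcoef \<sigma> \<delta> \<epsilon> (circ_lin \<sigma> (y-w) * (y-v)) (-((y-w) * circ_lin \<sigma> (y-v))) ((y-v) * circ_lin \<sigma> (y-w)) Fac_c Fac_s (x-v) (x-w)
       + wt \<delta> (x-v) * wt \<delta> (x-w) * dcoef \<sigma> \<delta> \<epsilon> (circ_lin \<sigma> (x-v) * (x-w)) (-((x-v) * circ_lin \<sigma> (x-w))) (circ (x-v) * circ_lin \<sigma> (x-w)) Fac_s Fac_s (y-w) (y-v)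
       - wt \<delta> (x-w) * wt \<delta> (y-w) * dcoef \<sigma> \<delta> \<epsilon> ((x-w) * circ_lin \<sigma> (y-w)) (-(circ_lin \<sigma> (x-w) * (y-w))) (\<sigma> * (y-w) * circ_lin \<sigma> (x-w)) Fac_c Fac_n (x-v) (y-v)
       - wt \<delta> (x-v) * wt \<delta> (y-v) * dcoef \<sigma> \<delta> \<epsilon> (circ_lin \<sigma> (x-v) * (y-v)) (-((x-v) * circ_lin \<sigma> (y-v))) (\<sigma> * circ (x-v) * (y-v)) Fac_n Fac_n (y-w) (x-w)" for v w x y
  define Dz where "Dz v w x y = corner_det \<sigma> (x-v) (y-v) (x-w) (y-w)" for v w x y
  have div: "q1 v w x y + q2 v w x y + q3 v w x y + q4 v w x y =
      box_integrand F \<sigma> \<delta> (v,w,x,y) * (Dz v w x y * tau \<epsilon> (Dz v w x y)) + \<Phi> (?U x v) * F (?U y v) * F (?U x w) * F (?U y w) * \<Psi> v w x y" for v w x y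
    using part_deriv_divergence[OF \<sigma>, of \<delta> "y-v" "y-w" F "?U y v" "?U y w" \<Phi> F' \<epsilon> "x-v" "x-w" "?U x v" "?U x w"]
    unfolding q1_def q2_def q3_def q4_def \<Psi>_def Dz_def box_integrand_def arc_kernel_def by (simp add: mult_ac)
  have cube1: "cube (x-v) (y-v) (y-w) = 1" if "\<bar>x-v\<bar> \<le> 1" "\<bar>y-v\<bar> \<le> 1" "\<bar>x-w\<bar> \<le> 1" "\<bar>y-w\<bar> \<le> 1" for v w x y
    using that by (simp add: cube_def)
  have s3: "(x-v) + (y-w) - (y-v) = x - w" for x y v w :: real by simp
  \<comment> \<open>This bound contains the supremum of F' through A; it only has to be
    finite.\<close>
  define KK where "KK = (1/\<delta>) * (1/\<delta>) * A * (A * A * C)"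
  have q0: "q1 v w x y = 0 \<and> q2 v w x y = 0 \<and> q3 v w x y = 0 \<and> q4 v w x y = 0 \<and> \<Psi> v w x y = 0 \<and> box_integrand F \<sigma> \<delta> (v,w,x,y) = 0"
    if "\<not> (\<bar>x-v\<bar> \<le> 1 \<and> \<bar>y-v\<bar> \<le> 1 \<and> \<bar>x-w\<bar> \<le> 1 \<and> \<bar>y-w\<bar> \<le> 1)" for v w x y
  proof -
    have "\<bar>x-v\<bar> \<ge> 1 \<or> \<bar>y-v\<bar> \<ge> 1 \<or> \<bar>x-w\<bar> \<ge> 1 \<or> \<bar>y-w\<bar> \<ge> 1" using that by linarith
    then show ?thesis
      by (elim disjE) (simp_all add: q1_def q2_def q3_def q4_def \<Psi>_def box_integrand_def arc_kernel_def wt_eq_0 part_deriv_eq_0 dcoef_eq_0)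
  qed
  have qb: "\<bar>q1 v w x y\<bar> \<le> KK * (G (?U y w) * cube (x-v) (y-v) (y-w)) \<and> \<bar>q2 v w x y\<bar> \<le> KK * (G (?U y w) * cube (x-v) (y-v) (y-w))
     \<and> \<bar>q3 v w x y\<bar> \<le> KK * (G (?U y w) * cube (x-v) (y-v) (y-w)) \<and> \<bar>q4 v w x y\<bar> \<le> KK * (G (?U y w) * cube (x-v) (y-v) (y-w))" for v w x y
  proof (cases "\<bar>x-v\<bar> \<le> 1 \<and> \<bar>y-v\<bar> \<le> 1 \<and> \<bar>x-w\<bar> \<le> 1 \<and> \<bar>y-w\<bar> \<le> 1")
    case True
    then have s: "\<bar>x-v\<bar> \<le> 1" "\<bar>y-v\<bar> \<le> 1" "\<bar>x-w\<bar> \<le> 1" "\<bar>y-w\<bar> \<le> 1" by auto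
    have "\<bar>q1 v w x y\<bar> \<le> (1/\<delta>) * (1/\<delta>) * A * G (?U y w) * (A * A * C)"
      unfolding q1_def C_def by (rule abs_mult_le abs_mult_le[OF abs_mult_le] W A FG part_deriv_le \<sigma> \<delta> \<epsilon> greek s)+ (simp_all add: A FG)
    moreover have "\<bar>q2 v w x y\<bar> \<le> (1/\<delta>) * (1/\<delta>) * A * A * (G (?U y w) * A * C)"
      unfolding q2_def C_def by (rule abs_mult_le W A FG part_deriv_le \<sigma> \<delta> \<epsilon> greek s)+ (simp_all add: A FG)
    moreover have "\<bar>q3 v w x y\<bar> \<le> (1/\<delta>) * (1/\<delta>) * A * G (?U y w) * (A * A * C)"
      unfolding q3_def C_def by (rule abs_mult_le W A FG part_deriv_le \<sigma> \<delta> \<epsilon> greek s)+ (simp_all add: A FG)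
    moreover have "\<bar>q4 v w x y\<bar> \<le> (1/\<delta>) * (1/\<delta>) * A * A * (G (?U y w) * A * C)"
      unfolding q4_def C_def by (rule abs_mult_le W A FG part_deriv_le \<sigma> \<delta> \<epsilon> greek s)+ (simp_all add: A FG)
    ultimately show ?thesis using cube1[OF s] by (simp add: KK_def mult_ac)
  next
    case False
    have "0 \<le> KK * (G (?U y w) * cube (x-v) (y-v) (y-w))"
      using G0 A0 \<delta> \<epsilon> cube_cases(1) by (auto simp: KK_def C_def intro!: mult_nonneg_nonneg)
    then show ?thesis using q0[OF False] by simp
  qed
  define Ir where "Ir = enn2real (\<integral>\<^sup>+y. ennreal (G y) \<partial>lborel)"
  have Ir: "(\<integral>\<^sup>+y. ennreal (G y) \<partial>lborel) \<le> ennreal Ir" "0 \<le> Ir" using Gint by (simp_all add: Ir_def less_top)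
  have KK0: "0 \<le> KK" using A0 \<delta> \<epsilon> by (simp add: KK_def C_def)
  have mq[measurable]: "(\<lambda>(v,w,x,y). q1 v w x y) \<in> borel_measurable M4" "(\<lambda>(v,w,x,y). q2 v w x y) \<in> borel_measurable M4"
    "(\<lambda>(v,w,x,y). q3 v w x y) \<in> borel_measurable M4" "(\<lambda>(v,w,x,y). q4 v w x y) \<in> borel_measurable M4"
    unfolding q1_def q2_def q3_def q4_def by measurable
  have mc: "(\<lambda>(a,b,c). cube a b c) \<in> borel_measurable M3" by measurable
  have intq: "integrable M4 (\<lambda>(v,w,x,y). q1 v w x y)" "integrable M4 (\<lambda>(v,w,x,y). q2 v w x y)"
    "integrable M4 (\<lambda>(v,w,x,y). q3 v w x y)" "integrable M4 (\<lambda>(v,w,x,y). q4 v w x y)"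
    by (rule corner_bound(1)[OF _ G mc G0 cube_cases(1) KK0 Ir(2) _ _ Ir(1) nn_integral_cube, where \<sigma> = \<sigma>];
        use qb in \<open>simp add: mq\<close>)+
  have z1: "(\<integral>x. q1 v w x y \<partial>lborel) = 0" for v w y
  proof (cases "\<bar>y-v\<bar> \<le> 1 \<and> \<bar>y-w\<bar> \<le> 1")
    case True
    then have s: "\<bar>y-v\<bar> \<le> 1" "\<bar>y-w\<bar> \<le> 1" by auto
    have "(\<integral>x. part_deriv \<Phi> F F F' \<sigma> \<delta> \<epsilon> (circ_lin \<sigma> (y-w) * (y-v)) (-((y-w) * circ_lin \<sigma> (y-v))) ((y-v) * circ_lin \<sigma> (y-w)) Fac_c Fac_s 1 1 (1*x+-v) (1*x+-w)
       (1*x+0-\<sigma>*circ (1*x+-v)) (1*x+0-\<sigma>*circ (1*x+-w)) \<partial>lborel) = 0"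
      by (rule integral_part_deriv[where A = A and B = A]; (rule D\<Phi> DF bF' DERIV_borel[OF DF] A \<sigma> \<delta> \<epsilon> greek s | simp)+)
    then show ?thesis by (simp add: q1_def)
  qed (auto simp: q1_def wt_eq_0)
  have z2: "(\<integral>y. q2 v w x y \<partial>lborel) = 0" for v w x
  proof (cases "\<bar>x-v\<bar> \<le> 1 \<and> \<bar>x-w\<bar> \<le> 1")
    case True
    then have s: "\<bar>x-v\<bar> \<le> 1" "\<bar>x-w\<bar> \<le> 1" by auto
    have "(\<integral>y. part_deriv F F' F F' \<sigma> \<delta> \<epsilon> (circ_lin \<sigma> (x-v) * (x-w)) (-((x-v) * circ_lin \<sigma> (x-w))) (circ (x-v) * circ_lin \<sigma> (x-w)) Fac_s Fac_s 1 1 (1*y+-w) (1*y+-v)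
       (1*y+0-\<sigma>*circ (1*y+-w)) (1*y+0-\<sigma>*circ (1*y+-v)) \<partial>lborel) = 0"
      by (rule integral_part_deriv[where A = A and B = A]; (rule D\<Phi> DF bF' DERIV_borel[OF DF] A \<sigma> \<delta> \<epsilon> greek s | simp)+)
    then show ?thesis by (simp add: q2_def)
  qed (auto simp: q2_def wt_eq_0)
  have z3: "(\<integral>v. q3 v w x y \<partial>lborel) = 0" for w x y
  proof (cases "\<bar>x-w\<bar> \<le> 1 \<and> \<bar>y-w\<bar> \<le> 1")
    case True
    then have s: "\<bar>x-w\<bar> \<le> 1" "\<bar>y-w\<bar> \<le> 1" by auto
    have "(\<integral>v. part_deriv \<Phi> F F F' \<sigma> \<delta> \<epsilon> ((x-w) * circ_lin \<sigma> (y-w)) (-(circ_lin \<sigma> (x-w) * (y-w))) (\<sigma> * (y-w) * circ_lin \<sigma> (x-w)) Fac_c Fac_n 0 (-1) ((-1) * v+x) ((-1) * v+y)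
       (0 * v+x-\<sigma>*circ ((-1) * v+x)) (0 * v+y-\<sigma>*circ ((-1) * v+y)) \<partial>lborel) = 0"
      by (rule integral_part_deriv[where A = A and B = A]; (rule D\<Phi> DF bF' DERIV_borel[OF DF] A \<sigma> \<delta> \<epsilon> greek s | simp)+)
    then show ?thesis by (simp add: q3_def)
  qed (auto simp: q3_def wt_eq_0)
  have z4: "(\<integral>w. q4 v w x y \<partial>lborel) = 0" for v x y
  proof (cases "\<bar>x-v\<bar> \<le> 1 \<and> \<bar>y-v\<bar> \<le> 1")
    case True
    then have s: "\<bar>x-v\<bar> \<le> 1" "\<bar>y-v\<bar> \<le> 1" by auto
    have "(\<integral>w. part_deriv F F' F F' \<sigma> \<delta> \<epsilon> (circ_lin \<sigma> (x-v) * (y-v)) (-((x-v) * circ_lin \<sigma> (y-v))) (\<sigma> * circ (x-v) * (y-v)) Fac_n Fac_n 0 (-1) ((-1)*w+y) ((-1)*w+x)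
       (0*w+y-\<sigma>*circ ((-1)*w+y)) (0*w+x-\<sigma>*circ ((-1)*w+x)) \<partial>lborel) = 0"
      by (rule integral_part_deriv[where A = A and B = A]; (rule D\<Phi> DF bF' DERIV_borel[OF DF] A \<sigma> \<delta> \<epsilon> greek s | simp)+)
    then show ?thesis by (simp add: q4_def)
  qed (auto simp: q4_def wt_eq_0)
  have Z: "(\<integral>(v,w,x,y). q1 v w x y \<partial>M4) = 0" "(\<integral>(v,w,x,y). q2 v w x y \<partial>M4) = 0"
    "(\<integral>(v,w,x,y). q3 v w x y \<partial>M4) = 0" "(\<integral>(v,w,x,y). q4 v w x y \<partial>M4) = 0"
    by (rule integral_M4_zero(3), simp add: z1) (rule integral_M4_zero(4), simp add: z2,
        rule integral_M4_zero(1), simp add: z3, rule integral_M4_zero(2), simp add: z4)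
  define J1 where "J1 = (\<lambda>(v,w,x,y). box_integrand F \<sigma> \<delta> (v,w,x,y) * (Dz v w x y * tau \<epsilon> (Dz v w x y)))"
  define J2 where "J2 = (\<lambda>(v,w,x,y). \<Phi> (?U x v) * F (?U y v) * F (?U x w) * F (?U y w) * \<Psi> v w x y)"
  define J3 where "J3 = (\<lambda>(v,w,x,y). box_integrand F \<sigma> \<delta> (v,w,x,y) * (\<epsilon>\<^sup>2 / ((Dz v w x y)\<^sup>2 + \<epsilon>\<^sup>2)))"
  have [measurable]: "J1 \<in> borel_measurable M4" "J2 \<in> borel_measurable M4" "J3 \<in> borel_measurable M4"
    unfolding J1_def J2_def J3_def box_integrand_def \<Psi>_def Dz_def by measurable
  note Qb = box_integrand_le[where F = F and \<sigma> = \<sigma>, OF F2 \<delta>(1)]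
  have frac: "0 \<le> \<epsilon>\<^sup>2 / (y\<^sup>2 + \<epsilon>\<^sup>2)" "\<bar>y * tau \<epsilon> y\<bar> \<le> 1" "y * tau \<epsilon> y + \<epsilon>\<^sup>2 / (y\<^sup>2 + \<epsilon>\<^sup>2) = 1" for y
  proof -
    have "0 < y\<^sup>2 + \<epsilon>\<^sup>2" using \<epsilon> by (simp add: add_nonneg_pos)
    then show "0 \<le> \<epsilon>\<^sup>2 / (y\<^sup>2 + \<epsilon>\<^sup>2)" "\<bar>y * tau \<epsilon> y\<bar> \<le> 1" "y * tau \<epsilon> y + \<epsilon>\<^sup>2 / (y\<^sup>2 + \<epsilon>\<^sup>2) = 1"
      by (auto simp: tau_def divide_simps power2_eq_square)
  qed
  have J1b: "\<bar>J1 (v,w,x,y)\<bar> \<le> (8 / \<delta>^4) * (\<bar>F (?U y w)\<bar> * cube (x-v) (y-v) (y-w))" for v w x y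
    using abs_mult_le[OF Qb frac(2), of v w x y "Dz v w x y"] by (simp add: J1_def)
  \<comment> \<open>Four derivatives of coefficients bounded by 1280 give 5120, two factors F
    bounded by 2 give 20480, and the volume bound 8 of \<open>nn_integral_cube\<close> gives the
    constant 163840 of the statement.\<close>
  define L where "L = 1 / (\<delta>^5 * \<epsilon>\<^sup>2)"
  have J2b: "\<bar>J2 (v,w,x,y)\<bar> \<le> (\<eta> * (20480 * L)) * (\<bar>F (?U y w)\<bar> * cube (x-v) (y-v) (y-w))" for v w x y
  proof (cases "\<bar>x-v\<bar> \<le> 1 \<and> \<bar>y-v\<bar> \<le> 1 \<and> \<bar>x-w\<bar> \<le> 1 \<and> \<bar>y-w\<bar> \<le> 1")
    case True
    then have s: "\<bar>x-v\<bar> \<le> 1" "\<bar>y-v\<bar> \<le> 1" "\<bar>x-w\<bar> \<le> 1" "\<bar>y-w\<bar> \<le> 1" by auto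
    have sub: "\<bar>a - b\<bar> \<le> p + q" if "\<bar>a\<bar> \<le> p" "\<bar>b\<bar> \<le> q" for a b p q :: real using that by linarith
    have "\<bar>\<Psi> v w x y\<bar> \<le> (1/\<delta>) * (1/\<delta>) * (1280 / (\<delta>^3 * \<epsilon>\<^sup>2)) + (1/\<delta>) * (1/\<delta>) * (1280 / (\<delta>^3 * \<epsilon>\<^sup>2))
       + (1/\<delta>) * (1/\<delta>) * (1280 / (\<delta>^3 * \<epsilon>\<^sup>2)) + (1/\<delta>) * (1/\<delta>) * (1280 / (\<delta>^3 * \<epsilon>\<^sup>2))"
      unfolding \<Psi>_def by (rule sub abs_add_le abs_mult_le W dcoef_le \<sigma> \<delta> \<epsilon> greek s)+
    also have "\<dots> = 5120 * L" by (simp add: L_def eval_nat_numeral)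
    finally have \<Psi>b: "\<bar>\<Psi> v w x y\<bar> \<le> 5120 * L" .
    have "\<bar>J2 (v,w,x,y)\<bar> \<le> \<eta> * 2 * 2 * \<bar>F (?U y w)\<bar> * (5120 * L)"
      unfolding J2_def prod.case by (intro abs_mult_le \<Phi> F2 \<Psi>b order_refl)
    then show ?thesis using cube1[OF s] by (simp add: mult_ac)
  next
    case False
    then show ?thesis using q0[OF False] \<delta> \<epsilon> \<eta>0 cube_cases(1) by (simp add: J2_def L_def mult_nonneg_nonneg)
  qed
  define e where "e a b c = cube a b c * (\<epsilon>\<^sup>2 / ((corner_det \<sigma> a b (a + c - b) c)\<^sup>2 + \<epsilon>\<^sup>2))" for a b c
  have me: "(\<lambda>(a,b,c). e a b c) \<in> borel_measurable M3" unfolding e_def by measurable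
  have e0: "0 \<le> e a b c" for a b c using cube_cases(1) frac(1) by (simp add: e_def)
  have J3b: "\<bar>J3 (v,w,x,y)\<bar> \<le> (8 / \<delta>^4) * (\<bar>F (?U y w)\<bar> * e (x-v) (y-v) (y-w))" for v w x y
  proof -
    have "\<bar>\<epsilon>\<^sup>2 / ((Dz v w x y)\<^sup>2 + \<epsilon>\<^sup>2)\<bar> \<le> \<epsilon>\<^sup>2 / ((Dz v w x y)\<^sup>2 + \<epsilon>\<^sup>2)" using frac(1)[of "Dz v w x y"] by simp
    from abs_mult_le[OF Qb this, of v w x y] show ?thesis
      by (simp add: J3_def e_def Dz_def mult_ac s3)
  qed
  have mF: "(\<lambda>y. \<bar>F y\<bar>) \<in> borel_measurable borel" by measurable
  have k8: "0 \<le> 8 / \<delta>^4" and kL: "0 \<le> \<eta> * (20480 * L)" using \<delta> \<epsilon> \<eta>0 by (auto simp: L_def)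
  note cF = corner_bound[OF _ mF, where \<sigma> = \<sigma>]
  have iJ1: "integrable M4 J1"
    by (rule cF(1)[OF _ mc _ cube_cases(1) k8 I(2) _ J1b I(1) nn_integral_cube]) auto
  have iJ2: "integrable M4 J2" and bJ2: "\<bar>\<integral>z. J2 z \<partial>M4\<bar> \<le> (\<eta> * (20480 * L)) * (I * 8)"
    by (rule cF[OF _ mc _ cube_cases(1) kL I(2) _ J2b I(1) nn_integral_cube]; simp)+
  have iJ3: "integrable M4 J3" and bJ3: "\<bar>\<integral>z. J3 z \<partial>M4\<bar> \<le> (8 / \<delta>^4) * (I * S)"
    by (rule cF[OF _ me _ e0 k8 I(2) S(2) J3b I(1) S(1)[folded e_def]]; simp)+
  have "(\<integral>z. J1 z + J2 z \<partial>M4) = (\<integral>z. (case z of (v,w,x,y) \<Rightarrow> q1 v w x y) + (case z of (v,w,x,y) \<Rightarrow> q2 v w x y)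
       + (case z of (v,w,x,y) \<Rightarrow> q3 v w x y) + (case z of (v,w,x,y) \<Rightarrow> q4 v w x y) \<partial>M4)"
    by (rule Bochner_Integration.integral_cong) (auto simp: J1_def J2_def div)
  also have "\<dots> = 0" using intq Z by simp
  finally have J12: "(\<integral>z. J1 z \<partial>M4) = - (\<integral>z. J2 z \<partial>M4)" using iJ1 iJ2 by simp
  have "box_integrand F \<sigma> \<delta> z = J1 z + J3 z" for z
  proof -
    obtain v w x y where z: "z = (v,w,x,y)" by (cases z) auto
    have "J1 z + J3 z = box_integrand F \<sigma> \<delta> (v,w,x,y) * (Dz v w x y * tau \<epsilon> (Dz v w x y) + \<epsilon>\<^sup>2 / ((Dz v w x y)\<^sup>2 + \<epsilon>\<^sup>2))"
      by (simp add: z J1_def J3_def distrib_left)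
    then show ?thesis by (simp only: frac(3) z mult_1_right)
  qed
  then have "(\<integral>z. box_integrand F \<sigma> \<delta> z \<partial>M4) = (\<integral>z. J1 z \<partial>M4) + (\<integral>z. J3 z \<partial>M4)" using iJ1 iJ3 by simp
  then have "\<bar>\<integral>z. box_integrand F \<sigma> \<delta> z \<partial>M4\<bar> \<le> (\<eta> * (20480 * L)) * (I * 8) + (8 / \<delta>^4) * (I * S)"
    using J12 bJ2 bJ3 by linarith
  also have "\<dots> = I * (\<eta> * (163840 / (\<delta>^5 * \<epsilon>\<^sup>2)) + 8 * S / \<delta>^4)"
    by (simp add: L_def algebra_simps)
  finally show ?thesis .
qed

section \<open>Average of the regularised determinant\<close>

lemma emeasure_square_sublevel:
  assumes "0 \<le> \<theta>"
  shows "emeasure lborel {b. \<bar>b\<^sup>2 - c\<^sup>2\<bar> \<le> \<theta>\<^sup>2} \<le> ennreal (4 * \<theta>)"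
  using emeasure_poly_sublevel[of "[:-(c\<^sup>2), 0, 1:]" \<theta>] assms
  by (simp add: power2_eq_square algebra_simps numeral_2_eq_2)

text \<open>Here \<epsilon> = \<theta>^32. Where |D| > \<theta>^16 the quotient is at most
  \<theta>^64/\<theta>^32 <= \<theta>. The remaining a have measure at most 48 \<theta> unless b^2
  is within \<theta>^2 of c^2, and such b have measure at most 4 \<theta>. Integration in a gives 2
  \<theta> + 48 \<theta>, with 2 more for the exceptional b; then b gives 100 \<theta> + 8 \<theta>,
  and c doubles this.\<close>

lemma nn_integral_corner_det_sublevel:
  assumes \<sigma>: "\<bar>\<sigma>\<bar> = 1" and \<theta>: "0 < \<theta>" "\<theta> \<le> 1"
  shows "(\<integral>\<^sup>+c. \<integral>\<^sup>+b. \<integral>\<^sup>+a. ennreal (cube a b c * ((\<theta>^32)\<^sup>2 / ((corner_det \<sigma> a b (a + c - b) c)\<^sup>2 + (\<theta>^32)\<^sup>2))) \<partial>lborel \<partial>lborel \<partial>lborel)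
    \<le> ennreal (216 * \<theta>)"
proof -
  define e where "e a b c = cube a b c * ((\<theta>^32)\<^sup>2 / ((corner_det \<sigma> a b (a + c - b) c)\<^sup>2 + (\<theta>^32)\<^sup>2))" for a b c
  define X where "X b c = {a. \<bar>a\<bar> \<le> 1 \<and> \<bar>a + c - b\<bar> \<le> 1 \<and> \<bar>corner_det \<sigma> a b (a + c - b) c\<bar> \<le> \<theta>^16}" for b c
  define Y where "Y c = {b. \<bar>b\<^sup>2 - c\<^sup>2\<bar> \<le> \<theta>\<^sup>2}" for c
  let ?J = "{-1..1::real}"
  have \<sigma>2: "\<sigma>\<^sup>2 = 1" using \<sigma> by (simp add: abs_square_eq_1)
  have mX: "X b c \<in> sets borel" for b c unfolding X_def by measurable
  have mY: "Y c \<in> sets borel" for c unfolding Y_def by measurable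
  have e_le: "ennreal (e a b c) \<le> ennreal \<theta> * indicator ?J a * indicator ?J b * indicator ?J c
      + indicator (X b c) a * indicator ?J b * indicator ?J c" for a b c
  proof (cases "cube a b c = 1")
    case True
    then have J: "a \<in> ?J" "b \<in> ?J" "c \<in> ?J" and ac: "\<bar>a\<bar> \<le> 1" "\<bar>a + c - b\<bar> \<le> 1"
      by (auto simp: cube_def abs_le_iff split: if_splits)
    define D where "D = corner_det \<sigma> a b (a + c - b) c"
    have pos: "0 < D\<^sup>2 + (\<theta>^32)\<^sup>2" using \<theta> by (simp add: add_nonneg_pos)
    have e: "e a b c = (\<theta>^32)\<^sup>2 / (D\<^sup>2 + (\<theta>^32)\<^sup>2)" using True by (simp add: e_def D_def)
    have le1: "e a b c \<le> 1" using pos by (simp add: e divide_simps)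
    show ?thesis
    proof (cases "\<bar>D\<bar> \<le> \<theta>^16")
      case True
      then have "a \<in> X b c" using ac by (simp add: X_def D_def)
      then show ?thesis using J le1 by (simp add: ennreal_le_1 add_increasing)
    next
      case False
      then have "(\<theta>^16)\<^sup>2 \<le> D\<^sup>2" using \<theta> by (metis abs_le_square_iff abs_of_nonneg less_eq_real_def linorder_not_le power2_abs zero_le_power)
      then have D: "\<theta>^32 \<le> D\<^sup>2" by (simp flip: power_mult)
      have "e a b c \<le> (\<theta>^32)\<^sup>2 / \<theta>^32" unfolding e using D \<theta> pos
        by (intro divide_left_mono) (auto intro!: mult_pos_pos add_increasing2)
      also have "\<dots> = \<theta>^32" unfolding power2_eq_square using \<theta> by (intro nonzero_mult_div_cancel_right) simp
      also have "\<dots> \<le> \<theta>" using \<theta> power_decreasing[of 1 32 \<theta>] by simp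
      finally show ?thesis using J by (simp add: add_increasing2 ennreal_leI)
    qed
  qed (auto simp: e_def cube_def)
  have inner: "(\<integral>\<^sup>+a. ennreal (e a b c) \<partial>lborel) \<le> (ennreal (50 * \<theta>) + 2 * indicator (Y c) b) * indicator ?J b * indicator ?J c" for b c
  proof (cases "b \<in> ?J \<and> c \<in> ?J")
    case True
    then have bc: "\<bar>b\<bar> \<le> 1" "\<bar>c\<bar> \<le> 1" by auto
    have "(\<integral>\<^sup>+a. ennreal (e a b c) \<partial>lborel) \<le> (\<integral>\<^sup>+a. ennreal \<theta> * indicator ?J a + indicator (X b c) a \<partial>lborel)"
      using e_le[of _ b c] True by (intro nn_integral_mono) simp
    also have "\<dots> = ennreal \<theta> * 2 + emeasure lborel (X b c)"
      using mX by (simp add: nn_integral_add nn_integral_cmult)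
    also have "\<dots> \<le> ennreal (50 * \<theta>) + 2 * indicator (Y c) b"
    proof (cases "b \<in> Y c")
      case True
      have "emeasure lborel (X b c) \<le> emeasure lborel ?J"
        by (rule emeasure_mono) (auto simp: X_def)
      also have "\<dots> = 2" by simp
      finally have 2: "emeasure lborel (X b c) \<le> 2" .
      have "ennreal \<theta> * 2 \<le> ennreal (50 * \<theta>)" using \<theta> by (simp add: ennreal_mult'[symmetric] ennreal_leI flip: ennreal_numeral)
      then show ?thesis using True 2 by (simp add: add_mono)
    next
      case False
      then have "\<bar>b\<^sup>2 - c\<^sup>2\<bar> \<ge> \<theta>\<^sup>2" by (simp add: Y_def)
      from emeasure_corner_det_sublevel[OF \<sigma>2 bc \<theta>(1) this]
      have "ennreal \<theta> * 2 + emeasure lborel (X b c) \<le> ennreal \<theta> * 2 + ennreal (48 * \<theta>)"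
        unfolding X_def by (rule add_left_mono)
      also have "\<dots> = ennreal (50 * \<theta>)" using \<theta> by (simp add: ennreal_mult'[symmetric] ennreal_plus[symmetric] del: ennreal_plus flip: ennreal_numeral)
      finally show ?thesis using False by simp
    qed
    finally show ?thesis using True by simp
  next
    case False
    then have "e a b c = 0" for a by (auto simp: e_def cube_def)
    then show ?thesis by simp
  qed
  have middle: "(\<integral>\<^sup>+b. (ennreal (50 * \<theta>) + 2 * indicator (Y c) b) * indicator ?J b * indicator ?J c \<partial>lborel) \<le> ennreal (108 * \<theta>) * indicator ?J c" for c
  proof -
    have "(\<integral>\<^sup>+b. (ennreal (50 * \<theta>) + 2 * indicator (Y c) b) * indicator ?J b * indicator ?J c \<partial>lborel)
      \<le> (\<integral>\<^sup>+b. (ennreal (50 * \<theta>) * indicator ?J b + 2 * indicator (Y c) b) * indicator ?J c \<partial>lborel)"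
      by (intro nn_integral_mono) (auto split: split_indicator)
    also have "\<dots> = (ennreal (50 * \<theta>) * 2 + 2 * emeasure lborel (Y c)) * indicator ?J c"
      using mY by (simp add: nn_integral_multc nn_integral_add nn_integral_cmult)
    also have "\<dots> \<le> (ennreal (50 * \<theta>) * 2 + 2 * ennreal (4 * \<theta>)) * indicator ?J c"
      using emeasure_square_sublevel[of \<theta> c] \<theta> unfolding Y_def by (intro mult_right_mono add_left_mono mult_left_mono) auto
    also have "ennreal (50 * \<theta>) * 2 + 2 * ennreal (4 * \<theta>) = ennreal (108 * \<theta>)"
      using \<theta> by (simp add: ennreal_mult'[symmetric] ennreal_plus[symmetric] del: ennreal_plus flip: ennreal_numeral)
    finally show ?thesis .
  qed
  have "(\<integral>\<^sup>+c. \<integral>\<^sup>+b. \<integral>\<^sup>+a. ennreal (e a b c) \<partial>lborel \<partial>lborel \<partial>lborel) \<le> (\<integral>\<^sup>+c. ennreal (108 * \<theta>) * indicator ?J c \<partial>lborel)"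
    by (intro nn_integral_mono order_trans[OF nn_integral_mono[OF inner] middle])
  also have "\<dots> = ennreal (216 * \<theta>)"
    using \<theta> by (simp add: nn_integral_cmult ennreal_mult'[symmetric] flip: ennreal_numeral)
  finally show ?thesis unfolding e_def .
qed

section \<open>Limits in the box form\<close>

lemma nn_integral_plane:
  fixes g :: "real \<Rightarrow> ennreal"
  assumes [measurable]: "g \<in> borel_measurable borel"
  shows "(\<integral>\<^sup>+v. \<integral>\<^sup>+x. g (x - \<sigma> * circ (x - v)) \<partial>lborel \<partial>lborel) = (\<integral>\<^sup>+x. g x \<partial>lborel) * \<infinity>"
proof -
  have "(\<integral>\<^sup>+v. \<integral>\<^sup>+x. g (x - \<sigma> * circ (x - v)) \<partial>lborel \<partial>lborel) = (\<integral>\<^sup>+x. \<integral>\<^sup>+v. g (x - \<sigma> * circ (x - v)) \<partial>lborel \<partial>lborel)"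
    by (rule lborel_pair.Fubini') simp
  also have "\<dots> = (\<integral>\<^sup>+x. \<integral>\<^sup>+c. g (x - \<sigma> * circ c) \<partial>lborel \<partial>lborel)"
    by (intro nn_integral_cong nn_integral_reflect_translate(2)[of "\<lambda>c. g (_ - \<sigma> * circ c)"]) simp
  also have "\<dots> = (\<integral>\<^sup>+c. \<integral>\<^sup>+x. g (x - \<sigma> * circ c) \<partial>lborel \<partial>lborel)"
    by (rule lborel_pair.Fubini') simp
  also have "\<dots> = (\<integral>\<^sup>+x. g x \<partial>lborel) * \<infinity>"
    by (simp add: nn_integral_reflect_translate(1)[of g])
  finally show ?thesis .
qed

text \<open>Each corner value is a coordinate minus a function of a difference. After passing to
  that difference as a variable it is a translation, so preimages of null sets are null and almost
  everywhere convergence on the line carries over to the corners.\<close>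

lemma AE_M4_corners:
  assumes "AE y in lborel. P y"
  shows "AE (v, w, x, y) in M4. P (x - \<sigma> * circ (x - v)) \<and> P (x - \<sigma> * circ (x - w)) \<and> P (y - \<sigma> * circ (y - v)) \<and> P (y - \<sigma> * circ (y - w))"
proof -
  obtain N where N: "N \<in> null_sets lborel" "{y. \<not> P y} \<subseteq> N" using assms by (auto simp: eventually_ae_filter)
  then have [measurable]: "N \<in> sets borel" by auto
  \<comment> \<open>A null set makes the product in \<open>nn_integral_plane\<close> equal to 0
    times infinity, which is 0.\<close>
  have zN: "(\<integral>\<^sup>+v. \<integral>\<^sup>+x. indicator N (x - \<sigma> * circ (x - v)) \<partial>lborel \<partial>lborel) = 0"
    using N(1) by (subst nn_integral_plane) (auto simp: null_setsD1)
  have 1: "(\<integral>\<^sup>+(v,w,x,y). indicator N (x - \<sigma> * circ (x - v)) \<partial>M4) = 0"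
    by (subst nn_integral_M4) (simp_all add: nn_integral_multc zN)
  have 2: "(\<integral>\<^sup>+(v,w,x,y). indicator N (x - \<sigma> * circ (x - w)) \<partial>M4) = 0"
    by (subst nn_integral_M4) (simp_all add: nn_integral_multc zN)
  have 3: "(\<integral>\<^sup>+(v,w,x,y). indicator N (y - \<sigma> * circ (y - v)) \<partial>M4) = 0"
    by (subst nn_integral_M4) (simp_all add: nn_integral_multc zN)
  have 4: "(\<integral>\<^sup>+(v,w,x,y). indicator N (y - \<sigma> * circ (y - w)) \<partial>M4) = 0"
    by (subst nn_integral_M4) (simp_all add: nn_integral_multc zN)
  have ae: "AE z in M4. f z = 0" if "f \<in> borel_measurable M4" "(\<integral>\<^sup>+z. f z \<partial>M4) = 0" for f :: "_ \<Rightarrow> ennreal"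
    using nn_integral_0_iff_AE that by blast
  have "AE z in M4. (case z of (v,w,x,y) \<Rightarrow> indicator N (x - \<sigma> * circ (x - v))) = (0::ennreal)"
    by (rule ae[OF _ 1]) measurable
  moreover have "AE z in M4. (case z of (v,w,x,y) \<Rightarrow> indicator N (x - \<sigma> * circ (x - w))) = (0::ennreal)"
    by (rule ae[OF _ 2]) measurable
  moreover have "AE z in M4. (case z of (v,w,x,y) \<Rightarrow> indicator N (y - \<sigma> * circ (y - v))) = (0::ennreal)"
    by (rule ae[OF _ 3]) measurable
  moreover have "AE z in M4. (case z of (v,w,x,y) \<Rightarrow> indicator N (y - \<sigma> * circ (y - w))) = (0::ennreal)"
    by (rule ae[OF _ 4]) measurable
  ultimately show ?thesis
    by eventually_elim (use N(2) in \<open>auto simp: indicator_def split: if_splits\<close>)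
qed

lemma box_integrand_limit:
  fixes f :: "real \<Rightarrow> real" and fs :: "nat \<Rightarrow> real \<Rightarrow> real"
  assumes [measurable]: "f \<in> borel_measurable borel" "\<And>n. fs n \<in> borel_measurable borel"
    and k: "integrable lborel k" and fk: "\<And>n y. \<bar>fs n y\<bar> \<le> k y" and f1: "\<And>n y. \<bar>fs n y\<bar> \<le> 1"
    and lim: "AE y in lborel. (\<lambda>n. fs n y) \<longlonglongrightarrow> f y" and \<delta>: "0 < \<delta>"
  shows "(\<lambda>n. \<integral>z. box_integrand (\<lambda>y. fs n y - fs n (y - h)) \<sigma> \<delta> z \<partial>M4) \<longlonglongrightarrow> (\<integral>z. box_integrand (\<lambda>y. f y - f (y - h)) \<sigma> \<delta> z \<partial>M4)"
proof (rule integral_dominated_convergence)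
  have [measurable]: "k \<in> borel_measurable borel" using k by auto
  have k0: "0 \<le> k y" for y using fk[of 0 y] by linarith
  \<comment> \<open>The majorant evaluates k only near corner 4, at the two points that enter F
    there; the other three factors are bounded.\<close>
  define K where "K = (\<lambda>(v,w,x,y). (8 / \<delta>^4) * ((k (y - \<sigma> * circ (y - w)) + k (y - \<sigma> * circ (y - w) - h)) * cube (x-v) (y-v) (y-w)))"
  have k2: "integrable lborel (\<lambda>y. k y + k (y - h))"
    using k lborel_integrable_real_affine[OF k, of 1 "-h"] by (intro Bochner_Integration.integrable_add) (simp_all add: algebra_simps)
  define I where "I = (\<integral>y. k y + k (y - h) \<partial>lborel)"
  show "integrable M4 K"
  proof (rule corner_bound(1)[where g = "\<lambda>y. k y + k (y - h)" and e = cube and K = "8 / \<delta>^4" and I = I and S = 8 and \<sigma> = \<sigma>])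
    show "(\<integral>\<^sup>+y. ennreal (k y + k (y - h)) \<partial>lborel) \<le> ennreal I"
      unfolding I_def using nn_integral_eq_integral[OF k2] k0 by simp
    show "(\<integral>\<^sup>+c. \<integral>\<^sup>+b. \<integral>\<^sup>+a. ennreal (cube a b c) \<partial>lborel \<partial>lborel \<partial>lborel) \<le> ennreal 8" by (rule nn_integral_cube)
    show "0 \<le> I" unfolding I_def using k0 by (intro Bochner_Integration.integral_nonneg) simp
    show "K \<in> borel_measurable M4" unfolding K_def by measurable
  qed (use k0 \<delta> cube_cases(1) in \<open>auto simp: K_def abs_mult\<close>)
  have "AE y in lborel. (\<lambda>n. fs n (y - h)) \<longlonglongrightarrow> f (y - h)"
  proof -
    obtain N where N: "N \<in> null_sets lborel" "{y. \<not> (\<lambda>n. fs n y) \<longlonglongrightarrow> f y} \<subseteq> N" using lim by (auto simp: eventually_ae_filter)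
    then have [measurable]: "N \<in> sets borel" by auto
    have "(\<integral>\<^sup>+y. indicator N (y - h) \<partial>lborel) = 0"
      using N(1) by (subst nn_integral_reflect_translate(1)[of "indicator N"]) (auto simp: null_setsD1)
    then have "AE y in lborel. indicator N (y - h) = (0::ennreal)" by (subst (asm) nn_integral_0_iff_AE) auto
    then show ?thesis by eventually_elim (use N(2) in \<open>auto simp: indicator_def split: if_splits\<close>)
  qed
  with lim have "AE y in lborel. (\<lambda>n. fs n y - fs n (y - h)) \<longlonglongrightarrow> f y - f (y - h)"
    by eventually_elim (rule tendsto_diff)
  from AE_M4_corners[OF this, of \<sigma>]
  show "AE z in M4. (\<lambda>n. box_integrand (\<lambda>y. fs n y - fs n (y - h)) \<sigma> \<delta> z) \<longlonglongrightarrow> box_integrand (\<lambda>y. f y - f (y - h)) \<sigma> \<delta> z"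
  proof eventually_elim
    case (elim z)
    then show ?case
      by (cases z) (auto simp: box_integrand_def arc_kernel_def intro!: tendsto_intros)
  qed
  show "AE z in M4. norm (box_integrand (\<lambda>y. fs n y - fs n (y - h)) \<sigma> \<delta> z) \<le> K z" for n
  proof (rule AE_I2)
    fix z :: "real \<times> real \<times> real \<times> real"
    obtain v w x y where z: "z = (v,w,x,y)" by (cases z) auto
    have Fb: "\<bar>fs n y - fs n (y - h)\<bar> \<le> 2" for y using f1[of n y] f1[of n "y - h"] by linarith
    from box_integrand_le[where F = "\<lambda>y. fs n y - fs n (y - h)" and \<sigma> = \<sigma> and v = v and w = w and x = x and y = y, OF Fb \<delta>]
    have "\<bar>box_integrand (\<lambda>y. fs n y - fs n (y - h)) \<sigma> \<delta> z\<bar> \<le>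
      (8 / \<delta>^4) * (\<bar>fs n (y - \<sigma> * circ (y - w)) - fs n (y - \<sigma> * circ (y - w) - h)\<bar> * cube (x-v) (y-v) (y-w))" by (simp add: z)
    also have "\<dots> \<le> K z"
      unfolding K_def z prod.case
    proof (intro mult_left_mono mult_right_mono cube_cases)
      show "\<bar>fs n (y - \<sigma> * circ (y - w)) - fs n (y - \<sigma> * circ (y - w) - h)\<bar> \<le> k (y - \<sigma> * circ (y - w)) + k (y - \<sigma> * circ (y - w) - h)"
        using fk[of n "y - \<sigma> * circ (y - w)"] fk[of n "y - \<sigma> * circ (y - w) - h"] by linarith
    qed (use \<delta> in auto)
    finally show "norm (box_integrand (\<lambda>y. fs n y - fs n (y - h)) \<sigma> \<delta> z) \<le> K z" by simp
  qed
qed measurable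

lemma box_form_limit:
  fixes f :: "real \<Rightarrow> real" and fs :: "nat \<Rightarrow> real \<Rightarrow> real"
  assumes meas[measurable]: "f \<in> borel_measurable borel" "\<And>n. fs n \<in> borel_measurable borel"
    and k: "integrable lborel k" and fk: "\<And>n y. \<bar>fs n y\<bar> \<le> k y" and f1: "\<And>n y. \<bar>fs n y\<bar> \<le> 1"
    and lim: "AE y in lborel. (\<lambda>n. fs n y) \<longlonglongrightarrow> f y" and \<delta>: "0 < \<delta>"
    and bound: "\<And>n. \<bar>\<integral>z. box_integrand (\<lambda>y. fs n y - fs n (y - h)) \<sigma> \<delta> z \<partial>M4\<bar> \<le> C * (\<integral>y. \<bar>fs n y\<bar> \<partial>lborel)"
  shows "\<bar>\<integral>z. box_integrand (\<lambda>y. f y - f (y - h)) \<sigma> \<delta> z \<partial>M4\<bar> \<le> C * (\<integral>y. \<bar>f y\<bar> \<partial>lborel)"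
proof -
  have "(\<lambda>n. \<integral>y. \<bar>fs n y\<bar> \<partial>lborel) \<longlonglongrightarrow> (\<integral>y. \<bar>f y\<bar> \<partial>lborel)"
  proof (rule integral_dominated_convergence[where w = k])
    show "AE y in lborel. (\<lambda>n. \<bar>fs n y\<bar>) \<longlonglongrightarrow> \<bar>f y\<bar>" using lim by eventually_elim (rule tendsto_rabs)
  qed (use k fk in auto)
  then have "(\<lambda>n. C * (\<integral>y. \<bar>fs n y\<bar> \<partial>lborel)) \<longlonglongrightarrow> C * (\<integral>y. \<bar>f y\<bar> \<partial>lborel)" by (rule tendsto_mult_left)
  moreover have "(\<lambda>n. \<bar>\<integral>z. box_integrand (\<lambda>y. fs n y - fs n (y - h)) \<sigma> \<delta> z \<partial>M4\<bar>) \<longlonglongrightarrow> \<bar>\<integral>z. box_integrand (\<lambda>y. f y - f (y - h)) \<sigma> \<delta> z \<partial>M4\<bar>"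
    by (intro tendsto_rabs box_integrand_limit[OF meas k fk f1 lim \<delta>])
  ultimately show ?thesis using bound by (intro LIMSEQ_le) auto
qed

text \<open>The bound of \<open>box_form_smooth\<close> at \<eta> = |h|, \<epsilon> = \<theta>^32
  and S = 216 \<theta>; the factor 2 compares the L^1 norm of f - \<tau>_h f with that of f.\<close>

definition box_const :: "real \<Rightarrow> real \<Rightarrow> real \<Rightarrow> real" where
  "box_const \<delta> \<theta> h = 2 * (\<bar>h\<bar> * (163840 / (\<delta>^5 * (\<theta>^32)\<^sup>2)) + 8 * (216 * \<theta>) / \<delta>^4)"

text \<open>For an antiderivative A of f, the function A(y) - A(y - h) has derivative F and is at
  most |h| because |f| <= 1. This is the source of the gain in h.\<close>

lemma box_form_C1:
  assumes D: "\<And>y. (f has_real_derivative f' y) (at y)" and cf': "continuous_on UNIV f'"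
    and supp: "\<And>y. \<bar>y\<bar> > R \<Longrightarrow> f y = 0" "\<And>y. \<bar>y\<bar> > R \<Longrightarrow> f' y = 0" and f1: "\<And>y. \<bar>f y\<bar> \<le> 1" and h: "\<bar>h\<bar> \<le> 1"
    and \<sigma>: "\<bar>\<sigma>\<bar> = 1" and \<delta>: "0 < \<delta>" "\<delta> \<le> 1" and \<theta>: "0 < \<theta>" "\<theta> \<le> 1"
  shows "\<bar>\<integral>z. box_integrand (\<lambda>y. f y - f (y - h)) \<sigma> \<delta> z \<partial>M4\<bar> \<le> box_const \<delta> \<theta> h * (\<integral>y. \<bar>f y\<bar> \<partial>lborel)"
proof -
  have cf: "continuous_on UNIV f" using D by (meson DERIV_isCont continuous_at_imp_continuous_on)
  have [measurable]: "f \<in> borel_measurable borel" "f' \<in> borel_measurable borel"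
    using cf cf' by (auto intro: borel_measurable_continuous_onI)
  obtain B where B: "0 \<le> B" "\<And>y. \<bar>f' y\<bar> \<le> B"
  proof -
    have "bounded (f' ` {-R..R})"
      using cf' by (intro compact_imp_bounded compact_continuous_image) (auto intro: continuous_on_subset)
    then obtain b where b: "\<And>y. y \<in> {-R..R} \<Longrightarrow> \<bar>f' y\<bar> \<le> b" unfolding bounded_iff by fastforce
    have "\<bar>f' y\<bar> \<le> max 0 b" for y
    proof (cases "\<bar>y\<bar> > R")
      case False
      then have "y \<in> {-R..R}" by auto
      from b[OF this] show ?thesis by linarith
    qed (simp add: supp)
    then show thesis by (intro that[of "max 0 b"]) auto
  qed
  obtain A where A: "\<And>y. (A has_real_derivative f y) (at y)"
  proof -
    have "isCont f x" for x using D DERIV_isCont by blast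
    then show thesis
      using that einterval_antiderivative[of "-\<infinity>" \<infinity> f] by (auto simp: has_real_derivative_iff_has_vector_derivative)
  qed
  have shift: "((\<lambda>y. g (y - h)) has_real_derivative g' (y - h)) (at y)" if "\<And>y. (g has_real_derivative g' y) (at y)" for g g' y
  proof -
    have "((\<lambda>y. y - h) has_real_derivative 1) (at y)" by (auto intro!: derivative_eq_intros)
    from DERIV_chain2[where f = g and g = "\<lambda>y. y - h", OF that this] show ?thesis by simp
  qed
  have intf: "integrable lborel f"
  proof (rule integrableI_bounded_set[where A = "{-R..R}" and B = 1])
    show "AE x in lborel. x \<notin> {-R..R} \<longrightarrow> f x = 0" using supp(1) by (intro AE_I2) (auto simp: abs_if)
  qed (use f1 in \<open>auto simp: emeasure_lborel_Icc_eq\<close>)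
  define I where "I = 2 * (\<integral>y. \<bar>f y\<bar> \<partial>lborel)"
  define G where "G y = (2 + 2 * B) * indicator {-(\<bar>R\<bar>+1)..\<bar>R\<bar>+1} y" for y :: real
  have out: "f y - f (y - h) = 0" "f' y - f' (y - h) = 0" if "y \<notin> {-(\<bar>R\<bar>+1)..\<bar>R\<bar>+1}" for y
  proof -
    have "\<bar>y\<bar> > R" "\<bar>y - h\<bar> > R" using that h by (auto simp: abs_if split: if_splits)
    then show "f y - f (y - h) = 0" "f' y - f' (y - h) = 0" using supp by auto
  qed
  have F2: "\<bar>f y - f (y - h)\<bar> \<le> 2" for y using f1[of y] f1[of "y - h"] by linarith
  have "\<bar>\<integral>z. box_integrand (\<lambda>y. f y - f (y - h)) \<sigma> \<delta> z \<partial>M4\<bar> \<le> I * (\<bar>h\<bar> * (163840 / (\<delta>^5 * (\<theta>^32)\<^sup>2)) + 8 * (216 * \<theta>) / \<delta>^4)"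
  proof (rule box_form_smooth[where \<Phi> = "\<lambda>y. A y - A (y - h)" and F' = "\<lambda>y. f' y - f' (y - h)" and G = G and B = "2 + 2 * B"])
    show "((\<lambda>y. A y - A (y - h)) has_real_derivative f y - f (y - h)) (at y)" for y
      by (intro DERIV_diff A shift)
    show "((\<lambda>y. f y - f (y - h)) has_real_derivative f' y - f' (y - h)) (at y)" for y
      by (intro DERIV_diff D shift)
    show "\<bar>A y - A (y - h)\<bar> \<le> \<bar>h\<bar>" for y
      using field_differentiable_bound[of UNIV A f 1 y "y - h"] A f1 by simp
    show "\<bar>f y - f (y - h)\<bar> \<le> G y" for y
    proof (cases "y \<in> {-(\<bar>R\<bar>+1)..\<bar>R\<bar>+1}")
      case True
      then show ?thesis using F2[of y] B(1) unfolding G_def by simp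
    next
      case False
      then show ?thesis using out(1)[of y] by (simp add: G_def)
    qed
    show "\<bar>f' y - f' (y - h)\<bar> \<le> G y" for y
    proof (cases "y \<in> {-(\<bar>R\<bar>+1)..\<bar>R\<bar>+1}")
      case True
      then have "G y = 2 + 2 * B" by (simp add: G_def)
      then show ?thesis using B(2)[of y] B(2)[of "y - h"] B(1) by linarith
    next
      case False
      then show ?thesis using out(2)[of y] by (simp add: G_def)
    qed
    show "G \<in> borel_measurable borel" unfolding G_def by measurable
    show "G y \<le> 2 + 2 * B" for y using B(1) by (simp add: G_def indicator_def)
    show "(\<integral>\<^sup>+y. ennreal (G y) \<partial>lborel) < \<infinity>"
      using B(1) by (simp add: G_def ennreal_mult' nn_integral_cmult ennreal_mult_less_top emeasure_lborel_Icc_eq ennreal_indicator)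
    show "(\<integral>\<^sup>+y. ennreal \<bar>f y - f (y - h)\<bar> \<partial>lborel) \<le> ennreal I"
    proof -
      have "(\<integral>\<^sup>+y. ennreal \<bar>f y - f (y - h)\<bar> \<partial>lborel) \<le> (\<integral>\<^sup>+y. ennreal \<bar>f y\<bar> + ennreal \<bar>f (y - h)\<bar> \<partial>lborel)"
        by (intro nn_integral_mono) (simp add: abs_triangle_ineq4 flip: ennreal_plus)
      also have "\<dots> = (\<integral>\<^sup>+y. ennreal \<bar>f y\<bar> \<partial>lborel) + (\<integral>\<^sup>+y. ennreal \<bar>f y\<bar> \<partial>lborel)"
        by (simp add: nn_integral_add nn_integral_reflect_translate(1)[of "\<lambda>y. ennreal \<bar>f y\<bar>"])
      also have "(\<integral>\<^sup>+y. ennreal \<bar>f y\<bar> \<partial>lborel) = ennreal (\<integral>y. \<bar>f y\<bar> \<partial>lborel)"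
        using intf by (intro nn_integral_eq_integral) auto
      finally show ?thesis by (simp add: I_def flip: ennreal_plus)
    qed
    show "0 \<le> I" by (simp add: I_def)
    show "(\<integral>\<^sup>+c. \<integral>\<^sup>+b. \<integral>\<^sup>+a. ennreal (cube a b c * ((\<theta>^32)\<^sup>2 / ((corner_det \<sigma> a b (a + c - b) c)\<^sup>2 + (\<theta>^32)\<^sup>2))) \<partial>lborel \<partial>lborel \<partial>lborel)
      \<le> ennreal (216 * \<theta>)" by (rule nn_integral_corner_det_sublevel[OF \<sigma> \<theta>])
  qed (use F2 \<sigma> \<delta> \<theta> in \<open>auto simp: G_def power_le_one\<close>)
  also have "\<dots> = box_const \<delta> \<theta> h * (\<integral>y. \<bar>f y\<bar> \<partial>lborel)" by (simp add: I_def box_const_def mult_ac)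
  finally show ?thesis .
qed


section \<open>Approximation of bounded functions by C^1 functions\<close>

lemma DERIV_max_square: "((\<lambda>y. (max 0 y)\<^sup>2) has_real_derivative 2 * max 0 (y::real)) (at y)"
proof -
  consider "y > 0" | "y < 0" | "y = 0" by linarith
  then show ?thesis
  proof cases
    case 1
    have "((\<lambda>y. y\<^sup>2) has_real_derivative 2 * max 0 y) (at y)" using 1 by (auto intro!: derivative_eq_intros)
    then show ?thesis
      by (rule has_field_derivative_transform_within_open[where S = "{0<..}"]) (use 1 in auto)
  next
    case 2
    have "((\<lambda>y. 0) has_real_derivative 2 * max 0 y) (at y)" using 2 by simp
    then show ?thesis
      by (rule has_field_derivative_transform_within_open[where S = "{..<0}"]) (use 2 in auto)
  next
    case 3
    have "((\<lambda>h. (max 0 (0 + h))\<^sup>2 / h) \<longlongrightarrow> 0) (at (0::real))"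
    proof (rule Lim_null_comparison)
      show "\<forall>\<^sub>F h in at (0::real). norm ((max 0 (0 + h))\<^sup>2 / h) \<le> \<bar>h\<bar>"
        by (rule always_eventually) (auto simp: max_def power2_eq_square)
      show "((\<lambda>h::real. \<bar>h\<bar>) \<longlongrightarrow> 0) (at 0)" using tendsto_rabs[OF tendsto_ident_at[of "0::real"]] by simp
    qed
    then show ?thesis unfolding DERIV_def using 3 by simp
  qed
qed

text \<open>Squared positive parts are C^1. The two used here, one supported inside radius 2R and
  one outside radius R, never vanish together, so their quotient p/(p+q) is a cutoff with an
  explicit derivative.\<close>

lemma C1_cutoff:
  assumes "0 < (R::real)"
  obtains \<kappa> \<kappa>' where "\<And>y. (\<kappa> has_real_derivative \<kappa>' y) (at y)" "continuous_on UNIV \<kappa>'"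
    "\<And>y. \<bar>y\<bar> > 2 * R \<Longrightarrow> \<kappa> y = 0" "\<And>y. \<bar>y\<bar> > 2 * R \<Longrightarrow> \<kappa>' y = 0" "\<And>y. \<bar>y\<bar> \<le> R \<Longrightarrow> \<kappa> y = 1" "\<And>y. \<bar>\<kappa> y\<bar> \<le> 1"
proof -
  define p where "p y = (max 0 (4 * R\<^sup>2 - y\<^sup>2))\<^sup>2" for y :: real
  define q where "q y = (max 0 (y\<^sup>2 - R\<^sup>2))\<^sup>2" for y :: real
  define p' where "p' y = 2 * max 0 (4 * R\<^sup>2 - y\<^sup>2) * (- 2 * y)" for y :: real
  define q' where "q' y = 2 * max 0 (y\<^sup>2 - R\<^sup>2) * (2 * y)" for y :: real
  have R2: "0 < R\<^sup>2" using assms by simp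
  have dp: "(p has_real_derivative p' y) (at y)" for y
    unfolding p_def p'_def
    by (rule DERIV_chain2[where f = "\<lambda>y. (max 0 y)\<^sup>2" and g = "\<lambda>y. 4 * R\<^sup>2 - y\<^sup>2", OF DERIV_max_square]) (auto intro!: derivative_eq_intros)
  have dq: "(q has_real_derivative q' y) (at y)" for y
    unfolding q_def q'_def
    by (rule DERIV_chain2[where f = "\<lambda>y. (max 0 y)\<^sup>2" and g = "\<lambda>y. y\<^sup>2 - R\<^sup>2", OF DERIV_max_square]) (auto intro!: derivative_eq_intros)
  have pos: "p y + q y \<noteq> 0" for y
  proof -
    have "0 < max 0 (4 * R\<^sup>2 - y\<^sup>2) \<or> 0 < max 0 (y\<^sup>2 - R\<^sup>2)" using R2 by linarith
    then have "p y + q y > 0" unfolding p_def q_def by (auto intro: add_pos_nonneg add_nonneg_pos)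
    then show ?thesis by simp
  qed
  have p0: "p y = 0" "p' y = 0" if "\<bar>y\<bar> > 2 * R" for y
  proof -
    have "(2 * R)\<^sup>2 < \<bar>y\<bar>\<^sup>2" using that assms by (intro power_strict_mono) auto
    then show "p y = 0" "p' y = 0" by (simp_all add: p_def p'_def power_mult_distrib)
  qed
  define \<kappa>' where "\<kappa>' y = (p' y * (p y + q y) - p y * (p' y + q' y)) / ((p y + q y) * (p y + q y))" for y
  show thesis
  proof (rule that[of "\<lambda>y. p y / (p y + q y)" \<kappa>'])
    show "((\<lambda>y. p y / (p y + q y)) has_real_derivative \<kappa>' y) (at y)" for y
      unfolding \<kappa>'_def using DERIV_divide[OF dp DERIV_add[OF dp dq] pos] .
    have "continuous_on UNIV p" "continuous_on UNIV q" "continuous_on UNIV p'" "continuous_on UNIV q'"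
      unfolding p_def q_def p'_def q'_def by (intro continuous_intros)+
    then show "continuous_on UNIV \<kappa>'"
      unfolding \<kappa>'_def by (intro continuous_intros) (use pos in auto)
    show "\<bar>y\<bar> > 2 * R \<Longrightarrow> p y / (p y + q y) = 0" for y by (simp add: p0)
    show "\<bar>y\<bar> > 2 * R \<Longrightarrow> \<kappa>' y = 0" for y by (simp add: p0 \<kappa>'_def)
    show "\<bar>y\<bar> \<le> R \<Longrightarrow> p y / (p y + q y) = 1" for y
    proof -
      assume "\<bar>y\<bar> \<le> R"
      then have "y\<^sup>2 \<le> R\<^sup>2" using abs_le_square_iff[of y R] assms by simp
      then have "q y = 0" by (simp add: q_def)
      then show "p y / (p y + q y) = 1" using pos[of y] by simp
    qed
    have "0 \<le> p y" "0 \<le> q y" for y by (simp_all add: p_def q_def)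
    then show "\<bar>p y / (p y + q y)\<bar> \<le> 1" for y by (simp add: abs_divide divide_le_eq_1) (metis add_nonneg_eq_0_iff less_eq_real_def add_nonneg_nonneg)
  qed
qed

text \<open>Approximating $\arcsin f$ by polynomials $p_n$ keeps the bound $|\sin p_n| \le 1$.\<close>

lemma C1_approximation:
  fixes f :: "real \<Rightarrow> real"
  assumes f[measurable]: "f \<in> borel_measurable borel" and f1: "\<And>y. \<bar>f y\<bar> \<le> 1" and R: "0 < R" and supp: "\<And>y. \<bar>y\<bar> > R \<Longrightarrow> f y = 0"
  obtains fs fs' where "\<And>n y. (fs n has_real_derivative fs' n y) (at y)" "\<And>n. continuous_on UNIV (fs' n)"
    "\<And>(n::nat) y. \<bar>y\<bar> > 2 * R \<Longrightarrow> fs n y = 0" "\<And>n y. \<bar>y\<bar> > 2 * R \<Longrightarrow> fs' n y = 0" "\<And>n y. \<bar>fs n y\<bar> \<le> 1"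
    "AE y in lborel. (\<lambda>n. fs n y) \<longlonglongrightarrow> f y"
proof -
  obtain \<kappa> \<kappa>' where \<kappa>: "\<And>y. (\<kappa> has_real_derivative \<kappa>' y) (at y)" "continuous_on UNIV \<kappa>'"
    "\<And>y. \<bar>y\<bar> > 2 * R \<Longrightarrow> \<kappa> y = 0" "\<And>y. \<bar>y\<bar> > 2 * R \<Longrightarrow> \<kappa>' y = 0" "\<And>y. \<bar>y\<bar> \<le> R \<Longrightarrow> \<kappa> y = 1" "\<And>y. \<bar>\<kappa> y\<bar> \<le> 1"
    using C1_cutoff[OF R] by metis
  define \<theta> where "\<theta> y = arcsin (f y)" for y
  have sin\<theta>: "sin (\<theta> y) = f y" for y using f1[of y] by (simp add: \<theta>_def abs_le_iff)
  have m: "(\<lambda>x. if x \<in> {-1..1} then arcsin x else 0) \<in> borel_measurable borel"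
    by (rule borel_measurable_continuous_on_if) (auto intro: continuous_on_arcsin' continuous_on_const)
  have "\<theta> = (\<lambda>y. if f y \<in> {-1..1} then arcsin (f y) else 0)" using f1 by (auto simp: \<theta>_def abs_le_iff minus_le_iff)
  then have "\<theta> \<in> borel_measurable borel" using measurable_compose[OF f m] by (simp only:)
  then have "\<theta> \<in> borel_measurable lebesgue" by (simp add: measurable_completion)
  then have "\<theta> measurable_on UNIV" by (intro lebesgue_measurable_imp_measurable_on_real) auto
  then obtain N g where N: "negligible N" and g: "\<And>n. continuous_on UNIV (g n)" "\<And>x. x \<notin> N \<Longrightarrow> (\<lambda>n. g n x) \<longlonglongrightarrow> \<theta> x"
    unfolding measurable_on_def by auto
  \<comment> \<open>Uniform approximation within 1/(n+1) on [-n, n] is enough for pointwise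
    convergence, since every point lies in these intervals from some n on.\<close>
  have "\<exists>p. real_polynomial_function p \<and> (\<forall>x\<in>{-real n..real n}. \<bar>g n x - p x\<bar> < 1 / real (Suc n))" for n
    using Stone_Weierstrass_real_polynomial_function[of "{-real n..real n}" "g n" "1 / real (Suc n)"] g(1)[of n]
    by (metis compact_Icc continuous_on_subset of_nat_0_less_iff subset_UNIV zero_less_Suc zero_less_divide_1_iff)
  then obtain p where p: "\<And>n. real_polynomial_function (p n)" "\<And>n x. x \<in> {-real n..real n} \<Longrightarrow> \<bar>g n x - p n x\<bar> < 1 / real (Suc n)"
    by metis
  obtain p' where p': "\<And>n. real_polynomial_function (p' n)" "\<And>n x. (p n has_real_derivative p' n x) (at x)"
    using has_real_derivative_polynomial_function[OF p(1)] by metis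
  have cp: "continuous_on UNIV (p n)" "continuous_on UNIV (p' n)" for n
    using p(1) p'(1) by (simp_all add: continuous_on_polymonial_function real_polynomial_function_eq)
  have c\<kappa>: "continuous_on UNIV \<kappa>" using \<kappa>(1) by (meson DERIV_isCont continuous_at_imp_continuous_on)
  define fs where "fs n y = sin (p n y) * \<kappa> y" for n y
  define fs' where "fs' n y = cos (p n y) * p' n y * \<kappa> y + \<kappa>' y * sin (p n y)" for n y
  show thesis
  proof (rule that[of fs fs'])
    have "((\<lambda>y. sin (p n y)) has_real_derivative cos (p n y) * p' n y) (at y)" for n y
      by (rule DERIV_chain2[where f = sin and g = "p n", OF DERIV_sin p'(2)])
    then show "(fs n has_real_derivative fs' n y) (at y)" for n y
      unfolding fs_def fs'_def by (intro DERIV_mult \<kappa>(1))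
    show "continuous_on UNIV (fs' n)" for n
      unfolding fs'_def by (intro continuous_intros cp c\<kappa> \<kappa>(2))
    show "\<bar>y\<bar> > 2 * R \<Longrightarrow> fs n y = 0" "\<bar>y\<bar> > 2 * R \<Longrightarrow> fs' n y = 0" for n y
      by (simp_all add: fs_def fs'_def \<kappa>)
    show "\<bar>fs n y\<bar> \<le> 1" for n y
      using abs_mult_le[OF abs_sin_le_one \<kappa>(6), of "p n y" y] by (simp add: fs_def)
    have conv: "(\<lambda>n. fs n y) \<longlonglongrightarrow> f y" if "y \<notin> N" for y
    proof -
      have "(\<lambda>n. g n y - p n y) \<longlonglongrightarrow> 0"
      proof (rule Lim_null_comparison)
        show "\<forall>\<^sub>F n in sequentially. norm (g n y - p n y) \<le> 1 / real (Suc n)"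
          unfolding eventually_sequentially
        proof (intro exI[of _ "nat \<lceil>\<bar>y\<bar>\<rceil>"] allI impI)
          fix n assume "nat \<lceil>\<bar>y\<bar>\<rceil> \<le> n"
          then have "y \<in> {-real n..real n}" by auto
          from p(2)[OF this] show "norm (g n y - p n y) \<le> 1 / real (Suc n)" by simp
        qed
        show "(\<lambda>n. 1 / real (Suc n)) \<longlonglongrightarrow> 0" using LIMSEQ_inverse_real_of_nat by (simp add: inverse_eq_divide)
      qed
      from tendsto_diff[OF g(2)[OF that] this] have "(\<lambda>n. p n y) \<longlonglongrightarrow> \<theta> y" by simp
      then have "(\<lambda>n. fs n y) \<longlonglongrightarrow> sin (\<theta> y) * \<kappa> y" unfolding fs_def by (intro tendsto_intros)
      moreover have "sin (\<theta> y) * \<kappa> y = f y"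
        using supp[of y] \<kappa>(5)[of y] by (cases "\<bar>y\<bar> > R") (simp_all add: sin\<theta>)
      ultimately show ?thesis by simp
    qed
    have "N \<in> null_sets lebesgue" using N by (simp add: negligible_iff_null_sets)
    then have "AE y in lebesgue. y \<notin> N" by (rule AE_not_in)
    then have "AE y in lborel. y \<notin> N" by (simp add: AE_completion_iff)
    then show "AE y in lborel. (\<lambda>n. fs n y) \<longlonglongrightarrow> f y" by eventually_elim (rule conv)
  qed
qed

text \<open>Two limits are taken: C^1 functions approximate bounded functions supported in an
  interval, and these approximate f by restriction to growing intervals. In both, the constant is
  independent of n and the L^1 norms converge.\<close>

lemma box_form_bound:
  fixes f :: "real \<Rightarrow> real"
  assumes f[measurable]: "f \<in> borel_measurable borel" and f1: "\<And>y. \<bar>f y\<bar> \<le> 1" and int: "integrable lborel f" and h: "\<bar>h\<bar> \<le> 1"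
    and \<sigma>: "\<bar>\<sigma>\<bar> = 1" and \<delta>: "0 < \<delta>" "\<delta> \<le> 1" and \<theta>: "0 < \<theta>" "\<theta> \<le> 1"
  shows "\<bar>\<integral>z. box_integrand (\<lambda>y. f y - f (y - h)) \<sigma> \<delta> z \<partial>M4\<bar> \<le> box_const \<delta> \<theta> h * (\<integral>y. \<bar>f y\<bar> \<partial>lborel)"
proof -
  have compact: "\<bar>\<integral>z. box_integrand (\<lambda>y. g y - g (y - h)) \<sigma> \<delta> z \<partial>M4\<bar> \<le> box_const \<delta> \<theta> h * (\<integral>y. \<bar>g y\<bar> \<partial>lborel)"
    if g[measurable]: "g \<in> borel_measurable borel" and g1: "\<And>y. \<bar>g y\<bar> \<le> 1" and R: "0 < R" and supp: "\<And>y. \<bar>y\<bar> > R \<Longrightarrow> g y = 0" for g R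
  proof -
    obtain fs fs' where fs: "\<And>n y. (fs n has_real_derivative fs' n y) (at y)" "\<And>n. continuous_on UNIV (fs' n)"
      "\<And>(n::nat) y. \<bar>y\<bar> > 2 * R \<Longrightarrow> fs n y = 0" "\<And>n y. \<bar>y\<bar> > 2 * R \<Longrightarrow> fs' n y = 0" "\<And>n y. \<bar>fs n y\<bar> \<le> 1"
      "AE y in lborel. (\<lambda>n. fs n y) \<longlonglongrightarrow> g y"
      using C1_approximation[OF g g1 R supp] by blast
    show ?thesis
    proof (rule box_form_limit[where fs = fs and k = "indicator {-2*R..2*R}"])
      show "integrable lborel (indicator {-2*R..2*R} :: real \<Rightarrow> real)" by (simp add: emeasure_lborel_Icc_eq)
      show "\<bar>fs n y\<bar> \<le> indicator {-2*R..2*R} y" for n y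
        using fs(5)[of n y] fs(3)[of y n] by (auto simp: indicator_def)
    qed (use fs(5,6) \<delta> in \<open>auto intro!: DERIV_borel[OF fs(1)] box_form_C1[OF fs(1,2,3,4,5) h \<sigma> \<delta> \<theta>]\<close>)
  qed
  define fs where "fs n y = indicator {-real (Suc n)..real (Suc n)} y * f y" for n y
  show ?thesis
  proof (rule box_form_limit[where fs = fs and k = "\<lambda>y. \<bar>f y\<bar>"])
    show "\<bar>fs n y\<bar> \<le> \<bar>f y\<bar>" for n y by (simp add: fs_def indicator_def)
    then show *: "\<bar>fs n y\<bar> \<le> 1" for n y using f1[of y] by (meson order_trans)
    show m: "fs n \<in> borel_measurable borel" for n unfolding fs_def by measurable
    show "AE y in lborel. (\<lambda>n. fs n y) \<longlonglongrightarrow> f y"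
    proof (rule AE_I2, rule tendsto_eventually)
      fix y
      show "\<forall>\<^sub>F n in sequentially. fs n y = f y"
        unfolding eventually_sequentially
      proof (intro exI[of _ "nat \<lceil>\<bar>y\<bar>\<rceil>"] allI impI)
        fix n assume "nat \<lceil>\<bar>y\<bar>\<rceil> \<le> n"
        then have "\<bar>y\<bar> \<le> real (Suc n)" by linarith
        then show "fs n y = f y" by (simp add: fs_def abs_le_iff indicator_def)
      qed
    qed
    show "\<bar>\<integral>z. box_integrand (\<lambda>y. fs n y - fs n (y - h)) \<sigma> \<delta> z \<partial>M4\<bar> \<le> box_const \<delta> \<theta> h * (\<integral>y. \<bar>fs n y\<bar> \<partial>lborel)" for n
      by (rule compact[OF m *, of "real (Suc n)"]) (auto simp: fs_def indicator_def)
  qed (use int \<delta> in auto)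
qed

section \<open>The Cauchy-Schwarz step\<close>

abbreviation M2 :: "(real \<times> real) measure" where "M2 \<equiv> lborel \<Otimes>\<^sub>M lborel"

lemma integral_product_pair:
  fixes a b :: "real \<Rightarrow> real"
  assumes a: "integrable lborel a" and b: "integrable lborel b"
  shows "integrable M2 (\<lambda>(x, y). a x * b y)" "(\<integral>(x, y). a x * b y \<partial>M2) = (\<integral>x. a x \<partial>lborel) * (\<integral>x. b x \<partial>lborel)"
proof -
  have [measurable]: "a \<in> borel_measurable borel" "b \<in> borel_measurable borel" using a b by auto
  show int: "integrable M2 (\<lambda>(x, y). a x * b y)"
    by (rule lborel_pair.Fubini_integrable) (use a b in \<open>auto simp: abs_mult\<close>)
  show "(\<integral>(x, y). a x * b y \<partial>M2) = (\<integral>x. a x \<partial>lborel) * (\<integral>x. b x \<partial>lborel)"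
    using lborel_pair.integral_fst'[OF int] by simp
qed

lemma nn_integral_M4_assoc:
  fixes f :: "real \<times> real \<times> real \<times> real \<Rightarrow> ennreal"
  assumes [measurable]: "f \<in> borel_measurable M4"
  shows "(\<integral>\<^sup>+p. f (fst (fst p), snd (fst p), snd p) \<partial>(M2 \<Otimes>\<^sub>M M2)) = (\<integral>\<^sup>+z. f z \<partial>M4)"
proof -
  have "(\<integral>\<^sup>+p. f (fst (fst p), snd (fst p), snd p) \<partial>(M2 \<Otimes>\<^sub>M M2)) = (\<integral>\<^sup>+p. \<integral>\<^sup>+q. f (fst p, snd p, q) \<partial>M2 \<partial>M2)"
    by (subst sigma_finite_measure.nn_integral_fst[OF sigma_finite_lborel_pair(1), symmetric]) simp_all
  also have "\<dots> = (\<integral>\<^sup>+p. \<integral>\<^sup>+x. \<integral>\<^sup>+y. f (fst p, snd p, x, y) \<partial>lborel \<partial>lborel \<partial>M2)"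
    by (intro nn_integral_cong) (subst lborel.nn_integral_fst[symmetric]; simp)
  also have "\<dots> = (\<integral>\<^sup>+v. \<integral>\<^sup>+w. \<integral>\<^sup>+x. \<integral>\<^sup>+y. f (v, w, x, y) \<partial>lborel \<partial>lborel \<partial>lborel \<partial>lborel)"
    by (subst lborel.nn_integral_fst[symmetric]) simp_all
  also have "\<dots> = (\<integral>\<^sup>+z. f z \<partial>M4)" by (rule nn_integral_M4[symmetric]) simp
  finally show ?thesis .
qed

lemma integral_M4_assoc:
  fixes f :: "real \<times> real \<times> real \<times> real \<Rightarrow> real"
  assumes int: "integrable M4 f"
  shows "integrable (M2 \<Otimes>\<^sub>M M2) (\<lambda>p. f (fst (fst p), snd (fst p), snd p))"
    "(\<integral>p. f (fst (fst p), snd (fst p), snd p) \<partial>(M2 \<Otimes>\<^sub>M M2)) = (\<integral>z. f z \<partial>M4)"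
proof -
  have [measurable]: "f \<in> borel_measurable M4" using int by auto
  have eq: "(\<integral>\<^sup>+p. g (f (fst (fst p), snd (fst p), snd p)) \<partial>(M2 \<Otimes>\<^sub>M M2)) = (\<integral>\<^sup>+z. g (f z) \<partial>M4)"
    if [measurable]: "g \<in> borel_measurable borel" for g :: "real \<Rightarrow> ennreal"
    using nn_integral_M4_assoc[of "\<lambda>z. g (f z)"] by simp
  show int': "integrable (M2 \<Otimes>\<^sub>M M2) (\<lambda>p. f (fst (fst p), snd (fst p), snd p))"
  proof (rule integrableI_bounded)
    show "(\<integral>\<^sup>+p. ennreal (norm (f (fst (fst p), snd (fst p), snd p))) \<partial>(M2 \<Otimes>\<^sub>M M2)) < \<infinity>"
      using int eq[of "\<lambda>r. ennreal (norm r)"] by (simp add: integrable_iff_bounded)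
  qed measurable
  show "(\<integral>p. f (fst (fst p), snd (fst p), snd p) \<partial>(M2 \<Otimes>\<^sub>M M2)) = (\<integral>z. f z \<partial>M4)"
    using eq[of "\<lambda>r. ennreal r"] eq[of "\<lambda>r. ennreal (- r)"]
    by (simp add: real_lebesgue_integral_def[OF int] real_lebesgue_integral_def[OF int'])
qed

lemma arc_kernel_le: "(\<And>y. \<bar>F y\<bar> \<le> 2) \<Longrightarrow> 0 < \<delta> \<Longrightarrow> \<bar>arc_kernel F \<sigma> \<delta> x v\<bar> \<le> (2 / \<delta>) * indicator {-1..1} (x - v)"
proof (cases "\<bar>x - v\<bar> \<le> 1")
  case True
  assume "\<And>y. \<bar>F y\<bar> \<le> 2" "0 < \<delta>"
  then have "\<bar>arc_kernel F \<sigma> \<delta> x v\<bar> \<le> 2 * (1 / \<delta>)"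
    unfolding arc_kernel_def using wt_le[of \<delta> "x - v"] by (intro abs_mult_le) auto
  then show ?thesis using True by (simp add: abs_le_iff)
qed (simp add: arc_kernel_def wt_eq_0)

definition arc_op :: "(real \<Rightarrow> real) \<Rightarrow> (real \<Rightarrow> real) \<Rightarrow> real \<Rightarrow> real \<Rightarrow> real \<Rightarrow> real" where
  "arc_op F g \<sigma> \<delta> x = (\<integral>v. arc_kernel F \<sigma> \<delta> x v * g v \<partial>lborel)"

lemma integrable_bounded_interval:
  fixes f :: "real \<Rightarrow> real"
  assumes "f \<in> borel_measurable borel" "\<And>x. \<bar>f x\<bar> \<le> C * indicator {a..b} x"
  shows "integrable lborel f"
proof (rule integrableI_bounded_set[where A = "{a..b}" and B = C])
  show "AE x in lborel. x \<in> {a..b} \<longrightarrow> norm (f x) \<le> C"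
    using assms(2) by (intro AE_I2) (metis indicator_simps(1) mult.right_neutral real_norm_def)
  show "AE x in lborel. x \<notin> {a..b} \<longrightarrow> f x = 0"
    using assms(2) by (intro AE_I2) (metis abs_le_zero_iff indicator_simps(2) mult_zero_right)
qed (use assms(1) in \<open>auto simp: emeasure_lborel_Icc_eq\<close>)

text \<open>Expanding the square gives the double integral of g(v) g(w) M(v,w) with M(v,w) the
  x-integral of K(x,v) K(x,w), and the integral of M^2 is the box form. Cauchy-Schwarz is used as 2
  a M <= \<tau> a^2 + M^2/\<tau> with a free \<tau>, which avoids square roots; |g| <= 1 turns a^2
  into |a| and so brings in the L^1 norm of g.\<close>

lemma arc_op_L2:
  assumes [measurable]: "F \<in> borel_measurable borel" "g \<in> borel_measurable borel"
    and F2: "\<And>y. \<bar>F y\<bar> \<le> 2" and g1: "\<And>y. \<bar>g y\<bar> \<le> 1" and g: "integrable lborel g" and F: "integrable lborel F"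
    and \<delta>: "0 < \<delta>" and \<tau>: "0 < \<tau>"
  shows "integrable lborel (\<lambda>x. (arc_op F g \<sigma> \<delta> x)\<^sup>2)"
    "(\<integral>x. (arc_op F g \<sigma> \<delta> x)\<^sup>2 \<partial>lborel) \<le> (\<tau> * (\<integral>y. \<bar>g y\<bar> \<partial>lborel)\<^sup>2 + (\<integral>z. box_integrand F \<sigma> \<delta> z \<partial>M4) / \<tau>) / 2"
proof -
  let ?K = "arc_kernel F \<sigma> \<delta>"
  let ?J = "{-1..1::real}"
  note Kb = arc_kernel_le[of F, OF F2 \<delta>, where \<sigma> = \<sigma>]
  have J: "indicator ?J (x - v) = (indicator {x-1..x+1} v :: real)" "indicator ?J (x - v) = (indicator {v-1..v+1} x :: real)" for x v :: real
    by (auto simp: indicator_def)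
  have Kb2: "\<bar>?K x v\<bar> \<le> 2 / \<delta>" for x v
    by (rule order_trans[OF Kb]) (use \<delta> in \<open>simp add: indicator_def\<close>)
  have Kg: "integrable lborel (\<lambda>v. ?K x v * g v)" for x
  proof (rule integrable_bounded_interval[where C = "2 / \<delta>" and a = "x - 1" and b = "x + 1"])
    show "\<bar>?K x v * g v\<bar> \<le> (2 / \<delta>) * indicator {x-1..x+1} v" for v
      using abs_mult_le[OF Kb g1, of x v v] by (simp add: J(1))
  qed measurable
  have KK: "integrable lborel (\<lambda>x. ?K x v * ?K x w)" for v w
  proof (rule integrable_bounded_interval[where C = "(2 / \<delta>) * (2 / \<delta>)" and a = "v - 1" and b = "v + 1"])
    show "\<bar>?K x v * ?K x w\<bar> \<le> (2 / \<delta>) * (2 / \<delta>) * indicator {v-1..v+1} x" for x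
      using abs_mult_le[OF Kb Kb2, of x v x w] by (simp add: J(2) mult_ac)
  qed measurable
  define M where "M p = (\<integral>x. ?K x (fst p) * ?K x (snd p) \<partial>lborel)" for p :: "real \<times> real"
  interpret P: pair_sigma_finite lborel M2 by (rule pair_sigma_finite_lborel)
  interpret R: pair_sigma_finite M2 M2
    using sigma_finite_lborel_pair(1) by (auto intro!: pair_sigma_finite.intro)
  define H where "H x p = ?K x (fst p) * ?K x (snd p) * (g (fst p) * g (snd p))" for x :: real and p :: "real \<times> real"
  have mH[measurable]: "(\<lambda>(x, p). H x p) \<in> borel_measurable (lborel \<Otimes>\<^sub>M M2)" unfolding H_def by measurable
  \<comment> \<open>Exchanging the x-integral with that over (v,w) needs absolute integrability:
    g(v) controls v, and x and w then stay within bounded distance.\<close>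
  have intH: "integrable (lborel \<Otimes>\<^sub>M M2) (\<lambda>(x, p). H x p)"
  proof (rule integrableI_bounded)
    define k where "k = (2 / \<delta>) * (2 / \<delta>)"
    have k0: "0 \<le> k" by (simp add: k_def)
    have Hb: "norm (H x (v, w)) \<le> k * (\<bar>g v\<bar> * indicator ?J (x - v) * indicator ?J (x - w))" for x v w
    proof -
      have "\<bar>H x (v, w)\<bar> \<le> (2 / \<delta>) * indicator ?J (x - v) * ((2 / \<delta>) * indicator ?J (x - w)) * (\<bar>g v\<bar> * 1)"
        unfolding H_def fst_conv snd_conv by (intro abs_mult_le Kb g1 order_refl)
      then show ?thesis by (simp add: k_def mult_ac)
    qed
    have "(\<integral>\<^sup>+z. ennreal (norm (case z of (x, p) \<Rightarrow> H x p)) \<partial>(lborel \<Otimes>\<^sub>M M2))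
       \<le> (\<integral>\<^sup>+z. ennreal k * (ennreal \<bar>g (fst (snd z))\<bar> * indicator ?J (fst z - fst (snd z)) * indicator ?J (fst z - snd (snd z))) \<partial>(lborel \<Otimes>\<^sub>M M2))"
    proof (rule nn_integral_mono)
      fix z :: "real \<times> real \<times> real"
      obtain x v w where z: "z = (x, v, w)" by (cases z) auto
      show "ennreal (norm (case z of (x, p) \<Rightarrow> H x p)) \<le> ennreal k * (ennreal \<bar>g (fst (snd z))\<bar> * indicator ?J (fst z - fst (snd z)) * indicator ?J (fst z - snd (snd z)))"
        using ennreal_leI[OF Hb[of x v w]] k0 by (simp add: z ennreal_mult ennreal_indicator)
    qed
    also have "\<dots> = (\<integral>\<^sup>+x. \<integral>\<^sup>+p. ennreal k * (ennreal \<bar>g (fst p)\<bar> * indicator ?J (x - fst p) * indicator ?J (x - snd p)) \<partial>M2 \<partial>lborel)"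
      by (subst sigma_finite_measure.nn_integral_fst[OF sigma_finite_lborel_pair(1), symmetric]) simp_all
    also have "\<dots> = (\<integral>\<^sup>+x. \<integral>\<^sup>+v. \<integral>\<^sup>+w. ennreal k * (ennreal \<bar>g v\<bar> * indicator ?J (x - v) * indicator ?J (x - w)) \<partial>lborel \<partial>lborel \<partial>lborel)"
      by (intro nn_integral_cong) (subst lborel.nn_integral_fst[symmetric]; simp)
    also have "\<dots> = (\<integral>\<^sup>+x. \<integral>\<^sup>+v. ennreal k * (ennreal \<bar>g v\<bar> * indicator ?J (x - v) * 2) \<partial>lborel \<partial>lborel)"
      by (simp add: nn_integral_cmult nn_integral_reflect_translate(2)[of "indicator ?J"])
    also have "\<dots> = (\<integral>\<^sup>+v. \<integral>\<^sup>+x. ennreal k * (ennreal \<bar>g v\<bar> * indicator ?J (x - v) * 2) \<partial>lborel \<partial>lborel)"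
      by (rule lborel_pair.Fubini') simp
    also have "\<dots> = (\<integral>\<^sup>+v. ennreal k * (ennreal \<bar>g v\<bar> * 2 * 2) \<partial>lborel)"
      by (simp add: nn_integral_cmult nn_integral_multc nn_integral_reflect_translate(1)[of "indicator ?J"])
    also have "\<dots> = ennreal k * ((\<integral>\<^sup>+v. ennreal \<bar>g v\<bar> \<partial>lborel) * 2 * 2)"
      by (simp add: nn_integral_cmult nn_integral_multc)
    also have "\<dots> < \<infinity>" using g by (simp add: integrable_iff_bounded ennreal_mult_less_top)
    finally show "(\<integral>\<^sup>+z. ennreal (norm (case z of (x, p) \<Rightarrow> H x p)) \<partial>(lborel \<Otimes>\<^sub>M M2)) < \<infinity>" .
  qed measurable
  have HB: "(\<integral>p. H x p \<partial>M2) = (arc_op F g \<sigma> \<delta> x)\<^sup>2" for x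
    using integral_product_pair(2)[OF Kg Kg, of x x]
    by (simp add: H_def arc_op_def power2_eq_square case_prod_unfold mult_ac)
  have HM: "(\<integral>x. H x p \<partial>lborel) = g (fst p) * g (snd p) * M p" for p
    by (simp add: H_def M_def mult.commute)
  show "integrable lborel (\<lambda>x. (arc_op F g \<sigma> \<delta> x)\<^sup>2)"
    using P.integrable_fst[OF intH] by (simp add: HB)
  have intgM: "integrable M2 (\<lambda>p. g (fst p) * g (snd p) * M p)"
    using P.integrable_snd[OF intH] by (simp add: HM)
  have eq1: "(\<integral>x. (arc_op F g \<sigma> \<delta> x)\<^sup>2 \<partial>lborel) = (\<integral>p. g (fst p) * g (snd p) * M p \<partial>M2)"
    using P.Fubini_integral[OF intH] by (simp add: HB HM)
  have intQ: "integrable M4 (box_integrand F \<sigma> \<delta>)"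
  proof (rule corner_bound(1)[where g = "\<lambda>y. \<bar>F y\<bar>" and e = cube and K = "8 / \<delta>^4" and I = "\<integral>y. \<bar>F y\<bar> \<partial>lborel" and S = 8 and \<sigma> = \<sigma>])
    show "(\<integral>\<^sup>+y. ennreal \<bar>F y\<bar> \<partial>lborel) \<le> ennreal (\<integral>y. \<bar>F y\<bar> \<partial>lborel)"
      using F by (subst nn_integral_eq_integral) auto
    show "(\<integral>\<^sup>+c. \<integral>\<^sup>+b. \<integral>\<^sup>+a. ennreal (cube a b c) \<partial>lborel \<partial>lborel \<partial>lborel) \<le> ennreal 8" by (rule nn_integral_cube)
    show "\<bar>box_integrand F \<sigma> \<delta> (v, w, x, y)\<bar> \<le> (8 / \<delta>^4) * (\<bar>F (y - \<sigma> * circ (y - w))\<bar> * cube (x-v) (y-v) (y-w))" for v w x y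
      by (rule box_integrand_le[OF F2 \<delta>])
  qed (use \<delta> cube_cases(1) in auto)
  have QM: "(\<integral>q. box_integrand F \<sigma> \<delta> (fst p, snd p, q) \<partial>M2) = (M p)\<^sup>2" for p
    using integral_product_pair(2)[OF KK KK, of "fst p" "snd p" "fst p" "snd p"]
    by (simp add: box_integrand_def M_def power2_eq_square case_prod_unfold)
  have intM2: "integrable M2 (\<lambda>p. (M p)\<^sup>2)" and eqM: "(\<integral>p. (M p)\<^sup>2 \<partial>M2) = (\<integral>z. box_integrand F \<sigma> \<delta> z \<partial>M4)"
    using R.integrable_fst'[OF integral_M4_assoc(1)[OF intQ]] R.integral_fst'[OF integral_M4_assoc(1)[OF intQ]] integral_M4_assoc(2)[OF intQ]
    by (simp_all add: QM)
  have ag: "integrable lborel (\<lambda>y. \<bar>g y\<bar>)" using g by simp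
  have intgg: "integrable M2 (\<lambda>p. \<bar>g (fst p)\<bar> * \<bar>g (snd p)\<bar>)" and eqg: "(\<integral>p. \<bar>g (fst p)\<bar> * \<bar>g (snd p)\<bar> \<partial>M2) = (\<integral>y. \<bar>g y\<bar> \<partial>lborel)\<^sup>2"
    using integral_product_pair[OF ag ag] by (simp_all add: case_prod_unfold power2_eq_square)
  have "(\<integral>p. g (fst p) * g (snd p) * M p \<partial>M2) \<le> (\<integral>p. (\<tau> * (\<bar>g (fst p)\<bar> * \<bar>g (snd p)\<bar>) + (M p)\<^sup>2 / \<tau>) / 2 \<partial>M2)"
  proof (rule integral_mono[OF intgM])
    show "integrable M2 (\<lambda>p. (\<tau> * (\<bar>g (fst p)\<bar> * \<bar>g (snd p)\<bar>) + (M p)\<^sup>2 / \<tau>) / 2)"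
      using intgg intM2 by simp
    fix p :: "real \<times> real"
    define a where "a = g (fst p) * g (snd p)"
    have a1: "\<bar>a\<bar> \<le> 1" unfolding a_def using abs_mult_le[OF g1 g1] by simp
    then have aa: "a\<^sup>2 \<le> \<bar>a\<bar>" using mult_left_le[of "\<bar>a\<bar>" "\<bar>a\<bar>"] by (simp add: power2_eq_square)
    have "0 \<le> (\<tau> * a - M p)\<^sup>2" by simp
    then have "2 * (\<tau> * (a * M p)) \<le> \<tau>\<^sup>2 * a\<^sup>2 + (M p)\<^sup>2" by (simp add: power2_diff power_mult_distrib algebra_simps)
    also have "\<dots> \<le> \<tau>\<^sup>2 * \<bar>a\<bar> + (M p)\<^sup>2" using aa by (simp add: mult_left_mono)
    finally have "a * M p \<le> (\<tau>\<^sup>2 * \<bar>a\<bar> + (M p)\<^sup>2) / (2 * \<tau>)" using \<tau> by (simp add: field_simps)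
    also have "\<dots> = (\<tau> * \<bar>a\<bar> + (M p)\<^sup>2 / \<tau>) / 2" using \<tau> by (simp add: field_simps power2_eq_square)
    finally show "g (fst p) * g (snd p) * M p \<le> (\<tau> * (\<bar>g (fst p)\<bar> * \<bar>g (snd p)\<bar>) + (M p)\<^sup>2 / \<tau>) / 2"
      by (simp add: a_def abs_mult)
  qed
  also have "\<dots> = (\<tau> * (\<integral>y. \<bar>g y\<bar> \<partial>lborel)\<^sup>2 + (\<integral>z. box_integrand F \<sigma> \<delta> z \<partial>M4) / \<tau>) / 2"
    using intgg intM2 by (simp add: eqg eqM)
  finally show "(\<integral>x. (arc_op F g \<sigma> \<delta> x)\<^sup>2 \<partial>lborel) \<le> (\<tau> * (\<integral>y. \<bar>g y\<bar> \<partial>lborel)\<^sup>2 + (\<integral>z. box_integrand F \<sigma> \<delta> z \<partial>M4) / \<tau>) / 2"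
    by (simp add: eq1)
qed

section \<open>Splitting the circle into arcs\<close>

lemma sin_ge_quarter:
  assumes "0 \<le> y" "y \<le> pi / 2" shows "y / 4 \<le> sin y"
proof (cases "y \<le> pi / 6")
  case True
  have "sin 0 - 0 / 4 \<le> sin y - y / 4"
  proof (rule DERIV_nonneg_imp_nondecreasing[OF assms(1)])
    fix x assume x: "0 \<le> x" "x \<le> y"
    have "cos (pi / 3) \<le> cos x" using x True by (intro cos_monotone_0_pi_le) auto
    then have "0 \<le> cos x - 1 / 4" by (simp add: cos_60)
    moreover have "((\<lambda>x. sin x - x / 4) has_real_derivative cos x - 1 / 4) (at x)"
      by (auto intro!: derivative_eq_intros)
    ultimately show "\<exists>d. ((\<lambda>x. sin x - x / 4) has_real_derivative d) (at x) \<and> 0 \<le> d" by blast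
  qed
  then show ?thesis by simp
next
  case False
  then have "sin (pi / 6) \<le> sin y" using assms by (intro sin_monotone_2pi_le) auto
  then show ?thesis using assms pi_less_4 by (simp add: sin_30)
qed

text \<open>In each quadrant |cos t| is the sine of the distance from t to the nearest zero of the
  cosine, and on [0, \<pi>/2] the sine is at least a quarter of its argument.\<close>

lemma abs_cos_small:
  assumes t: "t \<in> {0..2 * pi}" and c: "\<bar>cos t\<bar> < r"
  shows "t \<in> {pi/2 - 4 * r .. pi/2 + 4 * r} \<union> {3*pi/2 - 4 * r .. 3*pi/2 + 4 * r}"
proof -
  have key: "y \<le> 4 * r" if "0 \<le> y" "y \<le> pi / 2" "\<bar>sin y\<bar> = \<bar>cos t\<bar>" for y
    using sin_ge_quarter[OF that(1,2)] c that(3) by linarith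
  have s: "sin (3 * pi / 2 - t) = - cos t" "sin (t - 3 * pi / 2) = cos t" "sin (t - pi / 2) = - cos t" "sin (pi / 2 - t) = cos t"
    using sin_3over2_pi cos_3over2_pi by (simp_all add: sin_diff)
  consider "t \<le> pi / 2" | "pi / 2 \<le> t" "t \<le> pi" | "pi \<le> t" "t \<le> 3 * pi / 2" | "3 * pi / 2 \<le> t" by linarith
  then show ?thesis
  proof cases
    case 1
    then have "pi / 2 - t \<le> 4 * r" using t by (intro key) (simp_all add: s)
    then show ?thesis using 1 c by auto
  next
    case 2
    then have "t - pi / 2 \<le> 4 * r" using t by (intro key) (simp_all add: s)
    then show ?thesis using 2 c by auto
  next
    case 3
    then have "3 * pi / 2 - t \<le> 4 * r" using t by (intro key) (simp_all add: s)
    then show ?thesis using 3 c by auto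
  next
    case 4
    then have "t - 3 * pi / 2 \<le> 4 * r" using t by (intro key) (simp_all add: s)
    then show ?thesis using 4 c by auto
  qed
qed

text \<open>The share of arc length that the smoothed weight keeps: with s = sin t on the right half
  circle, w(s) ds equals \<open>rho \<delta> t\<close> dt.\<close>

definition rho :: "real \<Rightarrow> real \<Rightarrow> real" where "rho \<delta> t = ((cos t)\<^sup>2 / ((cos t)\<^sup>2 + \<delta>))\<^sup>2"

lemma borel_rho [measurable]: "rho \<delta> \<in> borel_measurable borel"
  unfolding rho_def by measurable

lemma rho_bounds:
  assumes "0 < \<delta>"
  shows "0 \<le> rho \<delta> t" "rho \<delta> t \<le> 1" "1 - rho \<delta> t \<le> 2 * (\<delta> / ((cos t)\<^sup>2 + \<delta>))"
proof -
  define u where "u = (cos t)\<^sup>2 / ((cos t)\<^sup>2 + \<delta>)"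
  have p: "0 < (cos t)\<^sup>2 + \<delta>" using assms by (simp add: add_nonneg_pos)
  then have u: "0 \<le> u" "u \<le> 1" "1 - u = \<delta> / ((cos t)\<^sup>2 + \<delta>)" using assms by (simp_all add: u_def field_simps)
  show "0 \<le> rho \<delta> t" "rho \<delta> t \<le> 1" using u by (simp_all add: rho_def power_le_one flip: u_def)
  have "0 \<le> (1 - u)\<^sup>2" by simp
  then have "1 - u\<^sup>2 \<le> 2 * (1 - u)" by (simp add: power2_diff algebra_simps)
  then show "1 - rho \<delta> t \<le> 2 * (\<delta> / ((cos t)\<^sup>2 + \<delta>))" using u by (simp add: rho_def flip: u_def)
qed

text \<open>Where |cos t| < r, two intervals of total length 16 r are lost entirely. Elsewhere the
  loss is at most 2 r^4/r^2, which over the circle gives 4 \<pi> r^2 <= 16 r. The choice \<delta> =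
  r^4 makes both contributions O(r).\<close>

lemma nn_integral_rho:
  assumes r: "0 < r" "r \<le> 1"
  shows "(\<integral>\<^sup>+t. ennreal (indicator {0..2*pi} t * (1 - rho (r^4) t)) \<partial>lborel) \<le> ennreal (32 * r)"
proof -
  let ?A = "{pi/2 - 4 * r .. pi/2 + 4 * r}" and ?B = "{3*pi/2 - 4 * r .. 3*pi/2 + 4 * r}"
  have \<delta>: "0 < r^4" using r by simp
  have "ennreal (indicator {0..2*pi} t * (1 - rho (r^4) t)) \<le> ennreal (2 * r\<^sup>2) * indicator {0..2*pi} t + indicator ?A t + indicator ?B t" for t
  proof (cases "t \<in> {0..2*pi}")
    case True
    show ?thesis
    proof (cases "\<bar>cos t\<bar> < r")
      case small: True
      have "1 - rho (r^4) t \<le> 1" using rho_bounds(1)[OF \<delta>] by simp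
      moreover have "t \<in> ?A \<or> t \<in> ?B" using abs_cos_small[OF True small] by auto
      ultimately show ?thesis using True by (auto simp: ennreal_le_1 add_increasing add_increasing2 simp del: atLeastAtMost_iff)
    next
      case False
      then have "r\<^sup>2 \<le> (cos t)\<^sup>2" using r by (metis abs_le_square_iff abs_of_pos linorder_not_less)
      then have "r^4 / ((cos t)\<^sup>2 + r^4) \<le> r^4 / r\<^sup>2" using r by (intro divide_left_mono) (auto intro!: mult_pos_pos add_increasing2 add_nonneg_pos)
      also have "r^4 / r\<^sup>2 = r\<^sup>2" using r by (simp add: field_simps flip: power_add)
      finally have "1 - rho (r^4) t \<le> 2 * r\<^sup>2" using rho_bounds(3)[OF \<delta>, of t] by linarith
      then show ?thesis using True by (simp add: add_increasing2 ennreal_leI)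
    qed
  qed simp
  then have "(\<integral>\<^sup>+t. ennreal (indicator {0..2*pi} t * (1 - rho (r^4) t)) \<partial>lborel)
    \<le> (\<integral>\<^sup>+t. ennreal (2 * r\<^sup>2) * indicator {0..2*pi} t + indicator ?A t + indicator ?B t \<partial>lborel)"
    by (intro nn_integral_mono)
  also have "\<dots> = ennreal (2 * r\<^sup>2) * ennreal (2 * pi) + ennreal (8 * r) + ennreal (8 * r)"
    using r by (simp add: nn_integral_add nn_integral_cmult)
  also have "\<dots> = ennreal (4 * pi * r\<^sup>2 + 16 * r)"
    using r by (simp add: ennreal_mult'[symmetric] ennreal_plus[symmetric] mult_ac del: ennreal_plus)
  also have "\<dots> \<le> ennreal (32 * r)"
  proof (rule ennreal_leI)
    have "4 * pi * r\<^sup>2 \<le> 4 * 4 * r" using r pi_less_4 by (intro mult_mono) (auto simp: power2_eq_square mult_left_le)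
    then show "4 * pi * r\<^sup>2 + 16 * r \<le> 32 * r" by simp
  qed
  finally show ?thesis .
qed

text \<open>Periodicity moves the last quarter in front of the first, which gives the half circle
  with nonnegative cosine. The reflection t to \<pi> - t maps the other half onto it, keeping the
  sine and reversing the cosine. End points are null sets.\<close>

lemma integral_circle:
  fixes k :: "real \<Rightarrow> real"
  assumes [measurable]: "k \<in> borel_measurable borel" and b: "\<And>t. \<bar>k t\<bar> \<le> C" and per: "\<And>t. k (t + 2 * pi) = k t"
  shows "(LINT t:{0..2*pi}|lborel. k t) = (\<integral>t. indicator {-pi/2..pi/2} t * k t \<partial>lborel) + (\<integral>t. indicator {-pi/2..pi/2} t * k (pi - t) \<partial>lborel)"
proof -
  have C0: "0 \<le> C" using b[of 0] by linarith
  have int: "integrable lborel (\<lambda>t. indicator A t * q t)" if [measurable]: "A \<in> sets borel" "q \<in> borel_measurable borel" and "A \<subseteq> {u..v}" "\<And>t. \<bar>q t\<bar> \<le> C" for A q and u v :: real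
    by (rule integrable_bounded_interval[where C = C and a = u and b = v]) (use that C0 in \<open>auto simp: abs_mult indicator_def\<close>)
  have "(LINT t:{0..2*pi}|lborel. k t) = (\<integral>t. indicator {0..<pi/2} t * k t + indicator {pi/2..3*pi/2} t * k t + indicator {3*pi/2<..2*pi} t * k t \<partial>lborel)"
    unfolding set_lebesgue_integral_def
    by (rule Bochner_Integration.integral_cong) (auto simp: indicator_def)
  also have "\<dots> = (\<integral>t. indicator {0..<pi/2} t * k t \<partial>lborel) + (\<integral>t. indicator {pi/2..3*pi/2} t * k t \<partial>lborel) + (\<integral>t. indicator {3*pi/2<..2*pi} t * k t \<partial>lborel)"
    using b by (subst Bochner_Integration.integral_add Bochner_Integration.integrable_add; (intro Bochner_Integration.integrable_add int[where u = 0 and v = "2*pi"])?; simp?; force?)+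
  also have "(\<integral>t. indicator {pi/2..3*pi/2} t * k t \<partial>lborel) = (\<integral>t. indicator {-pi/2..pi/2} t * k (pi - t) \<partial>lborel)"
    by (subst lborel_integral_real_affine[where c = "-1" and t = pi]) (auto intro!: Bochner_Integration.integral_cong simp: indicator_def)
  also have "(\<integral>t. indicator {3*pi/2<..2*pi} t * k t \<partial>lborel) = (\<integral>t. indicator {-pi/2<..0} t * k t \<partial>lborel)"
    using per by (subst lborel_integral_real_affine[where c = 1 and t = "2*pi"]) (auto intro!: Bochner_Integration.integral_cong simp: indicator_def add.commute)
  also have "(\<integral>t. indicator {-pi/2<..0} t * k t \<partial>lborel) = (\<integral>t. indicator {-pi/2..<0} t * k t \<partial>lborel)"
  proof (rule integral_cong_AE)
    show "AE t in lborel. indicator {-pi/2<..0} t * k t = indicator {-pi/2..<0} t * k t"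
      using AE_lborel_singleton[of "0::real"] AE_lborel_singleton[of "-pi/2"] by eventually_elim (auto simp: indicator_def)
  qed measurable
  finally have 1: "(LINT t:{0..2*pi}|lborel. k t) = (\<integral>t. indicator {0..<pi/2} t * k t \<partial>lborel) + (\<integral>t. indicator {-pi/2..<0} t * k t \<partial>lborel) + (\<integral>t. indicator {-pi/2..pi/2} t * k (pi - t) \<partial>lborel)"
    by simp
  have "(\<integral>t. indicator {0..<pi/2} t * k t \<partial>lborel) + (\<integral>t. indicator {-pi/2..<0} t * k t \<partial>lborel)
    = (\<integral>t. indicator {0..<pi/2} t * k t + indicator {-pi/2..<0} t * k t \<partial>lborel)"
    using b by (intro Bochner_Integration.integral_add[symmetric] int[where u = "-pi" and v = pi]) auto
  also have "\<dots> = (\<integral>t. indicator {-pi/2..pi/2} t * k t \<partial>lborel)"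
  proof (rule integral_cong_AE)
    show "AE t in lborel. indicator {0..<pi/2} t * k t + indicator {-pi/2..<0} t * k t = indicator {-pi/2..pi/2} t * k t"
      using AE_lborel_singleton[of "pi/2"] by eventually_elim (auto simp: indicator_def)
  qed measurable
  finally show ?thesis using 1 by simp
qed

lemma circ_sin: "t \<in> {-pi/2..pi/2} \<Longrightarrow> circ (sin t) = cos t"
  by (simp add: circ_eq_sqrt cos_squared_eq[symmetric] cos_ge_zero)

text \<open>The substitution s = sin t is monotone on the half circle and turns dt into ds/c(s); the
  factor rho then changes 1/c into the smoothed weight.\<close>

lemma arc_op_arc:
  assumes [measurable]: "F \<in> borel_measurable borel" "g \<in> borel_measurable borel"
    and F2: "\<And>y. \<bar>F y\<bar> \<le> 2" and g1: "\<And>y. \<bar>g y\<bar> \<le> 1" and \<delta>: "0 < \<delta>"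
  shows "(\<integral>t. indicator {-pi/2..pi/2} t * (rho \<delta> t * (F (x - \<sigma> * cos t) * g (x - sin t))) \<partial>lborel) = arc_op F g \<sigma> \<delta> x"
proof -
  define f where "f s = F (x - \<sigma> * circ s) * wt \<delta> s * g (x - s)" for s
  have [measurable]: "f \<in> borel_measurable borel" unfolding f_def by measurable
  have fb: "\<bar>f s\<bar> \<le> (2 / \<delta>) * indicator {-1..1} s" for s
  proof (cases "\<bar>s\<bar> \<le> 1")
    case True
    have "\<bar>f s\<bar> \<le> 2 * (1 / \<delta>) * 1" unfolding f_def using wt_le[OF \<delta>, of s] by (intro abs_mult_le F2 g1) simp
    then show ?thesis using True by (simp add: abs_le_iff)
  qed (use \<delta> in \<open>simp add: f_def wt_eq_0\<close>)
  have "set_integrable lborel {-1..1} f"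
    unfolding set_integrable_def
  proof (rule integrable_bounded_interval[where C = "2 / \<delta>" and a = "-1" and b = 1])
    show "\<bar>indicator {-1..1} s *\<^sub>R f s\<bar> \<le> (2 / \<delta>) * indicator {-1..1} s" for s
      using fb[of s] by (cases "s \<in> {-1..1}") (simp_all del: atLeastAtMost_iff)
  qed measurable
  then have sub: "(LBINT s. f s * indicator {sin (-pi/2)..sin (pi/2)} s) = (LBINT t. f (sin t) * cos t * indicator {-pi/2..pi/2} t)"
    by (intro integral_substitution) (auto intro!: continuous_intros DERIV_sin cos_ge_zero)
  have "arc_op F g \<sigma> \<delta> x = (\<integral>s. f s \<partial>lborel)"
    unfolding arc_op_def arc_kernel_def f_def
    by (subst lborel_integral_real_affine[where c = "-1" and t = x]) simp_all
  also have "\<dots> = (LBINT s. f s * indicator {sin (-pi/2)..sin (pi/2)} s)"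
  proof (rule Bochner_Integration.integral_cong)
    show "f s = f s * indicator {sin (-pi/2)..sin (pi/2)} s" for s
      by (cases "\<bar>s\<bar> \<le> 1") (auto simp: f_def wt_eq_0 indicator_def)
  qed simp
  also note sub
  also have "(LBINT t. f (sin t) * cos t * indicator {-pi/2..pi/2} t) = (\<integral>t. indicator {-pi/2..pi/2} t * (rho \<delta> t * (F (x - \<sigma> * cos t) * g (x - sin t))) \<partial>lborel)"
  proof (rule Bochner_Integration.integral_cong)
    fix t :: real
    have "wt \<delta> (sin t) * cos t = rho \<delta> t" if "t \<in> {-pi/2..pi/2}"
      using circ_sin[OF that] by (simp add: wt_def rho_def power_divide) (simp add: eval_nat_numeral)
    then show "f (sin t) * cos t * indicator {-pi/2..pi/2} t = indicator {-pi/2..pi/2} t * (rho \<delta> t * (F (x - \<sigma> * cos t) * g (x - sin t)))"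
      using circ_sin[of t] by (auto simp: f_def indicator_def mult_ac simp del: atLeastAtMost_iff)
  qed simp
  finally show ?thesis ..
qed

definition rem_op :: "(real \<Rightarrow> real) \<Rightarrow> (real \<Rightarrow> real) \<Rightarrow> real \<Rightarrow> real \<Rightarrow> real" where
  "rem_op F g \<delta> x = (LINT t:{0..2*pi}|lborel. (1 - rho \<delta> t) * (F (x - cos t) * g (x - sin t)))"

lemma set_integrable_bounded:
  fixes f :: "real \<Rightarrow> real"
  assumes [measurable]: "f \<in> borel_measurable borel" and "\<And>t. \<bar>f t\<bar> \<le> C"
  shows "set_integrable lborel {a..b} f"
proof -
  have "0 \<le> C" using assms(2)[of 0] by linarith
  then show ?thesis unfolding set_integrable_def
    by (intro integrable_bounded_interval[where C = C and a = a and b = b]) (use assms(2) in \<open>auto simp: indicator_def\<close>)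
qed

lemma A1_decomposition:
  assumes [measurable]: "F \<in> borel_measurable borel" "g \<in> borel_measurable borel"
    and F2: "\<And>y. \<bar>F y\<bar> \<le> 2" and g1: "\<And>y. \<bar>g y\<bar> \<le> 1" and \<delta>: "0 < \<delta>"
  shows "A1 F g x = arc_op F g 1 \<delta> x + arc_op F g (-1) \<delta> x + rem_op F g \<delta> x"
proof -
  define k where "k t = rho \<delta> t * (F (x - cos t) * g (x - sin t))" for t
  have [measurable]: "k \<in> borel_measurable borel" unfolding k_def by measurable
  have r: "\<bar>rho \<delta> t\<bar> \<le> 1" "\<bar>1 - rho \<delta> t\<bar> \<le> 1" for t using rho_bounds(1,2)[OF \<delta>, of t] by auto
  have kb: "\<bar>k t\<bar> \<le> 1 * (2 * 1)" for t unfolding k_def by (intro abs_mult_le r F2 g1)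
  have rb: "\<bar>(1 - rho \<delta> t) * (F (x - cos t) * g (x - sin t))\<bar> \<le> 1 * (2 * 1)" for t by (intro abs_mult_le r F2 g1)
  have "(LINT t:{0..2*pi}|lborel. k t) = arc_op F g 1 \<delta> x + arc_op F g (-1) \<delta> x"
  proof (subst integral_circle[where C = "1 * (2 * 1)"])
    \<comment> \<open>rho depends on cos^2 alone, so the reflected half circle carries the same
      weight and only the sign \<sigma> in front of the cosine changes.\<close>
    have "rho \<delta> (pi - t) = rho \<delta> t" for t by (simp add: rho_def)
    then show "(\<integral>t. indicator {-pi/2..pi/2} t * k t \<partial>lborel) + (\<integral>t. indicator {-pi/2..pi/2} t * k (pi - t) \<partial>lborel) = arc_op F g 1 \<delta> x + arc_op F g (-1) \<delta> x"
      using arc_op_arc[where \<sigma> = 1 and F = F and g = g and x = x, OF _ _ F2 g1 \<delta>] arc_op_arc[where \<sigma> = "-1" and F = F and g = g and x = x, OF _ _ F2 g1 \<delta>] by (simp add: k_def)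
    show "k (t + 2 * pi) = k t" for t by (simp add: k_def rho_def)
  qed (use kb in auto)
  moreover have "A1 F g x = (LINT t:{0..2*pi}|lborel. k t + (1 - rho \<delta> t) * (F (x - cos t) * g (x - sin t)))"
    unfolding A1_def k_def by (simp add: algebra_simps)
  moreover have "\<dots> = (LINT t:{0..2*pi}|lborel. k t) + rem_op F g \<delta> x"
    unfolding rem_op_def by (rule set_integral_add; rule set_integrable_bounded) (use kb rb in auto)
  ultimately show ?thesis by simp
qed

text \<open>Both bounds are linear in the mass w of the weight, the second by Tonelli and
  translation invariance. The weight 1 - rho has mass of order r and gives the discarded part; the
  weight 1 gives the trivial bounds for A_1.\<close>

lemma weighted_circle_bound:
  fixes m F g :: "real \<Rightarrow> real"
  assumes [measurable]: "m \<in> borel_measurable borel" "F \<in> borel_measurable borel" "g \<in> borel_measurable borel"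
    and m: "\<And>t. 0 \<le> m t" "\<And>t. m t \<le> 1"
    and F2: "\<And>y. \<bar>F y\<bar> \<le> 2" and g1: "\<And>y. \<bar>g y\<bar> \<le> 1" and g: "integrable lborel g"
    and w: "(\<integral>\<^sup>+t. ennreal (indicator {0..2*pi} t * m t) \<partial>lborel) \<le> ennreal w" "0 \<le> w"
  defines "T \<equiv> \<lambda>x. (LINT t:{0..2*pi}|lborel. m t * (F (x - cos t) * g (x - sin t)))"
  shows "\<bar>T x\<bar> \<le> 2 * w" "(\<integral>\<^sup>+x. ennreal \<bar>T x\<bar> \<partial>lborel) \<le> ennreal (2 * w * (\<integral>y. \<bar>g y\<bar> \<partial>lborel))"
proof -
  have int: "integrable lborel (\<lambda>t. indicator {0..2*pi} t *\<^sub>R (m t * (F (x - cos t) * g (x - sin t))))" for x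
  proof -
    have "\<bar>m t * (F (x - cos t) * g (x - sin t))\<bar> \<le> 1 * (2 * 1)" for t
      using m[of t] by (intro abs_mult_le F2 g1) simp
    from set_integrable_bounded[OF _ this, where a = 0 and b = "2 * pi"] show ?thesis unfolding set_integrable_def by simp
  qed
  have T: "ennreal \<bar>T x\<bar> \<le> (\<integral>\<^sup>+t. ennreal (indicator {0..2*pi} t * m t) * (2 * ennreal \<bar>g (x - sin t)\<bar>) \<partial>lborel)" for x
  proof -
    have "ennreal \<bar>T x\<bar> \<le> (\<integral>\<^sup>+t. ennreal (norm (indicator {0..2*pi} t *\<^sub>R (m t * (F (x - cos t) * g (x - sin t))))) \<partial>lborel)"
      unfolding T_def set_lebesgue_integral_def using integral_norm_bound_ennreal[OF int] by simp
    also have "\<dots> \<le> (\<integral>\<^sup>+t. ennreal (indicator {0..2*pi} t * m t) * (2 * ennreal \<bar>g (x - sin t)\<bar>) \<partial>lborel)"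
    proof (rule nn_integral_mono)
      fix t :: real
      have "norm (indicator {0..2*pi} t *\<^sub>R (m t * (F (x - cos t) * g (x - sin t)))) = indicator {0..2*pi} t * m t * (\<bar>F (x - cos t)\<bar> * \<bar>g (x - sin t)\<bar>)"
        using m(1)[of t] by (simp add: abs_mult)
      also have "\<dots> \<le> indicator {0..2*pi} t * m t * (2 * \<bar>g (x - sin t)\<bar>)"
        using m(1)[of t] F2 by (intro mult_left_mono mult_right_mono) auto
      finally have "ennreal (norm (indicator {0..2*pi} t *\<^sub>R (m t * (F (x - cos t) * g (x - sin t))))) \<le> ennreal (indicator {0..2*pi} t * m t * (2 * \<bar>g (x - sin t)\<bar>))"
        by (rule ennreal_leI)
      also have "\<dots> = ennreal (indicator {0..2*pi} t * m t) * (2 * ennreal \<bar>g (x - sin t)\<bar>)"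
        using m(1)[of t] by (simp add: ennreal_mult ennreal_mult')
      finally show "ennreal (norm (indicator {0..2*pi} t *\<^sub>R (m t * (F (x - cos t) * g (x - sin t))))) \<le> \<dots>" .
    qed
    finally show ?thesis .
  qed
  have "ennreal \<bar>T x\<bar> \<le> (\<integral>\<^sup>+t. ennreal (indicator {0..2*pi} t * m t) * (2 * 1) \<partial>lborel)"
    using g1 by (intro order_trans[OF T] nn_integral_mono mult_left_mono) auto
  also have "\<dots> = 2 * (\<integral>\<^sup>+t. ennreal (indicator {0..2*pi} t * m t) \<partial>lborel)"
    by (subst nn_integral_multc) (simp_all add: mult.commute)
  also have "\<dots> \<le> 2 * ennreal w" by (intro mult_left_mono w) simp
  also have "\<dots> = ennreal (2 * w)" using w by (simp add: ennreal_mult')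
  finally show "\<bar>T x\<bar> \<le> 2 * w" using w by simp
  have "(\<integral>\<^sup>+x. ennreal \<bar>T x\<bar> \<partial>lborel) \<le> (\<integral>\<^sup>+x. \<integral>\<^sup>+t. ennreal (indicator {0..2*pi} t * m t) * (2 * ennreal \<bar>g (x - sin t)\<bar>) \<partial>lborel \<partial>lborel)"
    by (intro nn_integral_mono T)
  also have "\<dots> = (\<integral>\<^sup>+t. \<integral>\<^sup>+x. ennreal (indicator {0..2*pi} t * m t) * (2 * ennreal \<bar>g (x - sin t)\<bar>) \<partial>lborel \<partial>lborel)"
    by (rule lborel_pair.Fubini') simp
  also have "\<dots> = (\<integral>\<^sup>+t. ennreal (indicator {0..2*pi} t * m t) * (2 * (\<integral>\<^sup>+x. ennreal \<bar>g x\<bar> \<partial>lborel)) \<partial>lborel)"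
    by (simp add: nn_integral_cmult nn_integral_reflect_translate(1)[of "\<lambda>x. ennreal \<bar>g x\<bar>"])
  also have "\<dots> = (\<integral>\<^sup>+t. ennreal (indicator {0..2*pi} t * m t) \<partial>lborel) * (2 * (\<integral>\<^sup>+x. ennreal \<bar>g x\<bar> \<partial>lborel))"
    by (simp add: nn_integral_multc)
  also have "(\<integral>\<^sup>+x. ennreal \<bar>g x\<bar> \<partial>lborel) = ennreal (\<integral>y. \<bar>g y\<bar> \<partial>lborel)"
    using g by (intro nn_integral_eq_integral) auto
  also have "(\<integral>\<^sup>+t. ennreal (indicator {0..2*pi} t * m t) \<partial>lborel) * (2 * ennreal (\<integral>y. \<bar>g y\<bar> \<partial>lborel)) \<le> ennreal w * (2 * ennreal (\<integral>y. \<bar>g y\<bar> \<partial>lborel))"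
    by (intro mult_right_mono w) simp
  also have "\<dots> = ennreal (2 * w * (\<integral>y. \<bar>g y\<bar> \<partial>lborel))"
    using w by (simp add: ennreal_mult'[symmetric] mult_ac flip: ennreal_numeral)
  finally show "(\<integral>\<^sup>+x. ennreal \<bar>T x\<bar> \<partial>lborel) \<le> ennreal (2 * w * (\<integral>y. \<bar>g y\<bar> \<partial>lborel))" .
qed

lemma borel_A1 [measurable]:
  assumes [measurable]: "F \<in> borel_measurable borel" "g \<in> borel_measurable borel"
  shows "A1 F g \<in> borel_measurable borel"
  unfolding A1_def set_lebesgue_integral_def by measurable

lemma borel_rem_op [measurable]:
  assumes [measurable]: "F \<in> borel_measurable borel" "g \<in> borel_measurable borel"
  shows "rem_op F g \<delta> \<in> borel_measurable borel"
  unfolding rem_op_def set_lebesgue_integral_def by measurable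

lemma borel_arc_op [measurable]:
  assumes [measurable]: "F \<in> borel_measurable borel" "g \<in> borel_measurable borel"
  shows "arc_op F g \<sigma> \<delta> \<in> borel_measurable borel"
  unfolding arc_op_def by measurable

lemma A1_trivial:
  assumes [measurable]: "F \<in> borel_measurable borel" "g \<in> borel_measurable borel"
    and F2: "\<And>y. \<bar>F y\<bar> \<le> 2" and g1: "\<And>y. \<bar>g y\<bar> \<le> 1" and g: "integrable lborel g"
  shows "\<bar>A1 F g x\<bar> \<le> 16" "(\<integral>\<^sup>+x. ennreal \<bar>A1 F g x\<bar> \<partial>lborel) \<le> ennreal (16 * (\<integral>y. \<bar>g y\<bar> \<partial>lborel))"
proof -
  have "(\<integral>\<^sup>+t. ennreal (indicator {0..2*pi} t * 1) \<partial>lborel) = ennreal (2 * pi)"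
    by (simp add: ennreal_indicator)
  also have "\<dots> \<le> ennreal 8" using pi_less_4 by (intro ennreal_leI) simp
  finally have w: "(\<integral>\<^sup>+t. ennreal (indicator {0..2*pi} t * 1) \<partial>lborel) \<le> ennreal 8" .
  show "\<bar>A1 F g x\<bar> \<le> 16" "(\<integral>\<^sup>+x. ennreal \<bar>A1 F g x\<bar> \<partial>lborel) \<le> ennreal (16 * (\<integral>y. \<bar>g y\<bar> \<partial>lborel))"
    using weighted_circle_bound[of "\<lambda>_. 1" F g 8, OF _ _ _ _ _ F2 g1 g w] by (simp_all add: A1_def[abs_def])
qed

section \<open>Smoothing estimates for bounded functions\<close>

lemma nn_integral_square_le:
  fixes f :: "real \<Rightarrow> real"
  assumes [measurable]: "f \<in> borel_measurable borel" and b: "\<And>x. \<bar>f x\<bar> \<le> C" and i: "(\<integral>\<^sup>+x. ennreal \<bar>f x\<bar> \<partial>lborel) \<le> ennreal I"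
  shows "(\<integral>\<^sup>+x. ennreal ((f x)\<^sup>2) \<partial>lborel) \<le> ennreal (C * I)"
proof -
  have C: "0 \<le> C" using b[of 0] by linarith
  have "(\<integral>\<^sup>+x. ennreal ((f x)\<^sup>2) \<partial>lborel) \<le> (\<integral>\<^sup>+x. ennreal C * ennreal \<bar>f x\<bar> \<partial>lborel)"
  proof (rule nn_integral_mono)
    fix x
    have "(f x)\<^sup>2 = \<bar>f x\<bar> * \<bar>f x\<bar>" by (simp add: power2_eq_square)
    also have "\<dots> \<le> C * \<bar>f x\<bar>" by (intro mult_right_mono b) simp
    finally show "ennreal ((f x)\<^sup>2) \<le> ennreal C * ennreal \<bar>f x\<bar>" using C by (simp add: ennreal_mult[symmetric] ennreal_leI)
  qed
  also have "\<dots> = ennreal C * (\<integral>\<^sup>+x. ennreal \<bar>f x\<bar> \<partial>lborel)" by (simp add: nn_integral_cmult)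
  also have "\<dots> \<le> ennreal C * ennreal I" by (intro mult_left_mono i) simp
  finally show ?thesis using C by (simp add: ennreal_mult')
qed

text \<open>For \<delta> = r^4 and \<theta> = r^20 one has \<epsilon> = r^640, hence \<delta>^5
  \<epsilon>^2 = r^1300, and four further powers of r in the bound on |h| remain as gain. The second
  term is 1728 r^20/r^16, and 331136 = 2(163840 + 1728).\<close>

lemma box_const_le:
  assumes r: "0 < r" "r \<le> 1" and h: "\<bar>h\<bar> \<le> r ^ 1304"
  shows "box_const (r^4) (r^20) h \<le> 331136 * r^4"
proof -
  have "\<bar>h\<bar> * (163840 / ((r^4)^5 * ((r^20)^32)\<^sup>2)) = 163840 * (\<bar>h\<bar> / r ^ 1300)"
    by (simp flip: power_mult power_add)
  also have "\<bar>h\<bar> / r ^ 1300 \<le> r ^ 4"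
  proof -
    have "r ^ 1304 = r ^ 4 * r ^ 1300" by (simp flip: power_add)
    then show ?thesis using h r by (simp add: pos_divide_le_eq)
  qed
  finally have 1: "\<bar>h\<bar> * (163840 / ((r^4)^5 * ((r^20)^32)\<^sup>2)) \<le> 163840 * r ^ 4" by simp
  have "8 * (216 * r^20) / (r^4)^4 = 1728 * (r^20 / r^16)" by (simp flip: power_mult)
  also have "r^20 / r^16 = r^4" using r by (simp add: field_simps flip: power_add)
  finally have 2: "8 * (216 * r^20) / (r^4)^4 = 1728 * r^4" .
  show ?thesis unfolding box_const_def
    by (rule order_trans[OF mult_left_mono[OF add_mono[OF 1 eq_refl[OF 2]]]]) simp_all
qed

text \<open>The choices $\delta = r^4$ and $\epsilon = r^{640}$ give each error term a factor $r^2$ as soon as $|h| \le r^{1304}$.\<close>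

lemma smoothing_L2:
  fixes f g :: "real \<Rightarrow> real"
  assumes f[measurable]: "f \<in> borel_measurable borel" and g[measurable]: "g \<in> borel_measurable borel"
    and f1: "\<And>y. \<bar>f y\<bar> \<le> 1" and g1: "\<And>y. \<bar>g y\<bar> \<le> 1" and fi: "integrable lborel f" and gi: "integrable lborel g"
    and V: "(\<integral>y. \<bar>f y\<bar> \<partial>lborel) \<le> V" "(\<integral>y. \<bar>g y\<bar> \<partial>lborel) \<le> V" "1 \<le> V"
    and r: "0 < r" "r \<le> 1" and h: "\<bar>h\<bar> \<le> r ^ 1304"
  shows "(\<integral>\<^sup>+x. ennreal ((A1 (\<lambda>y. f y - f (y - h)) g x)\<^sup>2) \<partial>lborel) \<le> ennreal (2000000 * r\<^sup>2 * V\<^sup>2)"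
proof -
  define F where "F y = f y - f (y - h)" for y
  have [measurable]: "F \<in> borel_measurable borel" unfolding F_def by measurable
  have F2: "\<bar>F y\<bar> \<le> 2" for y using f1[of y] f1[of "y - h"] unfolding F_def by linarith
  have Fi: "integrable lborel F"
    unfolding F_def using fi lborel_integrable_real_affine[OF fi, of 1 "-h"] by (intro Bochner_Integration.integrable_diff) simp_all
  have h1: "\<bar>h\<bar> \<le> 1" using h r power_le_one[of r 1304] by linarith
  have VV: "V \<le> V\<^sup>2" "0 \<le> V" using V(3) by (auto simp: power2_eq_square mult_le_cancel_left1)
  have \<delta>: "0 < r^4" "r^4 \<le> 1" using r by (auto simp: power_le_one)
  have \<theta>: "0 < r^20" "r^20 \<le> 1" using r by (auto simp: power_le_one)
  have B: "(\<integral>\<^sup>+x. ennreal ((arc_op F g \<sigma> (r^4) x)\<^sup>2) \<partial>lborel) \<le> ennreal (165569 * r\<^sup>2 * V\<^sup>2)" if \<sigma>: "\<bar>\<sigma>\<bar> = 1" for \<sigma>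
  proof -
    have r2: "0 < r\<^sup>2" using r by simp
    have Q: "\<bar>\<integral>z. box_integrand F \<sigma> (r^4) z \<partial>M4\<bar> \<le> 331136 * r^4 * V\<^sup>2"
    proof -
      have "\<bar>\<integral>z. box_integrand F \<sigma> (r^4) z \<partial>M4\<bar> \<le> box_const (r^4) (r^20) h * (\<integral>y. \<bar>f y\<bar> \<partial>lborel)"
        unfolding F_def by (rule box_form_bound[OF f f1 fi h1 \<sigma> \<delta> \<theta>])
      also have "\<dots> \<le> (331136 * r^4) * (\<integral>y. \<bar>f y\<bar> \<partial>lborel)"
        by (intro mult_right_mono box_const_le r h) simp
      also have "\<dots> \<le> (331136 * r^4) * V\<^sup>2"
        using V VV r by (intro mult_left_mono) auto
      finally show ?thesis .
    qed
    \<comment> \<open>The box form is O(r^4), so \<tau> = r^2 balances the two terms of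
      \<open>arc_op_L2\<close>.\<close>
    have "(\<integral>x. (arc_op F g \<sigma> (r^4) x)\<^sup>2 \<partial>lborel) \<le> (r\<^sup>2 * (\<integral>y. \<bar>g y\<bar> \<partial>lborel)\<^sup>2 + (\<integral>z. box_integrand F \<sigma> (r^4) z \<partial>M4) / r\<^sup>2) / 2"
      by (rule arc_op_L2(2)[OF _ _ F2 g1 gi Fi \<delta>(1) r2]) measurable
    also have "\<dots> \<le> (r\<^sup>2 * V\<^sup>2 + (331136 * r^4 * V\<^sup>2) / r\<^sup>2) / 2"
      using V(2) Q r2 by (intro divide_right_mono add_mono mult_left_mono power_mono) auto
    also have "\<dots> = (331137 / 2) * r\<^sup>2 * V\<^sup>2" using r by (simp add: field_simps flip: power_add)
    also have "\<dots> \<le> 165569 * r\<^sup>2 * V\<^sup>2" by (intro mult_right_mono) auto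
    finally have 1: "(\<integral>x. (arc_op F g \<sigma> (r^4) x)\<^sup>2 \<partial>lborel) \<le> 165569 * r\<^sup>2 * V\<^sup>2" .
    have "integrable lborel (\<lambda>x. (arc_op F g \<sigma> (r^4) x)\<^sup>2)"
      by (rule arc_op_L2(1)[OF _ _ F2 g1 gi Fi \<delta>(1) r2]) measurable
    then have "(\<integral>\<^sup>+x. ennreal ((arc_op F g \<sigma> (r^4) x)\<^sup>2) \<partial>lborel) = ennreal (\<integral>x. (arc_op F g \<sigma> (r^4) x)\<^sup>2 \<partial>lborel)"
      by (intro nn_integral_eq_integral) auto
    then show ?thesis using 1 by (simp add: ennreal_leI)
  qed
  have R: "(\<integral>\<^sup>+x. ennreal ((rem_op F g (r^4) x)\<^sup>2) \<partial>lborel) \<le> ennreal (4096 * r\<^sup>2 * V\<^sup>2)"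
  proof -
    have m: "0 \<le> 1 - rho (r^4) t" "1 - rho (r^4) t \<le> 1" for t using rho_bounds(1,2)[OF \<delta>(1), of t] by auto
    have w: "0 \<le> 32 * r" using r by simp
    \<comment> \<open>The supremum bound 64 r and the L^1 bound 64 r times the norm of g multiply to
      the constant 4096 r^2.\<close>
    note bb = weighted_circle_bound[of "\<lambda>t. 1 - rho (r^4) t" F g "32 * r", OF _ _ _ m F2 g1 gi nn_integral_rho[OF r] w, folded rem_op_def]
    have "(\<integral>\<^sup>+x. ennreal ((rem_op F g (r^4) x)\<^sup>2) \<partial>lborel) \<le> ennreal ((2 * (32 * r)) * (2 * (32 * r) * (\<integral>y. \<bar>g y\<bar> \<partial>lborel)))"
      by (rule nn_integral_square_le) (use bb in \<open>auto simp: rem_op_def[abs_def, symmetric]\<close>)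
    also have "\<dots> \<le> ennreal (4096 * r\<^sup>2 * V\<^sup>2)"
    proof (rule ennreal_leI)
      have "(2 * (32 * r)) * (2 * (32 * r) * (\<integral>y. \<bar>g y\<bar> \<partial>lborel)) = 4096 * r\<^sup>2 * (\<integral>y. \<bar>g y\<bar> \<partial>lborel)" by (simp add: power2_eq_square)
      also have "\<dots> \<le> 4096 * r\<^sup>2 * V\<^sup>2" using V VV by (intro mult_left_mono) auto
      finally show "(2 * (32 * r)) * (2 * (32 * r) * (\<integral>y. \<bar>g y\<bar> \<partial>lborel)) \<le> 4096 * r\<^sup>2 * V\<^sup>2" .
    qed
    finally show ?thesis .
  qed
  have "(\<integral>\<^sup>+x. ennreal ((A1 F g x)\<^sup>2) \<partial>lborel) \<le>
    (\<integral>\<^sup>+x. 3 * (ennreal ((arc_op F g 1 (r^4) x)\<^sup>2) + ennreal ((arc_op F g (-1) (r^4) x)\<^sup>2) + ennreal ((rem_op F g (r^4) x)\<^sup>2)) \<partial>lborel)"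
  proof (rule nn_integral_mono)
    fix x
    have sq3: "(a + b + c)\<^sup>2 \<le> 3 * (a\<^sup>2 + b\<^sup>2 + c\<^sup>2)" for a b c :: real
    proof -
      have "0 \<le> (a - b)\<^sup>2 + (a - c)\<^sup>2 + (b - c)\<^sup>2" by simp
      also have "\<dots> = 3 * (a\<^sup>2 + b\<^sup>2 + c\<^sup>2) - (a + b + c)\<^sup>2" by algebra
      finally show ?thesis by simp
    qed
    have "A1 F g x = arc_op F g 1 (r^4) x + arc_op F g (-1) (r^4) x + rem_op F g (r^4) x"
      by (rule A1_decomposition[OF _ _ F2 g1 \<delta>(1)]) measurable
    then have "(A1 F g x)\<^sup>2 \<le> 3 * ((arc_op F g 1 (r^4) x)\<^sup>2 + (arc_op F g (-1) (r^4) x)\<^sup>2 + (rem_op F g (r^4) x)\<^sup>2)"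
      using sq3 by simp
    then have "ennreal ((A1 F g x)\<^sup>2) \<le> ennreal (3 * ((arc_op F g 1 (r^4) x)\<^sup>2 + (arc_op F g (-1) (r^4) x)\<^sup>2 + (rem_op F g (r^4) x)\<^sup>2))"
      by (rule ennreal_leI)
    then show "ennreal ((A1 F g x)\<^sup>2) \<le> 3 * (ennreal ((arc_op F g 1 (r^4) x)\<^sup>2) + ennreal ((arc_op F g (-1) (r^4) x)\<^sup>2) + ennreal ((rem_op F g (r^4) x)\<^sup>2))"
      by (simp add: ennreal_mult')
  qed
  also have "\<dots> = 3 * ((\<integral>\<^sup>+x. ennreal ((arc_op F g 1 (r^4) x)\<^sup>2) \<partial>lborel) + (\<integral>\<^sup>+x. ennreal ((arc_op F g (-1) (r^4) x)\<^sup>2) \<partial>lborel) + (\<integral>\<^sup>+x. ennreal ((rem_op F g (r^4) x)\<^sup>2) \<partial>lborel))"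
    by (simp add: nn_integral_cmult nn_integral_add)
  also have "\<dots> \<le> 3 * (ennreal (165569 * r\<^sup>2 * V\<^sup>2) + ennreal (165569 * r\<^sup>2 * V\<^sup>2) + ennreal (4096 * r\<^sup>2 * V\<^sup>2))"
    by (intro mult_left_mono add_mono B R) auto
  also have "\<dots> = ennreal (3 * (165569 * r\<^sup>2 * V\<^sup>2 + 165569 * r\<^sup>2 * V\<^sup>2 + 4096 * r\<^sup>2 * V\<^sup>2))"
  proof -
    have e3: "3 * (ennreal a + ennreal b + ennreal c) = ennreal (3 * (a + b + c))" if "0 \<le> a" "0 \<le> b" "0 \<le> c" for a b c :: real
      using that by (simp add: ennreal_mult')
    show ?thesis by (rule e3) auto
  qed
  also have "\<dots> \<le> ennreal (2000000 * r\<^sup>2 * V\<^sup>2)"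
  proof (rule ennreal_leI)
    have "0 \<le> r\<^sup>2 * V\<^sup>2" by simp
    then show "3 * (165569 * r\<^sup>2 * V\<^sup>2 + 165569 * r\<^sup>2 * V\<^sup>2 + 4096 * r\<^sup>2 * V\<^sup>2) \<le> 2000000 * r\<^sup>2 * V\<^sup>2" by (simp add: algebra_simps)
  qed
  finally show ?thesis unfolding F_def .
qed

text \<open>Values are compared with the level \<mu> = r^(1/2). Below it, |A|^p <= \<mu>^(p-1) |A|,
  and the trivial L^1 bound yields r^((p-1)/2), a gain since p > 1. Above it, |A| <= 16 gives |A|^p
  <= 16^p A^2/r, and the L^2 bound r^2 leaves r. The exponent is the smaller of the two, divided by
  1304 because r = |h|^(1/1304).\<close>

lemma smoothing_Lr:
  fixes p :: real
  assumes p: "1 < p"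
  obtains \<kappa> C :: real where "0 < \<kappa>" "0 \<le> C"
    "\<And>h f g V. \<lbrakk>0 < \<bar>h\<bar>; \<bar>h\<bar> < 1; f \<in> borel_measurable borel; g \<in> borel_measurable borel;
       \<And>y. \<bar>f y\<bar> \<le> 1; \<And>y. \<bar>g y\<bar> \<le> 1; integrable lborel f; integrable lborel g;
       (\<integral>y. \<bar>f y\<bar> \<partial>lborel) \<le> V; (\<integral>y. \<bar>g y\<bar> \<partial>lborel) \<le> V; 1 \<le> V\<rbrakk>
     \<Longrightarrow> (\<integral>\<^sup>+x. ennreal (\<bar>A1 (\<lambda>y. f y - f (y - h)) g x\<bar> powr p) \<partial>lborel) \<le> ennreal (C * \<bar>h\<bar> powr \<kappa> * V\<^sup>2)"
proof
  define \<kappa>0 where "\<kappa>0 = min ((p - 1) / 2) 1"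
  show "0 < \<kappa>0 / 1304" using p by (simp add: \<kappa>0_def)
  show "0 \<le> 16 + 16 powr p * 2000000" by (simp add: add_nonneg_nonneg)
  fix h V :: real and f g :: "real \<Rightarrow> real"
  assume h: "0 < \<bar>h\<bar>" "\<bar>h\<bar> < 1" and m[measurable]: "f \<in> borel_measurable borel" "g \<in> borel_measurable borel"
    and f1: "\<And>y. \<bar>f y\<bar> \<le> 1" and g1: "\<And>y. \<bar>g y\<bar> \<le> 1" and fi: "integrable lborel f" and gi: "integrable lborel g"
    and V: "(\<integral>y. \<bar>f y\<bar> \<partial>lborel) \<le> V" "(\<integral>y. \<bar>g y\<bar> \<partial>lborel) \<le> V" "1 \<le> V"
  define F where "F y = f y - f (y - h)" for y
  have [measurable]: "F \<in> borel_measurable borel" unfolding F_def by measurable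
  have F2: "\<bar>F y\<bar> \<le> 2" for y using f1[of y] f1[of "y - h"] unfolding F_def by linarith
  define r where "r = \<bar>h\<bar> powr (1 / 1304)"
  have r: "0 < r" "r \<le> 1" using h by (auto simp: r_def powr_le1)
  have "r ^ 1304 = r powr 1304" using r by (simp add: powr_numeral)
  also have "\<dots> = \<bar>h\<bar>" using h by (simp add: r_def powr_powr)
  finally have rh: "\<bar>h\<bar> \<le> r ^ 1304" by simp
  define \<mu> where "\<mu> = r powr (1/2)"
  have \<mu>: "0 < \<mu>" using r by (simp add: \<mu>_def)
  have \<mu>2: "\<mu>\<^sup>2 = r" using r by (simp add: \<mu>_def powr_half_sqrt)
  let ?A = "A1 F g"
  have triv: "\<bar>?A x\<bar> \<le> 16" "(\<integral>\<^sup>+x. ennreal \<bar>?A x\<bar> \<partial>lborel) \<le> ennreal (16 * (\<integral>y. \<bar>g y\<bar> \<partial>lborel))" for x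
    by (rule A1_trivial[OF _ _ F2 g1 gi]; measurable)+
  have pw: "\<bar>?A x\<bar> powr p \<le> \<mu> powr (p - 1) * \<bar>?A x\<bar> + 16 powr p / r * (?A x)\<^sup>2" for x
  proof (cases "\<bar>?A x\<bar> \<le> \<mu>")
    case True
    have "\<bar>?A x\<bar> powr p = \<bar>?A x\<bar> powr (p - 1) * \<bar>?A x\<bar>"
      using powr_mult_base'[of "?A x" "p - 1"] p by (cases "?A x = 0") (auto simp: powr_diff)
    also have "\<dots> \<le> \<mu> powr (p - 1) * \<bar>?A x\<bar>" using True p by (intro mult_right_mono powr_mono2) auto
    finally show ?thesis using r by (simp add: add_increasing2)
  next
    case False
    then have "\<mu>\<^sup>2 \<le> \<bar>?A x\<bar>\<^sup>2" using \<mu> by (intro power_mono) auto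
    then have "1 \<le> (?A x)\<^sup>2 / r" using r by (simp add: \<mu>2)
    moreover have "\<bar>?A x\<bar> powr p \<le> 16 powr p" using triv(1) p by (intro powr_mono2) auto
    ultimately have "\<bar>?A x\<bar> powr p \<le> 16 powr p * ((?A x)\<^sup>2 / r)"
      by (metis (no_types, lifting) mult.right_neutral mult_left_mono order_trans powr_ge_zero)
    then show ?thesis by (simp add: add_increasing)
  qed
  have "(\<integral>\<^sup>+x. ennreal (\<bar>?A x\<bar> powr p) \<partial>lborel) \<le> (\<integral>\<^sup>+x. ennreal (\<mu> powr (p - 1)) * ennreal \<bar>?A x\<bar> + ennreal (16 powr p / r) * ennreal ((?A x)\<^sup>2) \<partial>lborel)"
  proof (rule nn_integral_mono)
    fix x
    show "ennreal (\<bar>?A x\<bar> powr p) \<le> ennreal (\<mu> powr (p - 1)) * ennreal \<bar>?A x\<bar> + ennreal (16 powr p / r) * ennreal ((?A x)\<^sup>2)"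
    proof -
      have "ennreal (\<mu> powr (p - 1)) * ennreal \<bar>?A x\<bar> + ennreal (16 powr p / r) * ennreal ((?A x)\<^sup>2)
        = ennreal (\<mu> powr (p - 1) * \<bar>?A x\<bar> + 16 powr p / r * (?A x)\<^sup>2)"
        using r by (simp add: ennreal_mult[symmetric] ennreal_plus[symmetric] del: ennreal_plus)
      then show ?thesis using ennreal_leI[OF pw[of x]] by simp
    qed
  qed
  also have "\<dots> = ennreal (\<mu> powr (p - 1)) * (\<integral>\<^sup>+x. ennreal \<bar>?A x\<bar> \<partial>lborel) + ennreal (16 powr p / r) * (\<integral>\<^sup>+x. ennreal ((?A x)\<^sup>2) \<partial>lborel)"
    by (simp add: nn_integral_add nn_integral_cmult)
  also have "\<dots> \<le> ennreal (\<mu> powr (p - 1)) * ennreal (16 * (\<integral>y. \<bar>g y\<bar> \<partial>lborel)) + ennreal (16 powr p / r) * ennreal (2000000 * r\<^sup>2 * V\<^sup>2)"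
    using smoothing_L2[OF m f1 g1 fi gi V r rh] by (intro add_mono mult_left_mono triv) (auto simp: F_def[abs_def])
  also have "\<dots> = ennreal (\<mu> powr (p - 1) * (16 * (\<integral>y. \<bar>g y\<bar> \<partial>lborel)) + (16 powr p / r) * (2000000 * r\<^sup>2 * V\<^sup>2))"
    using r by (simp add: ennreal_mult[symmetric] ennreal_plus[symmetric] del: ennreal_plus)
  also have "\<dots> \<le> ennreal ((16 + 16 powr p * 2000000) * \<bar>h\<bar> powr (\<kappa>0 / 1304) * V\<^sup>2)"
  proof (rule ennreal_leI)
    have \<kappa>0: "\<kappa>0 \<le> (p - 1) / 2" "\<kappa>0 \<le> 1" unfolding \<kappa>0_def by (rule min.cobounded1, rule min.cobounded2)
    have hk: "\<bar>h\<bar> powr (\<kappa>0 / 1304) = r powr \<kappa>0" by (simp add: r_def powr_powr)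
    have "\<mu> powr (p - 1) = r powr ((p - 1) / 2)" by (simp add: \<mu>_def powr_powr)
    also have "\<dots> \<le> r powr \<kappa>0" using r \<kappa>0 by (intro powr_mono') auto
    finally have 1: "\<mu> powr (p - 1) \<le> r powr \<kappa>0" .
    have "r powr 1 \<le> r powr \<kappa>0" using r \<kappa>0 by (intro powr_mono') auto
    then have 2: "r \<le> r powr \<kappa>0" using r by simp
    have VV: "V \<le> V\<^sup>2" using V(3) by (auto simp: power2_eq_square mult_le_cancel_left1)
    have "\<mu> powr (p - 1) * (16 * (\<integral>y. \<bar>g y\<bar> \<partial>lborel)) \<le> r powr \<kappa>0 * (16 * V\<^sup>2)"
      using 1 V VV by (intro mult_mono) auto
    moreover have "(16 powr p / r) * (2000000 * r\<^sup>2 * V\<^sup>2) = 16 powr p * 2000000 * V\<^sup>2 * r" using r by (simp add: power2_eq_square)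
    moreover have "16 powr p * 2000000 * V\<^sup>2 * r \<le> 16 powr p * 2000000 * V\<^sup>2 * r powr \<kappa>0"
      using 2 by (intro mult_left_mono) auto
    ultimately show "\<mu> powr (p - 1) * (16 * (\<integral>y. \<bar>g y\<bar> \<partial>lborel)) + (16 powr p / r) * (2000000 * r\<^sup>2 * V\<^sup>2)
      \<le> (16 + 16 powr p * 2000000) * \<bar>h\<bar> powr (\<kappa>0 / 1304) * V\<^sup>2" unfolding hk by (simp add: algebra_simps)
  qed
  finally show "(\<integral>\<^sup>+x. ennreal (\<bar>A1 (\<lambda>y. f y - f (y - h)) g x\<bar> powr p) \<partial>lborel) \<le> ennreal ((16 + 16 powr p * 2000000) * \<bar>h\<bar> powr (\<kappa>0 / 1304) * V\<^sup>2)"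
    unfolding F_def .
qed

section \<open>Truncation in $L^p$\<close>

text \<open>The norm raised to the power p = 1/a. Working with this integral keeps roots out of the
  estimates for sums, cuts and translates.\<close>

definition p_mass :: "real \<Rightarrow> (real \<Rightarrow> real) \<Rightarrow> ennreal" where
  "p_mass a f = (\<integral>\<^sup>+x. ennreal (\<bar>f x\<bar> powr (1 / a)) \<partial>lborel)"

lemma lpnorm_le_iff:
  assumes a: "0 < a" and Y: "0 \<le> Y"
  shows "lpnorm a f \<le> ennreal Y \<longleftrightarrow> p_mass a f \<le> ennreal (Y powr (1 / a))"
proof (cases "p_mass a f = \<infinity>")
  case True
  then show ?thesis using a Y by (simp add: lpnorm_def enn_powr_def top_unique flip: p_mass_def)
next
  case False
  then obtain X where X: "p_mass a f = ennreal X" "0 \<le> X" by (cases "p_mass a f") auto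
  have "lpnorm a f = ennreal (X powr a)" using a X by (simp add: lpnorm_def enn_powr_def flip: p_mass_def)
  moreover have "X powr a \<le> Y \<longleftrightarrow> X \<le> Y powr (1 / a)"
  proof
    assume "X powr a \<le> Y"
    then have "(X powr a) powr (1 / a) \<le> Y powr (1 / a)" using a by (intro powr_mono2) auto
    then show "X \<le> Y powr (1 / a)" using a X by (simp add: powr_powr)
  next
    assume "X \<le> Y powr (1 / a)"
    then have "X powr a \<le> (Y powr (1 / a)) powr a" using a X by (intro powr_mono2) auto
    then show "X powr a \<le> Y" using a Y by (simp add: powr_powr)
  qed
  ultimately show ?thesis using X Y by simp
qed

lemma lpnorm_finite_iff: "0 < a \<Longrightarrow> lpnorm a f < \<infinity> \<longleftrightarrow> p_mass a f < \<infinity>"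
  by (auto simp: lpnorm_def enn_powr_def less_top simp flip: p_mass_def)

lemma p_mass_mono: "0 < a \<Longrightarrow> (\<And>x. \<bar>f x\<bar> \<le> \<bar>g x\<bar>) \<Longrightarrow> p_mass a f \<le> p_mass a g"
  unfolding p_mass_def by (intro nn_integral_mono ennreal_leI powr_mono2) auto

lemma p_mass_add:
  assumes [measurable]: "f \<in> borel_measurable borel" "g \<in> borel_measurable borel" and a: "0 < a"
  shows "p_mass a (\<lambda>x. f x + g x) \<le> ennreal (2 powr (1 / a)) * (p_mass a f + p_mass a g)"
proof -
  have pw: "\<bar>u + v\<bar> powr s \<le> 2 powr s * (\<bar>u\<bar> powr s + \<bar>v\<bar> powr s)" if "0 < s" for u v s :: real
  proof -
    have "\<bar>u + v\<bar> powr s \<le> (2 * max \<bar>u\<bar> \<bar>v\<bar>) powr s" using that by (intro powr_mono2) auto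
    also have "\<dots> = 2 powr s * max \<bar>u\<bar> \<bar>v\<bar> powr s" by (rule powr_mult)
    also have "\<dots> \<le> 2 powr s * (\<bar>u\<bar> powr s + \<bar>v\<bar> powr s)" by (intro mult_left_mono) (auto simp: max_def)
    finally show ?thesis .
  qed
  have "p_mass a (\<lambda>x. f x + g x) \<le> (\<integral>\<^sup>+x. ennreal (2 powr (1 / a)) * (ennreal (\<bar>f x\<bar> powr (1 / a)) + ennreal (\<bar>g x\<bar> powr (1 / a))) \<partial>lborel)"
    unfolding p_mass_def
  proof (rule nn_integral_mono)
    fix x
    show "ennreal (\<bar>f x + g x\<bar> powr (1 / a)) \<le> ennreal (2 powr (1 / a)) * (ennreal (\<bar>f x\<bar> powr (1 / a)) + ennreal (\<bar>g x\<bar> powr (1 / a)))"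
      using ennreal_leI[OF pw[of "1 / a" "f x" "g x"]] a by (simp add: ennreal_mult' )
  qed
  also have "\<dots> = ennreal (2 powr (1 / a)) * (p_mass a f + p_mass a g)"
    unfolding p_mass_def by (simp add: nn_integral_cmult nn_integral_add)
  finally show ?thesis .
qed

lemma p_mass_translate_diff:
  assumes [measurable]: "f \<in> borel_measurable borel" and a: "0 < a"
  shows "p_mass a (\<lambda>x. f x - f (x - h)) \<le> ennreal (2 powr (1 / a + 1)) * p_mass a f"
proof -
  have "p_mass a (\<lambda>x. f x + - f (x - h)) \<le> ennreal (2 powr (1 / a)) * (p_mass a f + p_mass a (\<lambda>x. - f (x - h)))"
    by (rule p_mass_add[OF _ _ a]) measurable
  also have "p_mass a (\<lambda>x. - f (x - h)) = p_mass a f"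
    unfolding p_mass_def using nn_integral_reflect_translate(1)[of "\<lambda>x. ennreal (\<bar>f x\<bar> powr (1 / a))"] by simp
  also have "ennreal (2 powr (1 / a)) * (p_mass a f + p_mass a f) = ennreal (2 powr (1 / a + 1)) * p_mass a f"
    by (simp add: powr_add ennreal_mult mult.assoc flip: mult_2)
  finally show ?thesis by simp
qed

lemma p_mass_scale:
  assumes [measurable]: "f \<in> borel_measurable borel"
  shows "p_mass a (\<lambda>x. k * f x) = ennreal (\<bar>k\<bar> powr (1 / a)) * p_mass a f"
  unfolding p_mass_def by (simp add: abs_mult powr_mult ennreal_mult nn_integral_cmult)

section \<open>Boundedness in terms of masses\<close>

lemma A1_scale: "A1 (\<lambda>x. k * f x) (\<lambda>x. l * g x) x = k * l * A1 f g x"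
proof -
  have "A1 (\<lambda>x. k * f x) (\<lambda>x. l * g x) x = (LINT t:{0..2*pi}|lborel. (k * l) * (f (x - cos t) * g (x - sin t)))"
    unfolding A1_def by (simp add: mult_ac)
  then show ?thesis unfolding A1_def by simp
qed

text \<open>The norm inequality raised to the power 1/c: a mass at most X means a norm at most X^a,
  which explains the exponents a/c and b/c. The almost everywhere integrability is carried along
  since additivity of \<open>A1\<close> depends on it.\<close>

definition mass_bound :: "real \<Rightarrow> real \<Rightarrow> real \<Rightarrow> real \<Rightarrow> bool" where
  "mass_bound K a b c \<longleftrightarrow> 0 \<le> K \<and> (\<forall>f g X Y. f \<in> borel_measurable borel \<longrightarrow> g \<in> borel_measurable borel \<longrightarrow> 0 \<le> X \<longrightarrow> 0 \<le> Y \<longrightarrow>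
      p_mass a f \<le> ennreal X \<longrightarrow> p_mass b g \<le> ennreal Y \<longrightarrow>
      (AE x in lborel. set_integrable lborel {0..2*pi} (\<lambda>t. f (x - cos t) * g (x - sin t))) \<and>
      p_mass c (A1 f g) \<le> ennreal (K * X powr (a / c) * Y powr (b / c)))"

lemma mass_boundD:
  assumes "mass_bound K a b c" "f \<in> borel_measurable borel" "g \<in> borel_measurable borel" "0 \<le> X" "0 \<le> Y"
    "p_mass a f \<le> ennreal X" "p_mass b g \<le> ennreal Y"
  shows "p_mass c (A1 f g) \<le> ennreal (K * X powr (a / c) * Y powr (b / c))"
    "AE x in lborel. set_integrable lborel {0..2*pi} (\<lambda>t. f (x - cos t) * g (x - sin t))"
  using assms unfolding mass_bound_def by blast+

lemma mass_bound_exists: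
  assumes bdd: "A1_bounded a b c" and abc: "0 < a" "0 < b" "0 < c"
  obtains K where "mass_bound K a b c"
proof -
  obtain C where C: "\<And>f g. in_Lp a f \<Longrightarrow> in_Lp b g \<Longrightarrow>
      (AE x in lborel. set_integrable lborel {0..2*pi} (\<lambda>t. f (x - cos t) * g (x - sin t))) \<and>
      lpnorm c (A1 f g) \<le> ennreal C * lpnorm a f * lpnorm b g"
    using bdd unfolding A1_bounded_def by blast
  have Lp: "in_Lp s f" if "f \<in> borel_measurable borel" "p_mass s f \<le> ennreal X" "0 < s" for s f X
    using that(1) lpnorm_finite_iff[OF that(3), of f] le_less_trans[OF that(2) ennreal_less_top] by (simp add: in_Lp_def)
  \<comment> \<open>The constant C may be negative, and then \<open>ennreal C\<close> is 0.
    Replacing it by \<open>max 0 C\<close> does not change that value and allows taking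
    powers.\<close>
  have "mass_bound ((max 0 C) powr (1 / c)) a b c"
    unfolding mass_bound_def
  proof (intro conjI allI impI)
    fix f g :: "real \<Rightarrow> real" and X Y :: real
    assume m: "f \<in> borel_measurable borel" "g \<in> borel_measurable borel" and XY: "0 \<le> X" "0 \<le> Y" and N: "p_mass a f \<le> ennreal X" "p_mass b g \<le> ennreal Y"
    note Cfg = C[OF Lp[OF m(1) N(1) abc(1)] Lp[OF m(2) N(2) abc(2)]]
    show "AE x in lborel. set_integrable lborel {0..2*pi} (\<lambda>t. f (x - cos t) * g (x - sin t))" using Cfg by blast
    have "lpnorm a f \<le> ennreal (X powr a)" "lpnorm b g \<le> ennreal (Y powr b)"
      using N abc XY by (simp_all add: lpnorm_le_iff powr_powr)
    then have "ennreal (max 0 C) * lpnorm a f * lpnorm b g \<le> ennreal (max 0 C) * ennreal (X powr a) * ennreal (Y powr b)"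
      by (intro mult_mono) auto
    moreover have "ennreal (max 0 C) = ennreal C" by (auto simp: max_def ennreal_neg)
    then have "lpnorm c (A1 f g) \<le> ennreal (max 0 C) * lpnorm a f * lpnorm b g" using Cfg by simp
    ultimately have "lpnorm c (A1 f g) \<le> ennreal (max 0 C * X powr a * Y powr b)"
      by (simp add: ennreal_mult)
    then have "p_mass c (A1 f g) \<le> ennreal ((max 0 C * X powr a * Y powr b) powr (1 / c))"
      using abc by (subst (asm) lpnorm_le_iff) auto
    also have "(max 0 C * X powr a * Y powr b) powr (1 / c) = max 0 C powr (1 / c) * X powr (a / c) * Y powr (b / c)"
      by (simp add: powr_mult powr_powr)
    finally show "p_mass c (A1 f g) \<le> ennreal (max 0 C powr (1 / c) * X powr (a / c) * Y powr (b / c))" .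
  qed simp
  then show thesis by (rule that)
qed

section \<open>Splitting a function by height\<close>

definition cut_large :: "real \<Rightarrow> (real \<Rightarrow> real) \<Rightarrow> real \<Rightarrow> real" where
  "cut_large l f x = (if \<bar>f x\<bar> > l then f x else 0)"
definition cut_small :: "real \<Rightarrow> (real \<Rightarrow> real) \<Rightarrow> real \<Rightarrow> real" where
  "cut_small l f x = (if \<bar>f x\<bar> < 1 / l then f x else 0)"
definition cut_mid :: "real \<Rightarrow> (real \<Rightarrow> real) \<Rightarrow> real \<Rightarrow> real" where
  "cut_mid l f x = (if \<bar>f x\<bar> > l \<or> \<bar>f x\<bar> < 1 / l then 0 else f x)"

lemma borel_cut [measurable]:
  assumes [measurable]: "f \<in> borel_measurable borel"
  shows "cut_large l f \<in> borel_measurable borel" "cut_small l f \<in> borel_measurable borel" "cut_mid l f \<in> borel_measurable borel"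
  unfolding cut_large_def cut_small_def cut_mid_def by measurable

lemma cut_sum: "1 \<le> l \<Longrightarrow> f x = cut_large l f x + cut_small l f x + cut_mid l f x"
proof -
  assume l: "1 \<le> l"
  then have "1 / l \<le> 1" by simp
  then have "\<not> (\<bar>f x\<bar> < 1 / l \<and> l < \<bar>f x\<bar>)" using l by linarith
  then show ?thesis by (auto simp: cut_large_def cut_small_def cut_mid_def)
qed

text \<open>A larger reciprocal exponent means a lower power of |f|. Where |f| > l the missing power
  of |f| is at most the same negative power of l; where |f| < 1/l the extra positive power is at
  most that power of 1/l. Either way a negative power of l is gained.\<close>

lemma p_mass_cut:
  assumes [measurable]: "f \<in> borel_measurable borel" and f: "p_mass a f \<le> 1" and a: "0 < a" and e: "0 < e" "e < a" and l: "1 \<le> l"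
  shows "p_mass (a + e) (cut_large l f) \<le> ennreal (l powr (1 / (a + e) - 1 / a))"
    "p_mass (a - e) (cut_small l f) \<le> ennreal (l powr (1 / a - 1 / (a - e)))"
proof -
  have gen: "p_mass s u \<le> ennreal k" if "\<And>x. \<bar>u x\<bar> powr (1 / s) \<le> k * \<bar>f x\<bar> powr (1 / a)" "0 \<le> k" for s u k
  proof -
    have "p_mass s u \<le> (\<integral>\<^sup>+x. ennreal k * ennreal (\<bar>f x\<bar> powr (1 / a)) \<partial>lborel)"
      unfolding p_mass_def using that by (intro nn_integral_mono) (simp add: ennreal_mult[symmetric] ennreal_leI)
    also have "\<dots> = ennreal k * p_mass a f" unfolding p_mass_def by (rule nn_integral_cmult) simp
    also have "\<dots> \<le> ennreal k * 1" by (intro mult_left_mono f) simp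
    finally show ?thesis by simp
  qed
  show "p_mass (a + e) (cut_large l f) \<le> ennreal (l powr (1 / (a + e) - 1 / a))"
  proof (rule gen)
    fix x
    show "\<bar>cut_large l f x\<bar> powr (1 / (a + e)) \<le> l powr (1 / (a + e) - 1 / a) * \<bar>f x\<bar> powr (1 / a)"
    proof (cases "\<bar>f x\<bar> > l")
      case True
      have "1 / (a + e) - 1 / a \<le> 0" using a e by (simp add: frac_le)
      then have "\<bar>f x\<bar> powr (1 / (a + e) - 1 / a) \<le> l powr (1 / (a + e) - 1 / a)" using True l by (intro powr_mono2') auto
      then have "\<bar>f x\<bar> powr (1 / (a + e) - 1 / a) * \<bar>f x\<bar> powr (1 / a) \<le> l powr (1 / (a + e) - 1 / a) * \<bar>f x\<bar> powr (1 / a)"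
        by (intro mult_right_mono) auto
      then show ?thesis using True by (simp add: cut_large_def flip: powr_add)
    qed (use a e in \<open>simp add: cut_large_def\<close>)
  qed simp
  show "p_mass (a - e) (cut_small l f) \<le> ennreal (l powr (1 / a - 1 / (a - e)))"
  proof (rule gen)
    fix x
    show "\<bar>cut_small l f x\<bar> powr (1 / (a - e)) \<le> l powr (1 / a - 1 / (a - e)) * \<bar>f x\<bar> powr (1 / a)"
    proof (cases "\<bar>f x\<bar> < 1 / l \<and> f x \<noteq> 0")
      case True
      have "0 \<le> 1 / (a - e) - 1 / a" using a e by (simp add: frac_le)
      then have "\<bar>f x\<bar> powr (1 / (a - e) - 1 / a) \<le> (1 / l) powr (1 / (a - e) - 1 / a)" using True l by (intro powr_mono2) auto
      also have "\<dots> = l powr (1 / a - 1 / (a - e))" using l by (simp add: powr_divide powr_minus_divide[symmetric])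
      finally have "\<bar>f x\<bar> powr (1 / (a - e) - 1 / a) * \<bar>f x\<bar> powr (1 / a) \<le> l powr (1 / a - 1 / (a - e)) * \<bar>f x\<bar> powr (1 / a)"
        by (intro mult_right_mono) auto
      then show ?thesis using True by (simp add: cut_small_def flip: powr_add)
    qed (auto simp: cut_small_def)
  qed simp
qed

text \<open>Division by l brings the values below 1. Where the middle part is nonzero, l |f| >= 1,
  so the value 1 is dominated by (l |f|)^(1/a) and the L^1 norm by the mass of f.\<close>

lemma cut_mid_bounds:
  assumes [measurable]: "f \<in> borel_measurable borel" and f: "p_mass a f \<le> 1" and a: "0 < a" and l: "1 \<le> l"
  shows "\<bar>cut_mid l f x / l\<bar> \<le> 1" "integrable lborel (\<lambda>x. cut_mid l f x / l)" "(\<integral>x. \<bar>cut_mid l f x / l\<bar> \<partial>lborel) \<le> l powr (1 / a)"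
proof -
  show b: "\<bar>cut_mid l f x / l\<bar> \<le> 1" for x using l by (simp add: cut_mid_def divide_le_eq_1)
  have pw: "\<bar>cut_mid l f x / l\<bar> \<le> l powr (1 / a) * \<bar>f x\<bar> powr (1 / a)" for x
  proof (cases "cut_mid l f x = 0")
    case False
    then have "1 / l \<le> \<bar>f x\<bar>" by (simp add: cut_mid_def split: if_splits)
    then have "1 \<le> l * \<bar>f x\<bar>" using l by (simp add: field_simps)
    then have "1 powr (1 / a) \<le> (l * \<bar>f x\<bar>) powr (1 / a)" using a by (intro powr_mono2) auto
    then show ?thesis using b[of x] by (simp add: powr_mult)
  qed simp
  have n: "(\<integral>\<^sup>+x. ennreal \<bar>cut_mid l f x / l\<bar> \<partial>lborel) \<le> ennreal (l powr (1 / a))"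
  proof -
    have "(\<integral>\<^sup>+x. ennreal \<bar>cut_mid l f x / l\<bar> \<partial>lborel) \<le> (\<integral>\<^sup>+x. ennreal (l powr (1 / a)) * ennreal (\<bar>f x\<bar> powr (1 / a)) \<partial>lborel)"
      using pw by (intro nn_integral_mono) (simp add: ennreal_mult[symmetric] ennreal_leI)
    also have "\<dots> = ennreal (l powr (1 / a)) * p_mass a f" unfolding p_mass_def by (rule nn_integral_cmult) simp
    also have "\<dots> \<le> ennreal (l powr (1 / a)) * 1" by (intro mult_left_mono f) simp
    finally show ?thesis by simp
  qed
  show int: "integrable lborel (\<lambda>x. cut_mid l f x / l)"
    by (rule integrableI_bounded) (use n in \<open>auto intro: le_less_trans\<close>)
  have "(\<integral>\<^sup>+x. ennreal \<bar>cut_mid l f x / l\<bar> \<partial>lborel) = ennreal (\<integral>x. \<bar>cut_mid l f x / l\<bar> \<partial>lborel)"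
    unfolding real_norm_def[symmetric] by (rule nn_integral_eq_integral[OF integrable_norm[OF int]]) simp
  then show "(\<integral>x. \<bar>cut_mid l f x / l\<bar> \<partial>lborel) \<le> l powr (1 / a)" using n by simp
qed

text \<open>The common factor H is kept separate so that nested applications to a sum of several
  terms again give a constant times H.\<close>

lemma p_mass_add_le:
  assumes "u \<in> borel_measurable borel" "v \<in> borel_measurable borel" and a: "0 < a"
    and u: "p_mass a u \<le> ennreal (x * H)" and v: "p_mass a v \<le> ennreal (y * H)" and "0 \<le> x" "0 \<le> y" "0 \<le> H"
  shows "p_mass a (\<lambda>z. u z + v z) \<le> ennreal (2 powr (1 / a) * (x + y) * H)"
proof -
  have xH: "0 \<le> x * H" "0 \<le> y * H" using assms by auto
  have "p_mass a (\<lambda>z. u z + v z) \<le> ennreal (2 powr (1 / a)) * (ennreal (x * H) + ennreal (y * H))"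
    by (rule order_trans[OF p_mass_add[OF assms(1,2) a]]) (intro mult_left_mono add_mono u v, simp)
  also have "\<dots> = ennreal (2 powr (1 / a) * (x * H + y * H))"
    unfolding ennreal_plus[OF xH, symmetric] by (rule ennreal_mult[symmetric]) (use xH in auto)
  also have "2 powr (1 / a) * (x * H + y * H) = 2 powr (1 / a) * (x + y) * H" by (simp add: algebra_simps)
  finally show ?thesis .
qed

section \<open>Decay in h from boundedness at nearby exponents\<close>

lemma p_mass_cong_AE: "(AE x in lborel. u x = v x) \<Longrightarrow> p_mass a u = p_mass a v"
  unfolding p_mass_def by (intro nn_integral_cong_AE) auto

text \<open>Displacements by d/2 stay in the ball and hence in the unit cube, which bounds a, b, c
  below by d/2 and c above by 1 - d/2. With e = d/4 the numbers a - e and b - e remain positive.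
  Only one of a, b is ever moved, never c.\<close>

lemma interior_R1_cases:
  assumes "(a, b, c) \<in> interior R1"
  obtains e where "0 < e" "e < a" "e < b" "0 < c" "c < 1"
    "A1_bounded (a + e) b c" "A1_bounded (a - e) b c" "A1_bounded a (b + e) c" "A1_bounded a (b - e) c"
proof -
  obtain d where d: "0 < d" "ball (a, b, c) d \<subseteq> R1" using assms by (auto simp: mem_interior)
  have R: "(a + x, b + y, c + z) \<in> R1" if "sqrt (x\<^sup>2 + (y\<^sup>2 + z\<^sup>2)) < d" for x y z
  proof -
    have "dist (a, b, c) (a + x, b + y, c + z) < d"
      using that by (simp add: dist_prod_def dist_real_def)
    then show ?thesis using d(2) by auto
  qed
  have "(a - d/2, b, c) \<in> R1" "(a, b - d/2, c) \<in> R1" "(a, b, c - d/2) \<in> R1" "(a, b, c + d/2) \<in> R1"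
    using R[of "-(d/2)" 0 0] R[of 0 "-(d/2)" 0] R[of 0 0 "-(d/2)"] R[of 0 0 "d/2"] d(1) by simp_all
  then have "d / 2 \<le> a" "d / 2 \<le> b" "d / 2 \<le> c" "c + d / 2 \<le> 1" by (auto simp: R1_def)
  moreover have "(a + d/4, b, c) \<in> R1" "(a - d/4, b, c) \<in> R1" "(a, b + d/4, c) \<in> R1" "(a, b - d/4, c) \<in> R1"
    using R[of "d/4" 0 0] R[of "-(d/4)" 0 0] R[of 0 "d/4" 0] R[of 0 "-(d/4)" 0] d(1) by simp_all
  ultimately show thesis using d(1) by (intro that[of "d/4"]) (auto simp: R1_def)
qed

text \<open>Five terms arise: the large and the small part of f against all of g, the middle of f
  against the large and the small part of g, and middle against middle. The first four have one
  extreme factor each, so moving one exponent is enough; the last is the smoothing estimate.\<close>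

lemma normalized_bound:
  assumes "(a, b, c) \<in> interior R1"
  obtains \<eta> C :: real where "0 < \<eta>" "0 \<le> C"
    "\<And>h f g. \<lbrakk>0 < \<bar>h\<bar>; \<bar>h\<bar> < 1; f \<in> borel_measurable borel; g \<in> borel_measurable borel; p_mass a f \<le> 1; p_mass b g \<le> 1\<rbrakk>
      \<Longrightarrow> p_mass c (A1 (\<lambda>x. f x - f (x - h)) g) \<le> ennreal (C * \<bar>h\<bar> powr \<eta>)"
proof -
  obtain e where e: "0 < e" "e < a" "e < b" and c: "0 < c" "c < 1"
    and bdd: "A1_bounded (a + e) b c" "A1_bounded (a - e) b c" "A1_bounded a (b + e) c" "A1_bounded a (b - e) c"
    using interior_R1_cases[OF assms] by metis
  have pos: "0 < a" "0 < b" "0 < a + e" "0 < a - e" "0 < b + e" "0 < b - e" using e by auto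
  obtain K1 where K1: "mass_bound K1 (a + e) b c"
    by (rule mass_bound_exists[OF bdd(1) pos(3,2) c(1)])
  obtain K2 where K2: "mass_bound K2 (a - e) b c"
    by (rule mass_bound_exists[OF bdd(2) pos(4,2) c(1)])
  obtain K3 where K3: "mass_bound K3 a (b + e) c"
    by (rule mass_bound_exists[OF bdd(3) pos(1,5) c(1)])
  obtain K4 where K4: "mass_bound K4 a (b - e) c"
    by (rule mass_bound_exists[OF bdd(4) pos(1,6) c(1)])
  have p1: "1 < 1 / c" using c by simp
  obtain \<kappa> C0 :: real where \<kappa>: "0 < \<kappa>" and C0: "0 \<le> C0" and smooth:
    "\<And>h f g V. \<lbrakk>0 < \<bar>h\<bar>; \<bar>h\<bar> < 1; f \<in> borel_measurable borel; g \<in> borel_measurable borel;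
       \<And>y. \<bar>f y\<bar> \<le> 1; \<And>y. \<bar>g y\<bar> \<le> 1; integrable lborel f; integrable lborel g;
       (\<integral>y. \<bar>f y\<bar> \<partial>lborel) \<le> V; (\<integral>y. \<bar>g y\<bar> \<partial>lborel) \<le> V; 1 \<le> V\<rbrakk>
     \<Longrightarrow> (\<integral>\<^sup>+x. ennreal (\<bar>A1 (\<lambda>y. f y - f (y - h)) g x\<bar> powr (1 / c)) \<partial>lborel) \<le> ennreal (C0 * \<bar>h\<bar> powr \<kappa> * V\<^sup>2)"
    apply (rule smoothing_Lr[OF p1])
    subgoal premises prems by (rule that) (fact prems)+
    done
  \<comment> \<open>The power of l lost in the term with both middle parts: rescaling both functions
    by l costs l^(2/c), and V^2 with V = l^(1/a + 1/b) costs the rest.\<close>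
  define E where "E = 2 / c + 2 / a + 2 / b"
  have E: "0 < E" using c pos by (simp add: E_def add_pos_pos)
  \<comment> \<open>s1 to s4 are the decay exponents in l: the gain from cutting one function,
    raised to the power with which its mass enters \<open>mass_bound\<close>.\<close>
  define s1 where "s1 = (1 / a - 1 / (a + e)) * ((a + e) / c)"
  define s2 where "s2 = (1 / (a - e) - 1 / a) * ((a - e) / c)"
  define s3 where "s3 = (1 / b - 1 / (b + e)) * ((b + e) / c)"
  define s4 where "s4 = (1 / (b - e) - 1 / b) * ((b - e) / c)"
  have fr: "0 < 1 / x - 1 / y" if "0 < x" "x < y" for x y :: real using that by (simp add: frac_less2)
  have s: "0 < s1" "0 < s2" "0 < s3" "0 < s4"
    unfolding s1_def s2_def s3_def s4_def using pos c e by (intro mult_pos_pos fr divide_pos_pos; simp)+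
  define \<nu> where "\<nu> = min (min s1 s2) (min s3 s4)"
  have \<nu>: "0 < \<nu>" "\<nu> \<le> s1" "\<nu> \<le> s2" "\<nu> \<le> s3" "\<nu> \<le> s4" using s by (auto simp: \<nu>_def)
  define \<eta> where "\<eta> = min (\<nu> * (\<kappa> / (2 * E))) (\<kappa> / 2)"
  have \<eta>: "0 < \<eta>" "\<eta> \<le> \<nu> * (\<kappa> / (2 * E))" "\<eta> \<le> \<kappa> / 2"
    unfolding \<eta>_def using \<nu> \<kappa> E by (simp_all only: min_less_iff_conj min.cobounded1 min.cobounded2) (simp add: mult_pos_pos)
  define m where "m = (2::real) powr (1 / c)"
  define D1 where "D1 = K1 * (2 powr (1 / (a + e) + 1)) powr ((a + e) / c)"
  define D2 where "D2 = K2 * (2 powr (1 / (a - e) + 1)) powr ((a - e) / c)"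
  define D3 where "D3 = K3 * (2 powr (1 / a + 1)) powr (a / c)"
  define D4 where "D4 = K4 * (2 powr (1 / a + 1)) powr (a / c)"
  have D: "0 \<le> D1" "0 \<le> D2" "0 \<le> D3" "0 \<le> D4" using K1 K2 K3 K4 by (simp_all add: mass_bound_def D1_def D2_def D3_def D4_def)
  have m0: "0 \<le> m" by (simp add: m_def)
  show thesis
  proof (rule that[OF \<eta>(1)])
    show "0 \<le> m * (D1 + m * (D2 + m * (D3 + m * (D4 + C0))))" using D m0 C0 by simp
    fix h :: real and f g :: "real \<Rightarrow> real"
    assume h: "0 < \<bar>h\<bar>" "\<bar>h\<bar> < 1" and meas[measurable]: "f \<in> borel_measurable borel" "g \<in> borel_measurable borel"
      and Nf: "p_mass a f \<le> 1" and Ng: "p_mass b g \<le> 1"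
    \<comment> \<open>This choice makes l^E = |h|^(-\<kappa>/2), so half of the gain |h|^\<kappa> is
      left in the middle term, while the other terms decay like a positive power of |h|.\<close>
    define l where "l = \<bar>h\<bar> powr (- (\<kappa> / (2 * E)))"
    define H where "H = \<bar>h\<bar> powr \<eta>"
    have l: "1 \<le> l"
    proof -
      have "\<bar>h\<bar> powr (\<kappa> / (2 * E)) \<le> 1" using h \<kappa> E by (intro powr_le1) auto
      moreover have "0 < \<bar>h\<bar> powr (\<kappa> / (2 * E))" using h by simp
      ultimately show ?thesis by (simp add: l_def powr_minus one_le_inverse)
    qed
    have H0: "0 \<le> H" by (simp add: H_def)
    have decay: "l powr (- s) \<le> H" if "\<nu> \<le> s" for s
    proof -
      have "l powr (- s) \<le> l powr (- \<nu>)" using that l by (intro powr_mono) auto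
      also have "\<dots> = \<bar>h\<bar> powr (\<nu> * (\<kappa> / (2 * E)))" by (simp add: l_def powr_powr mult.commute)
      also have "\<dots> \<le> H" unfolding H_def using h \<eta>(2) by (intro powr_mono') auto
      finally show ?thesis .
    qed
    define \<Delta> where "\<Delta> u x = u x - u (x - h)" for u :: "real \<Rightarrow> real" and x
    have m\<Delta>[measurable]: "\<Delta> u \<in> borel_measurable borel" if [measurable]: "u \<in> borel_measurable borel" for u
      unfolding \<Delta>_def by measurable
    let ?L = "cut_large l" and ?S = "cut_small l" and ?M = "cut_mid l"
    have N\<Delta>: "p_mass s (\<Delta> u) \<le> ennreal (2 powr (1 / s + 1) * X)"
      if "u \<in> borel_measurable borel" "0 < s" "p_mass s u \<le> ennreal X" "0 \<le> X" for s u X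
    proof -
      have "p_mass s (\<Delta> u) \<le> ennreal (2 powr (1 / s + 1)) * p_mass s u"
        unfolding \<Delta>_def by (rule p_mass_translate_diff[OF that(1,2)])
      also have "\<dots> \<le> ennreal (2 powr (1 / s + 1)) * ennreal X" by (intro mult_left_mono that) simp
      finally show ?thesis using that by (simp add: ennreal_mult)
    qed
    have Ng1: "p_mass b g \<le> ennreal 1" using Ng by simp
    have NM: "p_mass a (?M f) \<le> ennreal 1" "p_mass b (?M g) \<le> ennreal 1"
      using order_trans[OF p_mass_mono[OF pos(1), of "?M f" f] Nf] order_trans[OF p_mass_mono[OF pos(2), of "?M g" g] Ng]
      by (auto simp: cut_mid_def)
    note cf = p_mass_cut[OF meas(1) Nf pos(1) e(1) e(2) l] and cg = p_mass_cut[OF meas(2) Ng pos(2) e(1) e(3) l]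
    have NL: "p_mass (a + e) (\<Delta> (?L f)) \<le> ennreal (2 powr (1 / (a + e) + 1) * l powr (1 / (a + e) - 1 / a))"
      by (rule N\<Delta>[OF _ pos(3) cf(1)]) simp_all
    have NS: "p_mass (a - e) (\<Delta> (?S f)) \<le> ennreal (2 powr (1 / (a - e) + 1) * l powr (1 / a - 1 / (a - e)))"
      by (rule N\<Delta>[OF _ pos(4) cf(2)]) simp_all
    have N\<Delta>M: "p_mass a (\<Delta> (?M f)) \<le> ennreal (2 powr (1 / a + 1))"
      using N\<Delta>[OF _ pos(1) NM(1)] by simp
    have T1: "p_mass c (A1 (\<Delta> (?L f)) g) \<le> ennreal (D1 * H)"
    proof -
      have "p_mass c (A1 (\<Delta> (?L f)) g) \<le> ennreal (K1 * (2 powr (1 / (a + e) + 1) * l powr (1 / (a + e) - 1 / a)) powr ((a + e) / c) * 1 powr (b / c))"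
        by (rule mass_boundD(1)[OF K1 _ _ _ _ NL Ng1]) simp_all
      also have "(2 powr (1 / (a + e) + 1) * l powr (1 / (a + e) - 1 / a)) powr ((a + e) / c) = (2 powr (1 / (a + e) + 1)) powr ((a + e) / c) * l powr (- s1)"
        unfolding powr_mult powr_powr s1_def by (simp add: algebra_simps)
      also have "K1 * ((2 powr (1 / (a + e) + 1)) powr ((a + e) / c) * l powr (- s1)) * 1 powr (b / c) = D1 * l powr (- s1)" by (simp add: D1_def)
      also have "ennreal (D1 * l powr (- s1)) \<le> ennreal (D1 * H)" by (intro ennreal_leI mult_left_mono decay \<nu> D)
      finally show ?thesis .
    qed
    have T2: "p_mass c (A1 (\<Delta> (?S f)) g) \<le> ennreal (D2 * H)"
    proof -
      have "p_mass c (A1 (\<Delta> (?S f)) g) \<le> ennreal (K2 * (2 powr (1 / (a - e) + 1) * l powr (1 / a - 1 / (a - e))) powr ((a - e) / c) * 1 powr (b / c))"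
        by (rule mass_boundD(1)[OF K2 _ _ _ _ NS Ng1]) simp_all
      also have "(2 powr (1 / (a - e) + 1) * l powr (1 / a - 1 / (a - e))) powr ((a - e) / c) = (2 powr (1 / (a - e) + 1)) powr ((a - e) / c) * l powr (- s2)"
        unfolding powr_mult powr_powr s2_def by (simp add: algebra_simps)
      also have "K2 * ((2 powr (1 / (a - e) + 1)) powr ((a - e) / c) * l powr (- s2)) * 1 powr (b / c) = D2 * l powr (- s2)" by (simp add: D2_def)
      also have "ennreal (D2 * l powr (- s2)) \<le> ennreal (D2 * H)" by (intro ennreal_leI mult_left_mono decay \<nu> D)
      finally show ?thesis .
    qed
    have T3: "p_mass c (A1 (\<Delta> (?M f)) (?L g)) \<le> ennreal (D3 * H)"
    proof -
      have "p_mass c (A1 (\<Delta> (?M f)) (?L g)) \<le> ennreal (K3 * (2 powr (1 / a + 1)) powr (a / c) * (l powr (1 / (b + e) - 1 / b)) powr ((b + e) / c))"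
        by (rule mass_boundD(1)[OF K3 _ _ _ _ N\<Delta>M cg(1)]) simp_all
      also have "(l powr (1 / (b + e) - 1 / b)) powr ((b + e) / c) = l powr (- s3)"
        unfolding powr_powr s3_def by (simp add: algebra_simps)
      also have "ennreal (K3 * (2 powr (1 / a + 1)) powr (a / c) * l powr (- s3)) \<le> ennreal (D3 * H)"
        unfolding D3_def[symmetric] by (intro ennreal_leI mult_left_mono decay \<nu> D)
      finally show ?thesis .
    qed
    have T4: "p_mass c (A1 (\<Delta> (?M f)) (?S g)) \<le> ennreal (D4 * H)"
    proof -
      have "p_mass c (A1 (\<Delta> (?M f)) (?S g)) \<le> ennreal (K4 * (2 powr (1 / a + 1)) powr (a / c) * (l powr (1 / b - 1 / (b - e))) powr ((b - e) / c))"
        by (rule mass_boundD(1)[OF K4 _ _ _ _ N\<Delta>M cg(2)]) simp_all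
      also have "(l powr (1 / b - 1 / (b - e))) powr ((b - e) / c) = l powr (- s4)"
        unfolding powr_powr s4_def by (simp add: algebra_simps)
      also have "ennreal (K4 * (2 powr (1 / a + 1)) powr (a / c) * l powr (- s4)) \<le> ennreal (D4 * H)"
        unfolding D4_def[symmetric] by (intro ennreal_leI mult_left_mono decay \<nu> D)
      finally show ?thesis .
    qed
    define u where "u y = ?M f y / l" for y
    define w where "w y = ?M g y / l" for y
    have T5: "p_mass c (A1 (\<Delta> (?M f)) (?M g)) \<le> ennreal (C0 * H)"
    proof -
      have [measurable]: "u \<in> borel_measurable borel" "w \<in> borel_measurable borel" unfolding u_def w_def by measurable
      define V where "V = l powr (1 / a + 1 / b)"
      note bu = cut_mid_bounds[OF meas(1) Nf pos(1) l, folded u_def] and bw = cut_mid_bounds[OF meas(2) Ng pos(2) l, folded w_def]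
      have lV: "l powr (1 / a) \<le> V" "l powr (1 / b) \<le> V" "1 \<le> V"
        unfolding V_def using l pos by (auto intro!: powr_mono ge_one_powr_ge_zero add_nonneg_nonneg)
      have "p_mass c (A1 (\<lambda>y. u y - u (y - h)) w) \<le> ennreal (C0 * \<bar>h\<bar> powr \<kappa> * V\<^sup>2)"
        unfolding p_mass_def
        by (rule smooth[OF h _ _ bu(1) bw(1) bu(2) bw(2) order_trans[OF bu(3) lV(1)] order_trans[OF bw(3) lV(2)] lV(3)]) measurable
      moreover have "A1 (\<Delta> (?M f)) (?M g) = (\<lambda>x. l\<^sup>2 * A1 (\<lambda>y. u y - u (y - h)) w x)"
      proof
        fix x
        have "A1 (\<Delta> (?M f)) (?M g) x = A1 (\<lambda>y. l * (u y - u (y - h))) (\<lambda>y. l * w y) x"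
          using l by (simp add: \<Delta>_def[abs_def] u_def w_def right_diff_distrib)
        then show "A1 (\<Delta> (?M f)) (?M g) x = l\<^sup>2 * A1 (\<lambda>y. u y - u (y - h)) w x" by (simp add: A1_scale power2_eq_square)
      qed
      ultimately have "p_mass c (A1 (\<Delta> (?M f)) (?M g)) \<le> ennreal (\<bar>l\<^sup>2\<bar> powr (1 / c)) * ennreal (C0 * \<bar>h\<bar> powr \<kappa> * V\<^sup>2)"
        by (simp only:) (subst p_mass_scale, measurable, intro mult_left_mono, simp_all)
      also have "\<dots> = ennreal (\<bar>l\<^sup>2\<bar> powr (1 / c) * (C0 * \<bar>h\<bar> powr \<kappa> * V\<^sup>2))"
        using C0 by (simp add: ennreal_mult)
      also have "\<bar>l\<^sup>2\<bar> powr (1 / c) * (C0 * \<bar>h\<bar> powr \<kappa> * V\<^sup>2) = C0 * (\<bar>h\<bar> powr \<kappa> * l powr E)"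
      proof -
        have l2: "l\<^sup>2 = l powr 2" using l by simp
        have "V\<^sup>2 = V powr 2" using lV by simp
        then have "\<bar>l\<^sup>2\<bar> powr (1 / c) * V\<^sup>2 = l powr (2 / c) * l powr (2 * (1 / a + 1 / b))"
          by (simp add: l2 V_def powr_powr mult.commute)
        also have "\<dots> = l powr E" by (simp add: E_def distrib_left add.assoc flip: powr_add)
        finally show ?thesis by (simp add: mult_ac)
      qed
      also have "\<bar>h\<bar> powr \<kappa> * l powr E = \<bar>h\<bar> powr (\<kappa> / 2)"
        using E h by (simp add: l_def powr_powr flip: powr_add)
      also have "ennreal (C0 * \<bar>h\<bar> powr (\<kappa> / 2)) \<le> ennreal (C0 * H)"
        unfolding H_def using h \<eta>(3) C0 by (intro ennreal_leI mult_left_mono powr_mono') auto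
      finally show ?thesis .
    qed
    \<comment> \<open>Additivity of \<open>A1\<close> holds at those x where all five integrals
      converge. For four of the terms this is known almost everywhere from boundedness at the
      respective exponents; in the fifth both factors are bounded.\<close>
    have ae: "AE x in lborel. A1 (\<Delta> f) g x = A1 (\<Delta> (?L f)) g x + (A1 (\<Delta> (?S f)) g x + (A1 (\<Delta> (?M f)) (?L g) x
        + (A1 (\<Delta> (?M f)) (?S g) x + A1 (\<Delta> (?M f)) (?M g) x)))"
    proof -
      have i1: "AE x in lborel. set_integrable lborel {0..2*pi} (\<lambda>t. \<Delta> (?L f) (x - cos t) * g (x - sin t))"
        by (rule mass_boundD(2)[OF K1 _ _ _ _ NL Ng1]) simp_all
      have i2: "AE x in lborel. set_integrable lborel {0..2*pi} (\<lambda>t. \<Delta> (?S f) (x - cos t) * g (x - sin t))"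
        by (rule mass_boundD(2)[OF K2 _ _ _ _ NS Ng1]) simp_all
      have i3: "AE x in lborel. set_integrable lborel {0..2*pi} (\<lambda>t. \<Delta> (?M f) (x - cos t) * ?L g (x - sin t))"
        by (rule mass_boundD(2)[OF K3 _ _ _ _ N\<Delta>M cg(1)]) simp_all
      have i4: "AE x in lborel. set_integrable lborel {0..2*pi} (\<lambda>t. \<Delta> (?M f) (x - cos t) * ?S g (x - sin t))"
        by (rule mass_boundD(2)[OF K4 _ _ _ _ N\<Delta>M cg(2)]) simp_all
      have i5: "set_integrable lborel {0..2*pi} (\<lambda>t. \<Delta> (?M f) (x - cos t) * ?M g (x - sin t))" for x
      proof (rule set_integrable_bounded[where C = "(l + l) * l"])
        have M: "\<bar>?M k y\<bar> \<le> l" for k y using l by (simp add: cut_mid_def)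
        have "\<bar>\<Delta> (?M f) y\<bar> \<le> l + l" for y unfolding \<Delta>_def using M[of f y] M[of f "y - h"] by linarith
        then show "\<bar>\<Delta> (?M f) (x - cos t) * ?M g (x - sin t)\<bar> \<le> (l + l) * l" for t by (intro abs_mult_le M)
      qed measurable
      have split: "\<Delta> f y * g z = \<Delta> (?L f) y * g z + (\<Delta> (?S f) y * g z + (\<Delta> (?M f) y * ?L g z + (\<Delta> (?M f) y * ?S g z + \<Delta> (?M f) y * ?M g z)))" for y z
      proof -
        have "\<Delta> f y = \<Delta> (?L f) y + \<Delta> (?S f) y + \<Delta> (?M f) y"
          unfolding \<Delta>_def using cut_sum[OF l, of f y] cut_sum[OF l, of f "y - h"] by linarith
        moreover have "g z = ?L g z + ?S g z + ?M g z" by (rule cut_sum[OF l])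
        then have "\<Delta> (?M f) y * g z = \<Delta> (?M f) y * ?L g z + (\<Delta> (?M f) y * ?S g z + \<Delta> (?M f) y * ?M g z)"
          by (simp only: distrib_left add.assoc)
        ultimately show ?thesis by (simp only: distrib_right add.assoc)
      qed
      show ?thesis
        using i1 i2 i3 i4
      proof eventually_elim
        case (elim x)
        show ?case
          unfolding A1_def split using elim i5[of x] by (simp add: set_integral_add)
      qed
    qed
    have "p_mass c (A1 (\<Delta> f) g) = p_mass c (\<lambda>x. A1 (\<Delta> (?L f)) g x + (A1 (\<Delta> (?S f)) g x + (A1 (\<Delta> (?M f)) (?L g) x
        + (A1 (\<Delta> (?M f)) (?S g) x + A1 (\<Delta> (?M f)) (?M g) x))))" by (rule p_mass_cong_AE[OF ae])
    also have "\<dots> \<le> ennreal (m * (D1 + m * (D2 + m * (D3 + m * (D4 + C0)))) * H)"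
      unfolding m_def
      by (intro p_mass_add_le[OF _ _ c(1) T1] p_mass_add_le[OF _ _ c(1) T2] p_mass_add_le[OF _ _ c(1) T3] p_mass_add_le[OF _ _ c(1) T4 T5])
        (use D C0 H0 in simp_all)
    finally show "p_mass c (A1 (\<lambda>x. f x - f (x - h)) g) \<le> ennreal (m * (D1 + m * (D2 + m * (D3 + m * (D4 + C0)))) * \<bar>h\<bar> powr \<eta>)"
      by (simp add: H_def \<Delta>_def[abs_def])
  qed
qed

section \<open>Removing the normalisation by homogeneity\<close>

theorem theorem3p1:
  fixes a b c :: real
  assumes "(a, b, c) \<in> interior R1"
  shows "\<exists>\<eta>>0. \<exists>C::real. \<forall>h f1 f2. \<bar>h\<bar> < 1 \<longrightarrow> in_Lp a f1 \<longrightarrow> in_Lp b f2 \<longrightarrow>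
           lpnorm c (A1 (\<lambda>x. f1 x - f1 (x - h)) f2)
             \<le> ennreal (C * \<bar>h\<bar> powr \<eta>) * lpnorm a f1 * lpnorm b f2"
proof -
  obtain e where "0 < e" "e < a" "e < b" and c: "0 < c" "c < 1"
    using interior_R1_cases[OF assms] by metis
  then have ab: "0 < a" "0 < b" by auto
  obtain \<eta> C :: real where \<eta>: "0 < \<eta>" and C: "0 \<le> C" and main:
    "\<And>h f g. \<lbrakk>0 < \<bar>h\<bar>; \<bar>h\<bar> < 1; f \<in> borel_measurable borel; g \<in> borel_measurable borel; p_mass a f \<le> 1; p_mass b g \<le> 1\<rbrakk>
      \<Longrightarrow> p_mass c (A1 (\<lambda>x. f x - f (x - h)) g) \<le> ennreal (C * \<bar>h\<bar> powr \<eta>)"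
    apply (rule normalized_bound[OF assms])
    subgoal premises prems by (rule that) (fact prems)+
    done
  have bdd: "A1_bounded a b c" using assms interior_subset by (auto simp: R1_def)
  obtain K where K: "mass_bound K a b c"
    by (rule mass_bound_exists[OF bdd ab c(1)])
  have zero: "lpnorm c u = 0" if "p_mass c u = 0" for u
    using lpnorm_le_iff[OF c(1), of 0 u] that by simp
  \<comment> \<open>The mass is the norm to the power 1/c, so passing back to norms replaces C and
    \<eta> by \<open>C powr c\<close> and \<open>\<eta> * c\<close>.\<close>
  have "lpnorm c (A1 (\<lambda>x. f1 x - f1 (x - h)) f2) \<le> ennreal (C powr c * \<bar>h\<bar> powr (\<eta> * c)) * lpnorm a f1 * lpnorm b f2"
    if h: "\<bar>h\<bar> < 1" and f1: "in_Lp a f1" and f2: "in_Lp b f2" for h f1 f2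
  proof -
    have [measurable]: "f1 \<in> borel_measurable borel" "f2 \<in> borel_measurable borel" using f1 f2 by (auto simp: in_Lp_def)
    obtain X where X: "p_mass a f1 = ennreal X" "0 \<le> X" using f1 lpnorm_finite_iff[of a f1] ab by (cases "p_mass a f1") (auto simp: in_Lp_def)
    obtain Y where Y: "p_mass b f2 = ennreal Y" "0 \<le> Y" using f2 lpnorm_finite_iff[of b f2] ab by (cases "p_mass b f2") (auto simp: in_Lp_def)
    have nX: "lpnorm a f1 = ennreal (X powr a)" using ab X by (simp add: lpnorm_def enn_powr_def flip: p_mass_def)
    have nY: "lpnorm b f2 = ennreal (Y powr b)" using ab Y by (simp add: lpnorm_def enn_powr_def flip: p_mass_def)
    define F where "F x = f1 x - f1 (x - h)" for x
    have [measurable]: "F \<in> borel_measurable borel" unfolding F_def by measurable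
    have NF: "p_mass a F \<le> ennreal (2 powr (1 / a + 1) * X)"
      using p_mass_translate_diff[of f1 a h] ab X by (simp add: F_def[abs_def] ennreal_mult)
    show ?thesis
    proof (cases "h = 0 \<or> X = 0 \<or> Y = 0")
      case True
      \<comment> \<open>At h = 0 the right-hand side is 0 because \<open>0 powr\<close> of anything
        is 0, and a function of mass 0 cannot be normalised. In all these cases the left-hand side
        has to vanish exactly.\<close>
      have "p_mass c (A1 F f2) = 0"
      proof (cases "h = 0")
        case True
        then have "A1 F f2 = (\<lambda>x. 0)" by (auto simp: A1_def F_def)
        then show ?thesis using c by (simp add: p_mass_def)
      next
        case False
        have "p_mass c (A1 F f2) \<le> ennreal (K * (2 powr (1 / a + 1) * X) powr (a / c) * Y powr (b / c))"
          using X Y by (intro mass_boundD(1)[OF K] NF) auto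
        also have "\<dots> = 0" using False True by auto
        finally show ?thesis by simp
      qed
      then show ?thesis using zero by (simp add: F_def[abs_def])
    next
      case False
      then have pos: "0 < \<bar>h\<bar>" "0 < X powr a" "0 < Y powr b" using X Y by auto
      define f where "f x = (1 / X powr a) * f1 x" for x
      define g where "g x = (1 / Y powr b) * f2 x" for x
      have [measurable]: "f \<in> borel_measurable borel" "g \<in> borel_measurable borel" unfolding f_def g_def by measurable
      have "p_mass a f = ennreal ((1 / X powr a) powr (1 / a) * X)" "p_mass b g = ennreal ((1 / Y powr b) powr (1 / b) * Y)"
        unfolding f_def g_def by (subst p_mass_scale; simp add: X Y ennreal_mult)+
      moreover have "(1 / X powr a) powr (1 / a) * X = 1" "(1 / Y powr b) powr (1 / b) * Y = 1"
        using False X Y ab by (simp_all add: powr_divide powr_powr)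
      ultimately have "p_mass a f \<le> 1" "p_mass b g \<le> 1" by simp_all
      from main[OF pos(1) h _ _ this] have N: "p_mass c (A1 (\<lambda>x. f x - f (x - h)) g) \<le> ennreal (C * \<bar>h\<bar> powr \<eta>)" by simp
      have eq: "A1 F f2 = (\<lambda>x. (X powr a * Y powr b) * A1 (\<lambda>x. f x - f (x - h)) g x)"
      proof
        fix x
        have "A1 F f2 x = A1 (\<lambda>y. X powr a * (f y - f (y - h))) (\<lambda>y. Y powr b * g y) x"
          using pos by (simp add: F_def[abs_def] f_def g_def right_diff_distrib)
        then show "A1 F f2 x = (X powr a * Y powr b) * A1 (\<lambda>x. f x - f (x - h)) g x" by (simp only: A1_scale)
      qed
      have "p_mass c (A1 F f2) \<le> ennreal (\<bar>X powr a * Y powr b\<bar> powr (1 / c)) * ennreal (C * \<bar>h\<bar> powr \<eta>)"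
        unfolding eq by (subst p_mass_scale) (measurable, intro mult_left_mono N, simp)
      also have "\<dots> = ennreal ((X powr a * Y powr b) powr (1 / c) * (C * \<bar>h\<bar> powr \<eta>))"
        using C pos by (simp add: ennreal_mult abs_mult)
      also have "(X powr a * Y powr b) powr (1 / c) * (C * \<bar>h\<bar> powr \<eta>) = (X powr a * Y powr b * (C powr c * \<bar>h\<bar> powr (\<eta> * c))) powr (1 / c)"
        using c C by (simp add: powr_mult powr_powr)
      finally have "lpnorm c (A1 F f2) \<le> ennreal (X powr a * Y powr b * (C powr c * \<bar>h\<bar> powr (\<eta> * c)))"
        using c by (subst lpnorm_le_iff) auto
      also have "\<dots> = ennreal (C powr c * \<bar>h\<bar> powr (\<eta> * c)) * lpnorm a f1 * lpnorm b f2"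
        by (simp add: nX nY ennreal_mult mult_ac)
      finally show ?thesis by (simp add: F_def[abs_def])
    qed
  qed
  moreover have "0 < \<eta> * c" using \<eta> c by simp
  ultimately show ?thesis by blast
qed

end
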